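(* Let $k$ be a field and let homology be taken with coefficients in $k$. Let $X$ be a compact topological space, let $(Y,d)$ be a metric space, and let $f\colon X\to Y$ be a continuous map such that $H_\bullet(f^{-1}(V))=\bigoplus_{n\ge 0}H_n(f^{-1}(V))$ is finite-dimensional for every open $V\subseteq Y$. Let $\mathcal{U}=(U_i)_{i\in I}$ be a finite 1D cover of $f(X)$, i.e. a finite family of open subsets of $Y$ covering $f(X)$ whose nerve complex $\mathcal{N}_\mathcal{U}$ is one-dimensional. Assume that the precosheaves $\mathcal{L}^f$ and $C_\mathcal{U}D_\mathcal{U}\mathcal{L}^f$ on $Y$ (the Leray precosheaf of $f$, and the continuous extension of the cellular Leray cosheaf of $f$ with respect to $\mathcal{U}$) are constructible. Then $$d\big(C_\mathcal{U}D_\mathcal{U}\mathcal{L}^f,\ \mathcal{L}^f\big)\ \le\ \mathrm{res}(\mathcal{U}),$$ where $d$ is the interleaving distance of precosheaves on $Y$ and $\mathrm{res}(\mathcal{U})=\sup_{U\in\mathcal{U}}\sup_{x,y\in U}d(x,y)$.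
   Context: A precosheaf on $Y$ is a covariant functor from the poset of open subsets of $Y$ (ordered by inclusion) to graded $k$-vector spaces; morphisms of precosheaves are natural transformations (degree-preserving). $H_n$ denotes singular homology with coefficients in the field $k$. **Leray precosheaf.** For open $V\subseteq W\subseteq Y$, $\mathcal{L}^f(V)=\bigoplus_{n\ge 0}\mathcal{L}^f_n(V)$ with $\mathcal{L}^f_n(V):=H_n(f^{-1}(V))$, and $\mathcal{L}^f(V\subseteq W)=\bigoplus_n \mathcal{L}^f_n(V\subseteq W)$, where $\mathcal{L}^f_n(V\subseteq W)$ is the map on $H_n$ induced by the inclusion $f^{-1}(V)\subseteq f^{-1}(W)$. **Nerve.** $\mathcal{N}_\mathcal{U}$ is the simplicial complex of all $\sigma=(i_0,\dots,i_k)$ with $U_\sigma:=U_{i_0}\cap\dots\cap U_{i_k}\neq\emptyset$. Write $\sigma\le\tau$ if $\sigma$ is a face of $\tau$. **Cellular Leray cosheaf.** $D_\mathcal{U}\mathcal{L}^f$ assigns to each $\sigma\in\mathcal{N}_\mathcal{U}$ the space $D_\mathcal{U}\mathcal{L}^f(\sigma):=\mathcal{L}^f(U_\sigma)$ and to each $\sigma\le\tau$ the map $\mathcal{L}^f(U_\tau\subseteq U_\sigma)\colon \mathcal{L}^f(U_\tau)\to\mathcal{L}^f(U_\sigma)$. Its degree-$n$ part is $D_\mathcal{U}\mathcal{L}^f_n(\sigma)=\mathcal{L}^f_n(U_\sigma)$; set $D_\mathcal{U}\mathcal{L}^f_{-1}:=0$. **Cosheaf homology.** For a subcomplex $K\le\mathcal{N}_\mathcal{U}$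 and a cellular cosheaf $F$ (vector spaces $F(\sigma)$ with functorial maps $F(\sigma\le\tau)\colon F(\tau)\to F(\sigma)$), $H_i(K;F|_K)$ is the $i$-th homology of the chain complex with $i$-chains $\bigoplus_{\sigma\in K,\ \dim\sigma=i}F(\sigma)$ and boundary, on the summand $F(\tau)$, equal to $\sum_{\sigma}[\sigma:\tau]\,F(\sigma\le\tau)$, summing over codimension-one faces $\sigma$ of $\tau$, with $[\sigma:\tau]=\pm1$ the usual simplicial incidence signs for a fixed orientation. An inclusion of subcomplexes $\iota\colon K\hookrightarrow K'$ induces an inclusion of chain complexes and hence maps $H_i(\iota)\colon H_i(K;F|_K)\to H_i(K';F|_{K'})$; write $H_i(\iota)_n$ for this map when $F=D_\mathcal{U}\mathcal{L}^f_n$. **Continuous extension.** For open $V\subseteq Y$ let $K_V:=\{\sigma\in\mathcal{N}_\mathcal{U}\mid U_\sigma\cap V\ne\emptyset\}$, a subcomplex of $\mathcal{N}_\mathcal{U}$; for $V\subseteq W$ there is an inclusion $\iota\colon K_V\hookrightarrow K_W$. The precosheaf $C_\mathcal{U}D_\mathcal{U}\mathcal{L}^f$ on $Y$ is defined by $$C_\mathcal{U}D_\mathcal{U}\mathcal{L}^f(V):=\bigoplus_{n\ge 0}\Big(H_0\big(K_V;D_\mathcal{U}\mathcal{L}^f_n|_{K_V}\big)\oplus H_1\big(K_V;D_\mathcal{U}\mathcal{L}^f_{n-1}|_{K_V}\big)\Big),$$ $$C_\mathcal{U}D_\mathcal{U}\mathcal{L}^f(V\subseteq W):=\bigoplus_{n\ge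 0}\big(H_0(\iota)_n\oplus H_1(\iota)_{n-1}\big),$$ the $n$-th summand being the degree-$n$ part. **Distance.** For open $V\subseteq Y$ and $\epsilon>0$ let $V^\epsilon:=\{y\in Y\mid d(y,V)<\epsilon\}$, and $V^0:=V$. For a precosheaf $F$ on $Y$ and $\epsilon\ge0$ let $F^\epsilon$ be the precosheaf $F^\epsilon(V):=F(V^\epsilon)$, and for $\epsilon\le\delta$ let $F_\epsilon^\delta\colon F^\epsilon\to F^\delta$ be given by the maps $F(V^\epsilon\subseteq V^\delta)$. For $\epsilon\ge 0$, an $\epsilon$-interleaving of $F^\bullet$ and $G^\bullet$ consists of morphisms of precosheaves $\varphi^a\colon F^a\to G^{a+\epsilon}$ and $\psi^a\colon G^a\to F^{a+\epsilon}$ for all $a\ge0$ such that, for all $0\le a\le b$, $\varphi^b\circ F_a^b=G_{a+\epsilon}^{b+\epsilon}\circ\varphi^a$, $\psi^b\circ G_a^b=F_{a+\epsilon}^{b+\epsilon}\circ\psi^a$, $\psi^{a+\epsilon}\circ\varphi^a=F_a^{a+2\epsilon}$ and $\varphi^{a+\epsilon}\circ\psi^a=G_a^{a+2\epsilon}$. Then $d(F,G):=d_I(F^\bullet,G^\bullet):=\inf\{\epsilon\ge0\mid F^\bullet\text{ and }G^\bullet\text{ admit an }\epsilon\text{-interleaving}\}\in[0,\infty]$. **Constructibility.** A (pre)cosheaf on $Y$ is constructible if there is a stratification of $Y$ such that its restriction to each stratum is locally constant with finite-dimensional costalks (the costalk of $F$ at $y$ being the limit of $F(V)$ over open $V\ni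 y$). *)

theory Defs
  imports
    "HOL-Homology.Homology"
    "HOL-Algebra.Module"
    "HOL-Algebra.Algebraic_Closure_Type"
    "HOL-Analysis.Analysis"
begin

text \<open>Frees the identifier \<open>X\<close>.\<close>

no_notation Polynomials.var (\<open>X\<index>\<close>)

section \<open>Vector spaces\<close>

text \<open>
  The field is a type of class \<open>field\<close>; vector spaces over it are modules, in the
  sense of the locale \<open>module\<close>, over the ring \<open>ring_of_type_algebra\<close> of that type. The inherited record fields
  \<open>mult\<close> and \<open>one\<close> play no role and are left undefined.
\<close>

type_synonym ('k, 'v) vs = "('k, 'v) module"

abbreviation vector_space_over :: "('k::field, 'v) vs \<Rightarrow> bool" where
  "vector_space_over M \<equiv> module (ring_of_type_algebra :: 'k ring) M"

definition fin_dim :: "('k::field, 'v) vs \<Rightarrow> bool" where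
  "fin_dim M \<longleftrightarrow>
     (\<exists>A. finite A \<and> A \<subseteq> carrier M \<and>
       (\<forall>N. submodule N (ring_of_type_algebra :: 'k ring) M \<and> A \<subseteq> N \<longrightarrow> N = carrier M))"

definition linear_maps :: "('k::field, 'v) vs \<Rightarrow> ('k, 'w) vs \<Rightarrow> ('v \<Rightarrow> 'w) set" where
  "linear_maps M N =
     {h. h \<in> carrier M \<rightarrow> carrier N \<and>
         (\<forall>x\<in>carrier M. \<forall>y\<in>carrier M. h (x \<oplus>\<^bsub>M\<^esub> y) = h x \<oplus>\<^bsub>N\<^esub> h y) \<and>
         (\<forall>a. \<forall>x\<in>carrier M. h (a \<odot>\<^bsub>M\<^esub> x) = a \<odot>\<^bsub>N\<^esub> h x)}"

definition zero_vs :: "('k, 'v) vs" where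
  "zero_vs = \<lparr>carrier = {undefined}, monoid.mult = undefined, one = undefined,
     ring.zero = undefined, add = (\<lambda>_ _. undefined), module.smult = (\<lambda>_ _. undefined)\<rparr>"

definition prod_vs :: "('k, 'v) vs \<Rightarrow> ('k, 'w) vs \<Rightarrow> ('k, 'v \<times> 'w) vs" where
  "prod_vs M N = \<lparr>carrier = carrier M \<times> carrier N, monoid.mult = undefined, one = undefined,
     ring.zero = (\<zero>\<^bsub>M\<^esub>, \<zero>\<^bsub>N\<^esub>),
     add = (\<lambda>x y. (fst x \<oplus>\<^bsub>M\<^esub> fst y, snd x \<oplus>\<^bsub>N\<^esub> snd y)),
     module.smult = (\<lambda>a x. (a \<odot>\<^bsub>M\<^esub> fst x, a \<odot>\<^bsub>N\<^esub> snd x))\<rparr>"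

text \<open>
  The direct sum of the \<open>M j\<close> over \<open>j \<in> J\<close>. Its elements are functions on the whole index type that
  vanish outside \<open>J\<close>; hence for \<open>J \<subseteq> J'\<close> the canonical inclusion of direct sums is the identity
  function.
\<close>

definition direct_sum :: "'j set \<Rightarrow> ('j \<Rightarrow> ('k, 'v) vs) \<Rightarrow> ('k, 'j \<Rightarrow> 'v) vs" where
  "direct_sum J M =
     \<lparr>carrier = {x. (\<forall>j\<in>J. x j \<in> carrier (M j)) \<and> (\<forall>j. j \<notin> J \<longrightarrow> x j = \<zero>\<^bsub>M j\<^esub>) \<and>
                    finite {j. x j \<noteq> \<zero>\<^bsub>M j\<^esub>}},
      monoid.mult = undefined, one = undefined,
      ring.zero = (\<lambda>j. \<zero>\<^bsub>M j\<^esub>),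
      add = (\<lambda>x y j. x j \<oplus>\<^bsub>M j\<^esub> y j),
      module.smult = (\<lambda>a x j. a \<odot>\<^bsub>M j\<^esub> x j)\<rparr>"

text \<open>The quotient \<open>Z / B\<close> of subspaces \<open>B \<subseteq> Z\<close> of \<open>M\<close>, and the map of quotients induced by a
  linear map into a space \<open>M'\<close> that sends \<open>B\<close> into \<open>B'\<close>.\<close>

definition quot_vs :: "('k, 'v) vs \<Rightarrow> 'v set \<Rightarrow> 'v set \<Rightarrow> ('k, 'v set) vs" where
  "quot_vs M Z B =
     \<lparr>carrier = (\<lambda>z. B +>\<^bsub>M\<^esub> z) ` Z, monoid.mult = undefined, one = undefined,
      ring.zero = B,
      add = (\<lambda>C D. C <+>\<^bsub>M\<^esub> D),
      module.smult = (\<lambda>a C. \<Union>z\<in>C. B +>\<^bsub>M\<^esub> (a \<odot>\<^bsub>M\<^esub> z))\<rparr>"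

definition quot_map :: "('k, 'w) vs \<Rightarrow> 'w set \<Rightarrow> ('v \<Rightarrow> 'w) \<Rightarrow> 'v set \<Rightarrow> 'w set" where
  "quot_map M' B' g C = (\<Union>z\<in>C. B' +>\<^bsub>M'\<^esub> g z)"


section \<open>Singular homology with coefficients in a field\<close>

text \<open>
  These are the definitions behind \<open>homology_group\<close>, which has integer coefficients, with coefficients in \<open>'k\<close>.
\<close>

type_synonym ('x, 'k) kchain = "((nat \<Rightarrow> real) \<Rightarrow> 'x) \<Rightarrow>\<^sub>0 'k"

definition sing_chains :: "nat \<Rightarrow> 'x topology \<Rightarrow> ('k::field, ('x, 'k) kchain) vs" where
  "sing_chains p X =
     \<lparr>carrier = {c. Poly_Mapping.keys c \<subseteq> singular_simplex_set p X},
      monoid.mult = undefined, one = undefined,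
      ring.zero = 0, add = (\<lambda>c c'. c + c'),
      module.smult = (\<lambda>a c. Poly_Mapping.map (\<lambda>b. a * b) c)\<rparr>"

definition sing_boundary :: "nat \<Rightarrow> ('x, 'k::field) kchain \<Rightarrow> ('x, 'k) kchain" where
  "sing_boundary p c =
     (if p = 0 then 0
      else \<Sum>s\<in>Poly_Mapping.keys c. \<Sum>j\<le>p.
             Poly_Mapping.single (singular_face p j s) ((- 1) ^ j * Poly_Mapping.lookup c s))"

definition sing_chain_map :: "nat \<Rightarrow> ('x \<Rightarrow> 'z) \<Rightarrow> ('x, 'k::field) kchain \<Rightarrow> ('z, 'k) kchain" where
  "sing_chain_map p g c =
     (\<Sum>s\<in>Poly_Mapping.keys c. Poly_Mapping.single (simplex_map p g s) (Poly_Mapping.lookup c s))"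

definition sing_cycles :: "nat \<Rightarrow> 'x topology \<Rightarrow> ('x, 'k::field) kchain set" where
  "sing_cycles p X = {c \<in> carrier (sing_chains p X). sing_boundary p c = 0}"

definition sing_boundaries :: "nat \<Rightarrow> 'x topology \<Rightarrow> ('x, 'k::field) kchain set" where
  "sing_boundaries p X = sing_boundary (Suc p) ` carrier (sing_chains (Suc p) X)"

definition sing_homology :: "nat \<Rightarrow> 'x topology \<Rightarrow> ('k::field, ('x, 'k) kchain set) vs" where
  "sing_homology p X = quot_vs (sing_chains p X) (sing_cycles p X) (sing_boundaries p X)"

text \<open>The map on homology induced by a continuous map \<open>g\<close> into \<open>Z\<close>.\<close>

definition sing_homology_map ::
    "nat \<Rightarrow> 'z topology \<Rightarrow> ('x \<Rightarrow> 'z) \<Rightarrow> ('x, 'k::field) kchain set \<Rightarrow> ('z, 'k) kchain set" where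
  "sing_homology_map p Z g =
     quot_map (sing_chains p Z) (sing_boundaries p Z) (sing_chain_map p g)"


section \<open>Precosheaves of graded vector spaces\<close>

text \<open>
  \<open>ob F V n\<close> is the degree-\<open>n\<close> part of \<open>F(V)\<close>, and \<open>mor F V W n\<close> is the degree-\<open>n\<close> part of
  \<open>F(V \<subseteq> W)\<close>. Only the values at open sets (and at inclusions of open sets) are meaningful.
\<close>

record ('y, 'k, 'v) precosheaf =
  ob :: "'y set \<Rightarrow> nat \<Rightarrow> ('k, 'v) vs"
  mor :: "'y set \<Rightarrow> 'y set \<Rightarrow> nat \<Rightarrow> 'v \<Rightarrow> 'v"

definition graded_total :: "(nat \<Rightarrow> ('k, 'v) vs) \<Rightarrow> ('k, nat \<Rightarrow> 'v) vs" where
  "graded_total A = direct_sum UNIV A"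

definition precosheaf_hom ::
    "'y topology \<Rightarrow> ('y, 'k::field, 'v) precosheaf \<Rightarrow> ('y, 'k, 'w) precosheaf
       \<Rightarrow> ('y set \<Rightarrow> nat \<Rightarrow> 'v \<Rightarrow> 'w) \<Rightarrow> bool" where
  "precosheaf_hom T F G \<phi> \<longleftrightarrow>
     (\<forall>V n. openin T V \<longrightarrow> \<phi> V n \<in> linear_maps (ob F V n) (ob G V n)) \<and>
     (\<forall>V W n. openin T V \<and> openin T W \<and> V \<subseteq> W \<longrightarrow>
        (\<forall>x\<in>carrier (ob F V n). \<phi> W n (mor F V W n x) = mor G V W n (\<phi> V n x)))"


section \<open>Interleaving distance\<close>

text \<open>The infimum over the empty set is \<open>\<infinity>\<close> here, so the thickening of the empty set is empty.\<close>

definition thickening :: "'y set \<Rightarrow> ('y \<Rightarrow> 'y \<Rightarrow> real) \<Rightarrow> real \<Rightarrow> 'y set \<Rightarrow> 'y set" where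
  "thickening Y d \<epsilon> V =
     (if \<epsilon> = 0 then V else {y \<in> Y. (INF v\<in>V. ennreal (d y v)) < ennreal \<epsilon>})"

definition shift ::
    "'y set \<Rightarrow> ('y \<Rightarrow> 'y \<Rightarrow> real) \<Rightarrow> real \<Rightarrow> ('y, 'k, 'v) precosheaf \<Rightarrow> ('y, 'k, 'v) precosheaf" where
  "shift Y d \<epsilon> F =
     \<lparr>ob = (\<lambda>V. ob F (thickening Y d \<epsilon> V)),
      mor = (\<lambda>V W. mor F (thickening Y d \<epsilon> V) (thickening Y d \<epsilon> W))\<rparr>"

definition shift_map ::
    "'y set \<Rightarrow> ('y \<Rightarrow> 'y \<Rightarrow> real) \<Rightarrow> real \<Rightarrow> real \<Rightarrow> ('y, 'k, 'v) precosheaf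
       \<Rightarrow> 'y set \<Rightarrow> nat \<Rightarrow> 'v \<Rightarrow> 'v" where
  "shift_map Y d \<epsilon> \<delta> F V = mor F (thickening Y d \<epsilon> V) (thickening Y d \<delta> V)"

definition interleaving ::
    "'y set \<Rightarrow> ('y \<Rightarrow> 'y \<Rightarrow> real) \<Rightarrow> real \<Rightarrow> ('y, 'k::field, 'v) precosheaf \<Rightarrow> ('y, 'k, 'w) precosheaf
       \<Rightarrow> (real \<Rightarrow> 'y set \<Rightarrow> nat \<Rightarrow> 'v \<Rightarrow> 'w) \<Rightarrow> (real \<Rightarrow> 'y set \<Rightarrow> nat \<Rightarrow> 'w \<Rightarrow> 'v) \<Rightarrow> bool" where
  "interleaving Y d \<epsilon> F G \<phi> \<psi> \<longleftrightarrow>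
     (let T = Metric_space.mtopology Y d in
      (\<forall>a\<ge>0. precosheaf_hom T (shift Y d a F) (shift Y d (a + \<epsilon>) G) (\<phi> a) \<and>
              precosheaf_hom T (shift Y d a G) (shift Y d (a + \<epsilon>) F) (\<psi> a)) \<and>
      (\<forall>a b V n. 0 \<le> a \<and> a \<le> b \<and> openin T V \<longrightarrow>
         (\<forall>x\<in>carrier (ob (shift Y d a F) V n).
            \<phi> b V n (shift_map Y d a b F V n x)
              = shift_map Y d (a + \<epsilon>) (b + \<epsilon>) G V n (\<phi> a V n x)) \<and>
         (\<forall>x\<in>carrier (ob (shift Y d a G) V n).
            \<psi> b V n (shift_map Y d a b G V n x)
              = shift_map Y d (a + \<epsilon>) (b + \<epsilon>) F V n (\<psi> a V n x))) \<and>
      (\<forall>a V n. 0 \<le> a \<and> openin T V \<longrightarrow>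
         (\<forall>x\<in>carrier (ob (shift Y d a F) V n).
            \<psi> (a + \<epsilon>) V n (\<phi> a V n x) = shift_map Y d a (a + 2 * \<epsilon>) F V n x) \<and>
         (\<forall>x\<in>carrier (ob (shift Y d a G) V n).
            \<phi> (a + \<epsilon>) V n (\<psi> a V n x) = shift_map Y d a (a + 2 * \<epsilon>) G V n x)))"

definition interleaving_distance ::
    "'y set \<Rightarrow> ('y \<Rightarrow> 'y \<Rightarrow> real) \<Rightarrow> ('y, 'k::field, 'v) precosheaf \<Rightarrow> ('y, 'k, 'w) precosheaf
       \<Rightarrow> ennreal" where
  "interleaving_distance Y d F G =
     Inf {ennreal \<epsilon> | \<epsilon>. 0 \<le> \<epsilon> \<and> (\<exists>\<phi> \<psi>. interleaving Y d \<epsilon> F G \<phi> \<psi>)}"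


section \<open>Constructibility\<close>

text \<open>
  The limit of \<open>F(V)\<close> over the members \<open>V\<close> of a family \<open>\<V>\<close> of open sets, ordered by inclusion,
  in degree \<open>n\<close>; its elements are the compatible families.
\<close>

definition limit_vs ::
    "('y, 'k, 'v) precosheaf \<Rightarrow> 'y set set \<Rightarrow> nat \<Rightarrow> ('k, 'y set \<Rightarrow> 'v) vs" where
  "limit_vs F \<V> n =
     \<lparr>carrier = {x \<in> \<Pi>\<^sub>E V\<in>\<V>. carrier (ob F V n).
                  \<forall>V\<in>\<V>. \<forall>W\<in>\<V>. V \<subseteq> W \<longrightarrow> mor F V W n (x V) = x W},
      monoid.mult = undefined, one = undefined,
      ring.zero = (\<lambda>V\<in>\<V>. \<zero>\<^bsub>ob F V n\<^esub>),
      add = (\<lambda>x y. \<lambda>V\<in>\<V>. x V \<oplus>\<^bsub>ob F V n\<^esub> y V),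
      module.smult = (\<lambda>a x. \<lambda>V\<in>\<V>. a \<odot>\<^bsub>ob F V n\<^esub> x V)\<rparr>"

definition costalk ::
    "'y topology \<Rightarrow> ('y, 'k, 'v) precosheaf \<Rightarrow> 'y \<Rightarrow> nat \<Rightarrow> ('k, 'y set \<Rightarrow> 'v) vs" where
  "costalk T F y = limit_vs F {V. openin T V \<and> y \<in> V}"

text \<open>
  The restriction of a precosheaf to a subspace \<open>S\<close>, dual to the restriction of a presheaf: a
  relatively open \<open>W \<subseteq> S\<close> is sent to the limit of \<open>F(V)\<close> over the open \<open>V \<supseteq> W\<close>.
\<close>

definition restrict_precosheaf ::
    "'y topology \<Rightarrow> ('y, 'k, 'v) precosheaf \<Rightarrow> ('y, 'k, 'y set \<Rightarrow> 'v) precosheaf" where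
  "restrict_precosheaf T F =
     \<lparr>ob = (\<lambda>W. limit_vs F {V. openin T V \<and> W \<subseteq> V}),
      mor = (\<lambda>W W' n x. restrict x {V. openin T V \<and> W' \<subseteq> V})\<rparr>"

definition const_precosheaf :: "(nat \<Rightarrow> ('k, 'v) vs) \<Rightarrow> ('y, 'k, 'v) precosheaf" where
  "const_precosheaf M = \<lparr>ob = (\<lambda>V. M), mor = (\<lambda>V W n x. x)\<rparr>"

text \<open>
  A precosheaf \<open>F\<close> is locally constant if around every point there is an open \<open>N\<close> with a morphism from
  \<open>F|\<^sub>N\<close> to a constant precosheaf that induces isomorphisms on all costalks. (Asking for an isomorphism
  of precosheaves would be too strict: a constant cosheaf is not a constant functor on disconnected
  open sets, and \<open>F\<close> need not be a cosheaf.) The map on the costalk at \<open>t \<in> N\<close> sends a compatible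
  family \<open>x\<close> to the value of \<open>\<phi>\<close> on its member at \<open>N\<close>, all other members being sent to the same
  element of \<open>M\<close>. Since \<open>M\<close> is then isomorphic to a costalk, taking its elements from the
  type of elements of the costalks is no restriction.
\<close>

definition locally_constant :: "'y topology \<Rightarrow> ('y, 'k::field, 'v) precosheaf \<Rightarrow> bool" where
  "locally_constant T F \<longleftrightarrow>
     (\<forall>y\<in>topspace T. \<exists>N (M :: nat \<Rightarrow> ('k, 'y set \<Rightarrow> 'v) vs) \<phi>.
        openin T N \<and> y \<in> N \<and> (\<forall>n. vector_space_over (M n)) \<and>
        precosheaf_hom (subtopology T N) F (const_precosheaf M) \<phi> \<and>
        (\<forall>t\<in>N. \<forall>n. bij_betw (\<lambda>x. \<phi> N n (x N))
                     (carrier (costalk (subtopology T N) F t n)) (carrier (M n))))"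

text \<open>Locally finite partitions into locally closed strata, with a partial order on the strata such
  that the closure of a stratum lies in the union of the smaller ones.\<close>

definition stratification :: "'y topology \<Rightarrow> 'y set set \<Rightarrow> bool" where
  "stratification T \<S> \<longleftrightarrow>
     partition_on (topspace T) \<S> \<and> locally_finite_in T \<S> \<and>
     (\<forall>S\<in>\<S>. \<exists>A B. openin T A \<and> closedin T B \<and> S = A \<inter> B) \<and>
     (\<exists>r. partial_order_on \<S> r \<and> (\<forall>S\<in>\<S>. T closure_of S \<subseteq> \<Union>{S'\<in>\<S>. (S', S) \<in> r}))"

definition constructible :: "'y topology \<Rightarrow> ('y, 'k::field, 'v) precosheaf \<Rightarrow> bool" where
  "constructible T F \<longleftrightarrow>
     (\<exists>\<S>. stratification T \<S> \<and>
        (\<forall>S\<in>\<S>. locally_constant (subtopology T S) (restrict_precosheaf T F) \<and>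
           (\<forall>t\<in>S. fin_dim (graded_total (costalk (subtopology T S) (restrict_precosheaf T F) t)))))"


section \<open>Nerves and cellular cosheaves\<close>

text \<open>A simplex is the set of its vertices.\<close>

definition nerve :: "'i set \<Rightarrow> ('i \<Rightarrow> 'y set) \<Rightarrow> 'i set set" where
  "nerve I U = {\<sigma>. \<sigma> \<subseteq> I \<and> finite \<sigma> \<and> \<sigma> \<noteq> {} \<and> (\<Inter>i\<in>\<sigma>. U i) \<noteq> {}}"

definition simplices_of_dim :: "'i set set \<Rightarrow> nat \<Rightarrow> 'i set set" where
  "simplices_of_dim K p = {\<sigma>\<in>K. card \<sigma> = Suc p}"

definition one_dimensional :: "'i set set \<Rightarrow> bool" where
  "one_dimensional K \<longleftrightarrow> simplices_of_dim K 1 \<noteq> {} \<and> (\<forall>p>1. simplices_of_dim K p = {})"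

text \<open>\<open>cmor F \<sigma> \<tau>\<close>, for \<open>\<sigma>\<close> a face of \<open>\<tau>\<close>, is the map \<open>F(\<tau>) \<rightarrow> F(\<sigma>)\<close>.\<close>

record ('i, 'k, 'v) cellular_cosheaf =
  cob :: "'i set \<Rightarrow> ('k, 'v) vs"
  cmor :: "'i set \<Rightarrow> 'i set \<Rightarrow> 'v \<Rightarrow> 'v"

definition zero_cosheaf :: "('i, 'k, 'v) cellular_cosheaf" where
  "zero_cosheaf = \<lparr>cob = (\<lambda>\<sigma>. zero_vs), cmor = (\<lambda>\<sigma> \<tau> x. undefined)\<rparr>"

text \<open>
  Every simplex is oriented by a fixed linear order \<open>r\<close> of the vertices: if \<open>\<sigma>\<close> arises from \<open>\<tau>\<close> by
  deleting the vertex number \<open>j\<close> (counting from 0), then \<open>[\<sigma> : \<tau>] = (-1)^j\<close>.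
\<close>

definition incidence :: "'i rel \<Rightarrow> 'i set \<Rightarrow> 'i set \<Rightarrow> 'k::field" where
  "incidence r \<sigma> \<tau> = (- 1) ^ card {w\<in>\<sigma>. \<exists>v\<in>\<tau> - \<sigma>. (w, v) \<in> r}"

definition cell_chains ::
    "'i set set \<Rightarrow> ('i, 'k, 'v) cellular_cosheaf \<Rightarrow> nat \<Rightarrow> ('k, 'i set \<Rightarrow> 'v) vs" where
  "cell_chains K F p = direct_sum (simplices_of_dim K p) (cob F)"

text \<open>\<open>cell_boundary r K F p\<close> maps \<open>(p+1)\<close>-chains to \<open>p\<close>-chains; \<open>K\<close> is assumed to be finite.\<close>

definition cell_boundary ::
    "'i rel \<Rightarrow> 'i set set \<Rightarrow> ('i, 'k::field, 'v) cellular_cosheaf \<Rightarrow> nat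
       \<Rightarrow> ('i set \<Rightarrow> 'v) \<Rightarrow> 'i set \<Rightarrow> 'v" where
  "cell_boundary r K F p c \<sigma> =
     (if \<sigma> \<in> simplices_of_dim K p
      then finsum (cob F \<sigma>) (\<lambda>\<tau>. incidence r \<sigma> \<tau> \<odot>\<^bsub>cob F \<sigma>\<^esub> cmor F \<sigma> \<tau> (c \<tau>))
             {\<tau>\<in>simplices_of_dim K (Suc p). \<sigma> \<subseteq> \<tau>}
      else \<zero>\<^bsub>cob F \<sigma>\<^esub>)"

definition cell_cycles ::
    "'i rel \<Rightarrow> 'i set set \<Rightarrow> ('i, 'k::field, 'v) cellular_cosheaf \<Rightarrow> nat \<Rightarrow> ('i set \<Rightarrow> 'v) set" where
  "cell_cycles r K F p =
     {c\<in>carrier (cell_chains K F p).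
        p = 0 \<or> cell_boundary r K F (p - 1) c = \<zero>\<^bsub>cell_chains K F (p - 1)\<^esub>}"

definition cell_boundaries ::
    "'i rel \<Rightarrow> 'i set set \<Rightarrow> ('i, 'k::field, 'v) cellular_cosheaf \<Rightarrow> nat \<Rightarrow> ('i set \<Rightarrow> 'v) set" where
  "cell_boundaries r K F p = cell_boundary r K F p ` carrier (cell_chains K F (Suc p))"

definition cell_homology ::
    "'i rel \<Rightarrow> 'i set set \<Rightarrow> ('i, 'k::field, 'v) cellular_cosheaf \<Rightarrow> nat
       \<Rightarrow> ('k, ('i set \<Rightarrow> 'v) set) vs" where
  "cell_homology r K F p =
     quot_vs (cell_chains K F p) (cell_cycles r K F p) (cell_boundaries r K F p)"

text \<open>The map induced by the inclusion of a subcomplex into \<open>K'\<close>: a chain of the subcomplex is,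
  as a function, already a chain of \<open>K'\<close>.\<close>

definition cell_homology_incl ::
    "'i rel \<Rightarrow> 'i set set \<Rightarrow> ('i, 'k::field, 'v) cellular_cosheaf \<Rightarrow> nat
       \<Rightarrow> ('i set \<Rightarrow> 'v) set \<Rightarrow> ('i set \<Rightarrow> 'v) set" where
  "cell_homology_incl r K' F p = quot_map (cell_chains K' F p) (cell_boundaries r K' F p) (\<lambda>c. c)"


section \<open>The Leray precosheaf, its cellular version and the continuous extension\<close>

definition preimage :: "'x topology \<Rightarrow> ('x \<Rightarrow> 'y) \<Rightarrow> 'y set \<Rightarrow> 'x topology" where
  "preimage X f V = subtopology X {x\<in>topspace X. f x \<in> V}"

definition leray ::
    "'k::field itself \<Rightarrow> 'x topology \<Rightarrow> ('x \<Rightarrow> 'y) \<Rightarrow> ('y, 'k, ('x, 'k) kchain set) precosheaf" where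
  "leray _ X f =
     \<lparr>ob = (\<lambda>V n. sing_homology n (preimage X f V)),
      mor = (\<lambda>V W n. sing_homology_map n (preimage X f W) (\<lambda>x. x))\<rparr>"

text \<open>The degree-\<open>n\<close> part of \<open>D\<^sub>U F\<close>.\<close>

definition cellular_part ::
    "('i \<Rightarrow> 'y set) \<Rightarrow> ('y, 'k, 'v) precosheaf \<Rightarrow> nat \<Rightarrow> ('i, 'k, 'v) cellular_cosheaf" where
  "cellular_part U F n =
     \<lparr>cob = (\<lambda>\<sigma>. ob F (\<Inter>i\<in>\<sigma>. U i) n),
      cmor = (\<lambda>\<sigma> \<tau>. mor F (\<Inter>i\<in>\<tau>. U i) (\<Inter>i\<in>\<sigma>. U i) n)\<rparr>"

definition meeting_complex :: "'i set \<Rightarrow> ('i \<Rightarrow> 'y set) \<Rightarrow> 'y set \<Rightarrow> 'i set set" where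
  "meeting_complex I U V = {\<sigma>\<in>nerve I U. (\<Inter>i\<in>\<sigma>. U i) \<inter> V \<noteq> {}}"

definition prev_degree ::
    "(nat \<Rightarrow> ('i, 'k, 'v) cellular_cosheaf) \<Rightarrow> nat \<Rightarrow> ('i, 'k, 'v) cellular_cosheaf" where
  "prev_degree D n = (case n of 0 \<Rightarrow> zero_cosheaf | Suc m \<Rightarrow> D m)"

definition continuous_extension ::
    "'i rel \<Rightarrow> 'i set \<Rightarrow> ('i \<Rightarrow> 'y set) \<Rightarrow> (nat \<Rightarrow> ('i, 'k::field, 'v) cellular_cosheaf)
       \<Rightarrow> ('y, 'k, ('i set \<Rightarrow> 'v) set \<times> ('i set \<Rightarrow> 'v) set) precosheaf" where
  "continuous_extension r I U D =
     \<lparr>ob = (\<lambda>V n. prod_vs (cell_homology r (meeting_complex I U V) (D n) 0)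
                           (cell_homology r (meeting_complex I U V) (prev_degree D n) 1)),
      mor = (\<lambda>V W n. map_prod
               (cell_homology_incl r (meeting_complex I U W) (D n) 0)
               (cell_homology_incl r (meeting_complex I U W) (prev_degree D n) 1))\<rparr>"

definition resolution :: "'i set \<Rightarrow> ('i \<Rightarrow> 'y set) \<Rightarrow> ('y \<Rightarrow> 'y \<Rightarrow> real) \<Rightarrow> ennreal" where
  "resolution I U d = (SUP i\<in>I. SUP x\<in>U i. SUP y\<in>U i. ennreal (d x y))"

end

theory Submission
  imports Defs
begin

text \<open>
  Let \<open>\<epsilon> > res(\<U>)\<close>. Over a field, Mayer--Vietoris for a cover with one-dimensional nerve splits
  \<open>H\<^sub>n\<close> of the union as \<open>H\<^sub>0 \<oplus> H\<^sub>1\<close> of the nerve. The splitting is not canonical, but it can be chosen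
  naturally in subcomplexes \<open>K\<close>: for every set \<open>U\<^sub>i\<close> and every \<open>U\<^sub>i \<inter> U\<^sub>j\<close> fix linear choices of cycles
  representing homology classes and of chains filling boundaries. A lifted 1-cycle of \<open>K\<close> is then filled
  at each vertex, the fillings add up to a singular cycle, and the formula does not mention \<open>K\<close>.

  The set \<open>K\<^sub>V\<close> of simplices meeting \<open>V\<close> may lack edges between its vertices, in which case this map from
  \<open>H\<^sub>0(K\<^sub>V) \<oplus> H\<^sub>1(K\<^sub>V)\<close> to the homology of the preimage of \<open>\<Union>U\<^sub>i\<close> is not bijective. But the full subcomplex
  \<open>K'\<^sub>V\<close> on the vertices of \<open>K\<^sub>V\<close> lies between \<open>K\<^sub>V\<close> and \<open>K\<^bsub>V\<^sup>\<epsilon>\<^esub>\<close>, for it the map is bijective, and the union of the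
  \<open>U\<^sub>i\<close> meeting \<open>V\<close> lies in \<open>V\<^sup>\<epsilon>\<close>. This yields both halves of an \<open>\<epsilon>\<close>-interleaving.
\<close>

section \<open>Chains with field coefficients\<close>

text \<open>Cellular classes are represented by families of singular cycles, for which the inclusion
  of a subcomplex is the identity; naturality then needs no diagram chase. Two facts about chains
  carry the proof. A chain in a union of sets \<open>U i\<close> becomes, after subdivision, a sum
  of chains in single sets. And since no three sets with distinct indices meet, a simplex shared by
  two sets is shared by no third: at each vertex the chains of the edges have disjoint supports, so
  edge chains are determined by what they contribute at one end. Fullness matters because a relation
  between chains at the vertices produces chains on the intersections of pairs, whether or not these
  pairs are edges of the subcomplex at hand. The metric enters through one fact: for
  \<open>\<epsilon>\<close> strictly above the resolution, each \<open>U i\<close> meeting the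
  \<open>a\<close>-thickening of \<open>V\<close> lies in its
  \<open>(a + \<epsilon>)\<close>-thickening. Strictness matches the strict inequality in the
  thickening; the bound by the resolution itself comes from the infimum in the distance.\<close>

definition chain_scale :: "'k::field \<Rightarrow> ('a \<Rightarrow>\<^sub>0 'k) \<Rightarrow> 'a \<Rightarrow>\<^sub>0 'k" where
  "chain_scale a c = Poly_Mapping.map (\<lambda>b. a * b) c"

lemma lookup_chain_scale [simp]:
  "Poly_Mapping.lookup (chain_scale a c) s = a * Poly_Mapping.lookup c s"
  by (simp add: chain_scale_def Poly_Mapping.map.rep_eq when_def)

text \<open>Chains of all subspaces of a type live in a single ambient vector space, and being a
  chain of a given subspace is a condition on the support. No inclusion maps between chain spaces
  have to be carried along.\<close>

interpretation kch: vector_space chain_scale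
  by unfold_locales (auto intro!: poly_mapping_eqI simp: lookup_add algebra_simps)

interpretation kch2: vector_space_pair chain_scale chain_scale
  by unfold_locales

abbreviation klinear :: "(('a \<Rightarrow>\<^sub>0 'k::field) \<Rightarrow> ('b \<Rightarrow>\<^sub>0 'k)) \<Rightarrow> bool" where
  "klinear \<equiv> Vector_Spaces.linear chain_scale chain_scale"

lemma klinearI:
  assumes "\<And>x y. h (x + y) = h x + h y" "\<And>a x. h (chain_scale a x) = chain_scale a (h x)"
  shows "klinear h"
  by unfold_locales (use assms in auto)

lemma klinear_add: "klinear h \<Longrightarrow> h (x + y) = h x + h y"
  and klinear_scale: "klinear h \<Longrightarrow> h (chain_scale a x) = chain_scale a (h x)"
  and klinear_diff: "klinear h \<Longrightarrow> h (x - y) = h x - h y"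
  and klinear_0: "klinear h \<Longrightarrow> h 0 = 0"
  and klinear_sum: "klinear h \<Longrightarrow> h (\<Sum>i\<in>A. g i) = (\<Sum>i\<in>A. h (g i))"
  by (simp_all add: kch2.linear_add kch2.linear_scale kch2.linear_diff kch2.linear_0
      kch2.linear_sum)

lemma klinear_compose: "klinear h \<Longrightarrow> klinear h' \<Longrightarrow> klinear (\<lambda>x. h (h' x))"
  by (rule klinearI) (simp_all add: klinear_add klinear_scale)

lemma klinear_diff_fun: "klinear h \<Longrightarrow> klinear h' \<Longrightarrow> klinear (\<lambda>x. h x - h' x)"
  by (rule klinearI) (simp_all add: klinear_add klinear_scale kch.scale_right_diff_distrib)

lemma klinear_id: "klinear (\<lambda>x. x)"
  by (rule klinearI) simp_all

lemma keys_chain_scale_subset: "Poly_Mapping.keys (chain_scale a c) \<subseteq> Poly_Mapping.keys c"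
  by (auto simp: in_keys_iff)

lemma chain_scale_single [simp]:
  "chain_scale a (Poly_Mapping.single s b) = Poly_Mapping.single s (a * b)"
  by (rule poly_mapping_eqI) (simp add: lookup_single when_def)

section \<open>Linear extension from the basis of simplices\<close>

definition lin_extend :: "('a \<Rightarrow> ('b \<Rightarrow>\<^sub>0 'k::field)) \<Rightarrow> ('a \<Rightarrow>\<^sub>0 'k::field) \<Rightarrow> ('b \<Rightarrow>\<^sub>0 'k)" where
  "lin_extend b c = (\<Sum>s\<in>Poly_Mapping.keys c. chain_scale (Poly_Mapping.lookup c s) (b s))"

lemma lin_extend_superset:
  assumes "finite A" "Poly_Mapping.keys c \<subseteq> A"
  shows "lin_extend b c = (\<Sum>s\<in>A. chain_scale (Poly_Mapping.lookup c s) (b s))"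
  unfolding lin_extend_def
  by (rule sum.mono_neutral_left) (use assms in \<open>auto simp: in_keys_iff\<close>)

lemma klinear_lin_extend:
  fixes b :: "'a \<Rightarrow> ('b \<Rightarrow>\<^sub>0 'c::field)"
  shows "klinear (lin_extend b)"
proof (rule klinearI)
  fix x y :: "'a \<Rightarrow>\<^sub>0 'c"
  let ?A = "Poly_Mapping.keys x \<union> Poly_Mapping.keys y"
  have "lin_extend b (x + y) = (\<Sum>s\<in>?A. chain_scale (Poly_Mapping.lookup (x + y) s) (b s))"
    by (rule lin_extend_superset) (auto dest: Poly_Mapping.keys_add[THEN subsetD])
  also have "\<dots> = lin_extend b x + lin_extend b y"
    by (simp add: lin_extend_superset[of ?A] lookup_add kch.scale_left_distrib sum.distrib)
  finally show "lin_extend b (x + y) = lin_extend b x + lin_extend b y" .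
next
  fix a x
  show "lin_extend b (chain_scale a x) = chain_scale a (lin_extend b x)"
    by (subst lin_extend_superset[OF _ keys_chain_scale_subset])
      (simp_all add: lin_extend_def kch.scale_sum_right)
qed

lemma lin_extend_single [simp]: "lin_extend b (Poly_Mapping.single s a) = chain_scale a (b s)"
  by (simp add: lin_extend_def)

lemma chain_expansion:
  fixes c :: "'a \<Rightarrow>\<^sub>0 'b::comm_monoid_add"
  shows "(\<Sum>s\<in>Poly_Mapping.keys c. Poly_Mapping.single s (Poly_Mapping.lookup c s)) = c"
  by (rule poly_mapping_eqI)
    (simp add: lookup_sum lookup_single when_def in_keys_iff)

text \<open>Agreement is asked only on simplices occurring in \<open>c\<close>, so that integral
  identities valid just for simplices of a space \<open>X\<close> can be transferred to chains of
  \<open>X\<close> with field coefficients.\<close>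

lemma klinear_eq_on_keys:
  fixes h h' :: "('a \<Rightarrow>\<^sub>0 'k::field) \<Rightarrow> ('b \<Rightarrow>\<^sub>0 'k)"
  assumes "klinear h" "klinear h'"
    and "\<And>s. s \<in> Poly_Mapping.keys c \<Longrightarrow> h (Poly_Mapping.single s 1) = h' (Poly_Mapping.single s 1)"
  shows "h c = h' c"
proof -
  have *: "g c = (\<Sum>s\<in>Poly_Mapping.keys c.
      chain_scale (Poly_Mapping.lookup c s) (g (Poly_Mapping.single s 1)))"
    if "klinear g" for g :: "('a \<Rightarrow>\<^sub>0 'k) \<Rightarrow> ('b \<Rightarrow>\<^sub>0 'k)"
  proof -
    have "g c = g (\<Sum>s\<in>Poly_Mapping.keys c. chain_scale (Poly_Mapping.lookup c s) (Poly_Mapping.single s 1))"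
      by (simp add: chain_expansion)
    then show ?thesis
      by (simp only: klinear_sum[OF that] klinear_scale[OF that])
  qed
  show ?thesis
    unfolding *[OF assms(1)] *[OF assms(2)] by (rule sum.cong) (simp_all add: assms(3))
qed

lemma keys_sum_subset:
  "(\<And>i. i \<in> A \<Longrightarrow> Poly_Mapping.keys (g i) \<subseteq> S) \<Longrightarrow> Poly_Mapping.keys (\<Sum>i\<in>A. g i) \<subseteq> S"
  using keys_sum[of g A] by blast

lemma keys_lin_extend_subset:
  "(\<And>s. s \<in> Poly_Mapping.keys c \<Longrightarrow> Poly_Mapping.keys (b s) \<subseteq> S) \<Longrightarrow> Poly_Mapping.keys (lin_extend b c) \<subseteq> S"
  unfolding lin_extend_def
  by (intro keys_sum_subset order_trans[OF keys_chain_scale_subset])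

subsection \<open>Base change from integral chains\<close>

definition of_frag :: "('a \<Rightarrow>\<^sub>0 int) \<Rightarrow> ('a \<Rightarrow>\<^sub>0 'k::field)" where
  "of_frag c = Poly_Mapping.map of_int c"

lemma lookup_of_frag [simp]: "Poly_Mapping.lookup (of_frag c) s = of_int (Poly_Mapping.lookup c s)"
  by (simp add: of_frag_def Poly_Mapping.map.rep_eq when_def)

lemma of_frag_simps [simp]:
  "of_frag 0 = 0"
  "of_frag (Poly_Mapping.single s m) = Poly_Mapping.single s (of_int m)"
  "of_frag (x + y) = of_frag x + of_frag y"
  "of_frag (x - y) = of_frag x - of_frag y"
  "of_frag (frag_cmul m x) = chain_scale (of_int m) (of_frag x)"
  by (rule poly_mapping_eqI; simp add: lookup_add lookup_minus lookup_single when_def)+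

lemma of_frag_sum: "of_frag (\<Sum>i\<in>A. g i) = (\<Sum>i\<in>A. of_frag (g i))"
  by (induction A rule: infinite_finite_induct) simp_all

lemma keys_of_frag_subset: "Poly_Mapping.keys (of_frag c) \<subseteq> Poly_Mapping.keys c"
  by (auto simp: in_keys_iff)

text \<open>This is the tensor product of \<open>\<phi>\<close> with the field, written through its
  values on generators. It is linear for any function \<open>\<phi>\<close>; additivity of
  \<open>\<phi>\<close> becomes a hypothesis once values on other chains matter.\<close>

definition base_change :: "(('a \<Rightarrow>\<^sub>0 int) \<Rightarrow> ('b \<Rightarrow>\<^sub>0 int)) \<Rightarrow> ('a \<Rightarrow>\<^sub>0 'k::field) \<Rightarrow> ('b \<Rightarrow>\<^sub>0 'k)" where
  "base_change \<phi> = lin_extend (\<lambda>s. of_frag (\<phi> (frag_of s)))"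

lemma klinear_base_change: "klinear (base_change \<phi>)"
  unfolding base_change_def by (rule klinear_lin_extend)

text \<open>Induction on integral chains proceeds by differences of generators, hence the form of
  the hypothesis on \<open>x - y\<close>.\<close>

lemma base_change_of_frag:
  assumes 0: "\<phi> 0 = 0" and diff: "\<And>x y. \<phi> (x - y) = \<phi> x - \<phi> y"
  shows "base_change \<phi> (of_frag c) = of_frag (\<phi> c)"
proof -
  note lin = klinear_base_change[of \<phi>]
  show ?thesis
  proof (rule frag_induction[of c UNIV])
    show "base_change \<phi> (of_frag 0) = of_frag (\<phi> 0)"
      by (simp add: 0 klinear_0[OF lin])
  qed (simp_all add: base_change_def diff klinear_diff[OF klinear_lin_extend])
qed

lemma base_change_single:
  "base_change \<phi> (Poly_Mapping.single s (1::'k::field)) = of_frag (\<phi> (frag_of s))"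
  by (simp add: base_change_def)

text \<open>The bridge to the integral theory: the vanishing of the squared boundary, subdivision
  and its chain homotopy carry over to field coefficients by comparison on generators.\<close>

lemma sing_boundary_base_change: "sing_boundary p = base_change (chain_boundary p)"
proof (cases "p = 0")
  case True
  then show ?thesis
    by (simp add: sing_boundary_def base_change_def chain_boundary_def lin_extend_def fun_eq_iff)
next
  case False
  have "chain_scale b (of_frag (chain_boundary p (frag_of s)))
      = (\<Sum>j\<le>p. Poly_Mapping.single (singular_face p j s) ((- 1) ^ j * b))" for s and b :: 'b
    using False
    by (simp add: chain_boundary_of of_frag_sum kch.scale_sum_right mult.commute)
  note * = this
  show ?thesis
    using False by (simp add: sing_boundary_def base_change_def lin_extend_def fun_eq_iff *)
qed

lemma klinear_sing_boundary: "klinear (sing_boundary p)"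
  unfolding sing_boundary_base_change by (rule klinear_base_change)

abbreviation kchain :: "nat \<Rightarrow> 'x topology \<Rightarrow> ('x, 'k::field) kchain \<Rightarrow> bool" where
  "kchain p X c \<equiv> Poly_Mapping.keys c \<subseteq> singular_simplex_set p X"

lemma kchain_0: "kchain p X 0"
  and kchain_add: "kchain p X c \<Longrightarrow> kchain p X c' \<Longrightarrow> kchain p X (c + c')"
  and kchain_diff: "kchain p X c \<Longrightarrow> kchain p X c' \<Longrightarrow> kchain p X (c - c')"
  and kchain_scale: "kchain p X c \<Longrightarrow> kchain p X (chain_scale a c)"
  using keys_add[of c c'] keys_diff[of c c'] keys_chain_scale_subset[of a c] by (blast | simp)+

lemma kchain_sum: "(\<And>i. i \<in> A \<Longrightarrow> kchain p X (g i)) \<Longrightarrow> kchain p X (\<Sum>i\<in>A. g i)"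
  by (rule keys_sum_subset)

lemma kchain_base_change:
  assumes "\<And>c. singular_chain p X c \<Longrightarrow> singular_chain q X (\<phi> c)" "kchain p X c"
  shows "kchain q X (base_change \<phi> c)"
  unfolding base_change_def
proof (rule keys_lin_extend_subset)
  fix s assume "s \<in> Poly_Mapping.keys c"
  then have "singular_chain p X (frag_of s)"
    using assms(2) by (auto simp: singular_chain_of)
  then show "kchain q X (of_frag (\<phi> (frag_of s)))"
    by (intro order_trans[OF keys_of_frag_subset] assms(1)[unfolded singular_chain_def])
      (simp add: singular_chain_def)
qed

text \<open>Only the outer operator has to be additive, since the inner one is evaluated on
  generators alone.\<close>

lemma base_change_compose:
  assumes "\<phi> 0 = 0" "\<And>x y. \<phi> (x - y) = \<phi> x - \<phi> y"
  shows "base_change \<phi> (base_change \<psi> c) = base_change (\<lambda>x. \<phi> (\<psi> x)) c"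
  by (rule klinear_eq_on_keys)
    (simp_all add: klinear_compose klinear_base_change base_change_single base_change_of_frag assms)

lemma kchain_sing_boundary:
  "kchain (Suc p) X c \<Longrightarrow> kchain p X (sing_boundary (Suc p) c)"
  unfolding sing_boundary_base_change
  by (rule kchain_base_change[of "Suc p"]) (simp_all add: singular_chain_boundary_alt)

lemma base_change_cong:
  assumes "\<And>c. singular_chain p X c \<Longrightarrow> \<phi> c = \<psi> c" "kchain p X c"
  shows "base_change \<phi> c = base_change \<psi> c"
  by (rule klinear_eq_on_keys)
    (use assms in \<open>auto simp: klinear_base_change base_change_single singular_chain_of\<close>)

lemma base_change_0: "base_change (\<lambda>x. 0) c = 0"
  by (simp add: base_change_def lin_extend_def)

lemma sing_boundary_boundary:
  assumes "kchain (Suc p) X c"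
  shows "sing_boundary p (sing_boundary (Suc p) c) = 0"
  unfolding sing_boundary_base_change
  by (subst base_change_compose)
    (simp_all add: chain_boundary_diff base_change_0
      base_change_cong[OF chain_boundary_boundary_alt[of p X] assms])

subsection \<open>Subdivision\<close>

definition ksubdiv :: "nat \<Rightarrow> nat \<Rightarrow> ('x, 'k::field) kchain \<Rightarrow> ('x, 'k) kchain" where
  "ksubdiv p n = base_change (singular_subdivision p ^^ n)"

lemma klinear_ksubdiv: "klinear (ksubdiv p n)"
  unfolding ksubdiv_def by (rule klinear_base_change)

lemma singular_chain_singular_subdivision_power:
  "singular_chain p X c \<Longrightarrow> singular_chain p X ((singular_subdivision p ^^ n) c)"
  by (induction n) (simp_all add: singular_chain_singular_subdivision)

lemma kchain_ksubdiv: "kchain p X c \<Longrightarrow> kchain p X (ksubdiv p n c)"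
  unfolding ksubdiv_def
  by (rule kchain_base_change[of p]) (simp_all add: singular_chain_singular_subdivision_power)

lemma chain_boundary_singular_subdivision_power:
  "singular_chain (Suc p) X c \<Longrightarrow>
     chain_boundary (Suc p) ((singular_subdivision (Suc p) ^^ n) c) = (singular_subdivision p ^^ n) (chain_boundary (Suc p) c)"
proof (induction n)
  case (Suc n)
  then show ?case
    using chain_boundary_singular_subdivision[OF singular_chain_singular_subdivision_power[OF Suc.prems, of n]]
    by simp
qed simp

lemma sing_boundary_ksubdiv:
  assumes "kchain (Suc p) X c"
  shows "sing_boundary (Suc p) (ksubdiv (Suc p) n c) = ksubdiv p n (sing_boundary (Suc p) c)"
proof -
  have "sing_boundary (Suc p) (ksubdiv (Suc p) n c)
      = base_change (\<lambda>x. chain_boundary (Suc p) ((singular_subdivision (Suc p) ^^ n) x)) c"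
    unfolding sing_boundary_base_change ksubdiv_def
    by (rule base_change_compose) (simp_all add: chain_boundary_diff)
  also have "\<dots> = base_change (\<lambda>x. (singular_subdivision p ^^ n) (chain_boundary (Suc p) x)) c"
    using chain_boundary_singular_subdivision_power assms by (rule base_change_cong)
  also have "\<dots> = ksubdiv p n (sing_boundary (Suc p) c)"
    unfolding sing_boundary_base_change ksubdiv_def
    by (rule base_change_compose[symmetric]) (simp_all add: singular_subdivision_power_diff)
  finally show ?thesis .
qed

text \<open>The integral chain homotopy \<open>h\<close> from the identity to iterated subdivision
  is base changed; its second term contains the boundary of \<open>c\<close> and vanishes on cycles.
  For \<open>p = 0\<close> the truncated index \<open>p - Suc 0\<close> does no harm, as 0-chains
  have zero boundary.\<close>

lemma ksubdiv_homotopy: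
  fixes c :: "('x, 'k::field) kchain"
  assumes "kchain p X c" "sing_boundary p c = 0"
  shows "\<exists>h. kchain (Suc p) X h \<and> ksubdiv p n c - c = sing_boundary (Suc p) h"
proof (rule chain_homotopic_iterated_singular_subdivision[where n=n])
  fix h :: "nat \<Rightarrow> 'x chain \<Rightarrow> 'x chain"
  assume h: "\<And>p. h p 0 = 0" "\<And>p c1 c2. h p (c1-c2) = h p c1 - h p c2"
    "\<And>p X c. singular_chain p X c \<Longrightarrow> singular_chain (Suc p) X (h p c)"
    "\<And>p X c. singular_chain p X c
       \<Longrightarrow> chain_boundary (Suc p) (h p c) + h (p - Suc 0) (chain_boundary p c)
         = (singular_subdivision p ^^ n) c - c"
  let ?d = "base_change (h p) c"
  have eq: "base_change (\<lambda>c. chain_boundary (Suc p) (h p c)) c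
      = base_change (\<lambda>x. (singular_subdivision p ^^ n) x - x - h (p - Suc 0) (chain_boundary p x)) c"
    by (rule base_change_cong[OF _ assms(1)]) (simp add: h(4)[symmetric])
  have "sing_boundary (Suc p) ?d = base_change (\<lambda>c. chain_boundary (Suc p) (h p c)) c"
    unfolding sing_boundary_base_change
    by (rule base_change_compose) (simp_all add: chain_boundary_diff)
  also note eq
  also have "base_change (\<lambda>x. (singular_subdivision p ^^ n) x - x - h (p - Suc 0) (chain_boundary p x)) c
     = ksubdiv p n c - c - base_change (\<lambda>x. h (p - Suc 0) (chain_boundary p x)) c"
    by (rule klinear_eq_on_keys)
       (simp_all add: klinear_base_change klinear_diff_fun klinear_id klinear_ksubdiv base_change_single ksubdiv_def)
  also have "base_change (\<lambda>x. h (p - Suc 0) (chain_boundary p x)) c = base_change (h (p - Suc 0)) (sing_boundary p c)"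
    unfolding sing_boundary_base_change
    by (rule base_change_compose[symmetric]) (simp_all add: h)
  also have "\<dots> = 0"
    using assms(2) by (simp add: klinear_0[OF klinear_base_change])
  finally have "sing_boundary (Suc p) ?d = ksubdiv p n c - c"
    by simp
  moreover have "kchain (Suc p) X ?d"
    by (rule kchain_base_change[OF h(3) assms(1)])
  ultimately show ?thesis
    by metis
qed

section \<open>Splitting chains along an open cover\<close>

definition chain_restrict :: "'a set \<Rightarrow> ('a \<Rightarrow>\<^sub>0 'k::field) \<Rightarrow> 'a \<Rightarrow>\<^sub>0 'k" where
  "chain_restrict S c = (\<Sum>s\<in>Poly_Mapping.keys c \<inter> S. Poly_Mapping.single s (Poly_Mapping.lookup c s))"

lemma lookup_chain_restrict:
  "Poly_Mapping.lookup (chain_restrict S c) s = (if s \<in> S then Poly_Mapping.lookup c s else 0)"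
  by (simp add: chain_restrict_def lookup_sum lookup_single when_def in_keys_iff)

lemma keys_chain_restrict: "Poly_Mapping.keys (chain_restrict S c) = Poly_Mapping.keys c \<inter> S"
  by (auto simp: in_keys_iff lookup_chain_restrict split: if_splits)

lemma sum_split_chain:
  fixes c :: "'a \<Rightarrow>\<^sub>0 'k::field"
  assumes "finite J" "Poly_Mapping.keys c \<subseteq> (\<Union>i\<in>J. S i)"
  obtains w where "c = (\<Sum>i\<in>J. w i)" "\<And>i. i \<in> J \<Longrightarrow> Poly_Mapping.keys (w i) \<subseteq> Poly_Mapping.keys c \<inter> S i"
proof -
  \<comment> \<open>One index is chosen for every simplex of the support, which turns the cover into
    a partition: no simplex is counted twice where sets overlap.\<close>
  obtain j where j: "\<And>s. s \<in> Poly_Mapping.keys c \<Longrightarrow> j s \<in> J \<and> s \<in> S (j s)"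
    using assms(2) by (metis (no_types, lifting) UN_iff subset_iff)
  define w where "w i = chain_restrict {s \<in> Poly_Mapping.keys c. j s = i} c" for i
  have "c = (\<Sum>i\<in>J. w i)"
  proof (rule poly_mapping_eqI)
    fix s
    show "Poly_Mapping.lookup c s = Poly_Mapping.lookup (\<Sum>i\<in>J. w i) s"
    proof (cases "s \<in> Poly_Mapping.keys c")
      case True
      then show ?thesis
        using j[OF True] assms(1) by (simp add: lookup_sum w_def lookup_chain_restrict)
    next
      case False
      then show ?thesis
        by (simp add: lookup_sum w_def lookup_chain_restrict in_keys_iff)
    qed
  qed
  moreover have "Poly_Mapping.keys (w i) \<subseteq> Poly_Mapping.keys c \<inter> S i" for i
    using j by (auto simp: w_def keys_chain_restrict)
  ultimately show ?thesis
    by (rule that)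
qed

lemma small_ksubdiv_exists:
  fixes c :: "('x, 'k::field) kchain"
  assumes "finite J" "\<And>i. i \<in> J \<Longrightarrow> openin X (W i)" "topspace X \<subseteq> (\<Union>i\<in>J. W i)" "kchain p X c"
  obtains n w where "ksubdiv p n c = (\<Sum>i\<in>J. w i)" "\<And>i. i \<in> J \<Longrightarrow> kchain p (subtopology X (W i)) (w i)"
proof -
  have "\<exists>n. \<forall>m g. n \<le> m \<and> g \<in> Poly_Mapping.keys ((singular_subdivision p ^^ m) (frag_of s))
          \<longrightarrow> (\<exists>i\<in>J. g \<in> standard_simplex p \<rightarrow> W i)" if "s \<in> Poly_Mapping.keys c" for s
  proof (rule sufficient_iterated_singular_subdivision_exists[of "W ` J" X p "frag_of s"])
    show "openin X V" if "V \<in> W ` J" for V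
      using that assms(2) by blast
    show "topspace X \<subseteq> \<Union> (W ` J)"
      by (rule assms(3))
    show "singular_chain p X (frag_of s)"
      using that assms(4) by (auto simp: singular_chain_of)
  next
    fix n
    assume "\<And>m g. \<lbrakk>n \<le> m; g \<in> Poly_Mapping.keys ((singular_subdivision p ^^ m) (frag_of s))\<rbrakk>
        \<Longrightarrow> \<exists>V\<in>W ` J. g \<in> standard_simplex p \<rightarrow> V"
    then show ?thesis
      by (intro exI[of _ n]) blast
  qed
  then obtain n where n: "\<And>s m g. \<lbrakk>s \<in> Poly_Mapping.keys c; n s \<le> m;
      g \<in> Poly_Mapping.keys ((singular_subdivision p ^^ m) (frag_of s))\<rbrakk>
          \<Longrightarrow> \<exists>i\<in>J. g \<in> standard_simplex p \<rightarrow> W i"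
    by meson
  \<comment> \<open>A simplex \<open>s\<close> is fine enough after any number of subdivisions from
    \<open>n s\<close> on, so the maximum over the finite support serves the whole chain; the 0
    keeps the maximum defined for the zero chain.\<close>
  define N where "N = Max (insert 0 (n ` Poly_Mapping.keys c))"
  have N: "n s \<le> N" if "s \<in> Poly_Mapping.keys c" for s
    using that by (simp add: N_def)
  have k: "kchain p X (ksubdiv p N c)"
    by (rule kchain_ksubdiv[OF assms(4)])
  have "Poly_Mapping.keys (ksubdiv p N c) \<subseteq> (\<Union>i\<in>J. {g. g \<in> standard_simplex p \<rightarrow> W i})"
    unfolding ksubdiv_def base_change_def
  proof (rule keys_lin_extend_subset)
    fix s assume s: "s \<in> Poly_Mapping.keys c"
    have "Poly_Mapping.keys ((singular_subdivision p ^^ N) (frag_of s)) \<subseteq> (\<Union>i\<in>J. {g. g \<in> standard_simplex p \<rightarrow> W i})"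
      using n[OF s N[OF s]] by blast
    then show "Poly_Mapping.keys (of_frag ((singular_subdivision p ^^ N) (frag_of s)))
        \<subseteq> (\<Union>i\<in>J. {g. g \<in> standard_simplex p \<rightarrow> W i})"
      by (rule order_trans[OF keys_of_frag_subset])
  qed
  from sum_split_chain[OF assms(1) this] obtain w where
    w: "ksubdiv p N c = (\<Sum>i\<in>J. w i)"
    "\<And>i. i \<in> J \<Longrightarrow> Poly_Mapping.keys (w i) \<subseteq> Poly_Mapping.keys (ksubdiv p N c) \<inter> {g. g \<in> standard_simplex p \<rightarrow> W i}"
    by blast
  have "kchain p (subtopology X (W i)) (w i)" if "i \<in> J" for i
  proof
    fix g assume "g \<in> Poly_Mapping.keys (w i)"
    then have "singular_simplex p X g" "g \<in> standard_simplex p \<rightarrow> W i"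
      using w(2)[OF that] k by blast+
    then show "g \<in> singular_simplex_set p (subtopology X (W i))"
      by (simp add: singular_simplex_subtopology image_subset_iff_funcset)
  qed
  with w(1) show ?thesis
    by (rule that)
qed

section \<open>Quotients and direct sums of vector spaces\<close>

abbreviation kring :: "'k::field ring" where
  "kring \<equiv> ring_of_type_algebra"

lemma kring_simps [simp]:
  "carrier kring = UNIV" "a \<oplus>\<^bsub>kring\<^esub> b = a + b" "a \<otimes>\<^bsub>kring\<^esub> b = a * b"
  "\<one>\<^bsub>kring\<^esub> = 1" "\<zero>\<^bsub>kring\<^esub> = 0"
  by (simp_all add: ring_of_type_algebra_def)

lemma quot_vs_simps [simp]:
  "carrier (quot_vs M Z B) = (\<lambda>z. B +>\<^bsub>M\<^esub> z) ` Z"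
  "\<zero>\<^bsub>quot_vs M Z B\<^esub> = B"
  "C \<oplus>\<^bsub>quot_vs M Z B\<^esub> D = C <+>\<^bsub>M\<^esub> D"
  "a \<odot>\<^bsub>quot_vs M Z B\<^esub> C = (\<Union>z\<in>C. B +>\<^bsub>M\<^esub> (a \<odot>\<^bsub>M\<^esub> z))"
  by (simp_all add: quot_vs_def)

lemma direct_sum_simps [simp]:
  "\<zero>\<^bsub>direct_sum J M\<^esub> = (\<lambda>j. \<zero>\<^bsub>M j\<^esub>)"
  "x \<oplus>\<^bsub>direct_sum J M\<^esub> y = (\<lambda>j. x j \<oplus>\<^bsub>M j\<^esub> y j)"
  "a \<odot>\<^bsub>direct_sum J M\<^esub> x = (\<lambda>j. a \<odot>\<^bsub>M j\<^esub> x j)"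
  by (simp_all add: direct_sum_def)

lemma carrier_direct_sum:
  assumes "finite J"
  shows "carrier (direct_sum J M) = {x. (\<forall>j\<in>J. x j \<in> carrier (M j)) \<and> (\<forall>j. j \<notin> J \<longrightarrow> x j = \<zero>\<^bsub>M j\<^esub>)}"
proof -
  have "finite {j. x j \<noteq> \<zero>\<^bsub>M j\<^esub>}" if "\<forall>j. j \<notin> J \<longrightarrow> x j = \<zero>\<^bsub>M j\<^esub>" for x
    using assms by (rule finite_subset[rotated]) (use that in auto)
  then show ?thesis
    by (auto simp: direct_sum_def)
qed

lemma vector_spaceI:
  fixes M :: "('k::field, 'v) vs"
  assumes "abelian_group M"
    and "\<And>a x. x \<in> carrier M \<Longrightarrow> a \<odot>\<^bsub>M\<^esub> x \<in> carrier M"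
    and "\<And>a b x. x \<in> carrier M \<Longrightarrow> (a + b) \<odot>\<^bsub>M\<^esub> x = a \<odot>\<^bsub>M\<^esub> x \<oplus>\<^bsub>M\<^esub> b \<odot>\<^bsub>M\<^esub> x"
    and "\<And>a x y. x \<in> carrier M \<Longrightarrow> y \<in> carrier M \<Longrightarrow> a \<odot>\<^bsub>M\<^esub> (x \<oplus>\<^bsub>M\<^esub> y) = a \<odot>\<^bsub>M\<^esub> x \<oplus>\<^bsub>M\<^esub> a \<odot>\<^bsub>M\<^esub> y"
    and "\<And>a b x. x \<in> carrier M \<Longrightarrow> (a * b) \<odot>\<^bsub>M\<^esub> x = a \<odot>\<^bsub>M\<^esub> (b \<odot>\<^bsub>M\<^esub> x)"
    and "\<And>x. x \<in> carrier M \<Longrightarrow> 1 \<odot>\<^bsub>M\<^esub> x = x"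
  shows "vector_space_over M"
  by (rule moduleI) (use assms in \<open>auto intro: cring_from_type_algebra\<close>)

lemma vector_subspaceI:
  fixes M :: "('k::field, 'v) vs"
  assumes M: "vector_space_over M" and "S \<subseteq> carrier M" "\<zero>\<^bsub>M\<^esub> \<in> S"
    and "\<And>x y. x \<in> S \<Longrightarrow> y \<in> S \<Longrightarrow> x \<oplus>\<^bsub>M\<^esub> y \<in> S" and smult: "\<And>a x. x \<in> S \<Longrightarrow> a \<odot>\<^bsub>M\<^esub> x \<in> S"
  shows "submodule S kring M"
proof -
  interpret module kring M by fact
  show ?thesis
  proof (rule submoduleI)
    fix x assume x: "x \<in> S"
    then have xM: "x \<in> carrier M" using assms(2) by auto
    have "(- 1) \<odot>\<^bsub>M\<^esub> x \<oplus>\<^bsub>M\<^esub> 1 \<odot>\<^bsub>M\<^esub> x = ((- 1) + 1) \<odot>\<^bsub>M\<^esub> x"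
      using smult_l_distr[of "- 1" 1 x] xM by simp
    also have "\<dots> = \<zero>\<^bsub>M\<^esub>"
      using smult_l_null[of x] xM by simp
    finally have "(- 1) \<odot>\<^bsub>M\<^esub> x \<oplus>\<^bsub>M\<^esub> x = \<zero>\<^bsub>M\<^esub>"
      using smult_one[of x] xM by simp
    then have "\<ominus>\<^bsub>M\<^esub> x = (- 1) \<odot>\<^bsub>M\<^esub> x"
      using xM smult_closed[of "- 1" x] by (intro M.minus_equality) simp_all
    then show "\<ominus>\<^bsub>M\<^esub> x \<in> S"
      using smult[OF x] by simp
  qed (use assms in auto)
qed

lemma vector_space_zero_vs: "vector_space_over (zero_vs :: ('k::field, 'v) vs)"
proof (rule vector_spaceI)
  show "abelian_group (zero_vs :: ('k::field, 'v) vs)"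
    by (rule abelian_groupI) (auto simp: zero_vs_def)
qed (auto simp: zero_vs_def)

lemma abelian_subgroup_submodule:
  assumes "vector_space_over M" "submodule B kring M"
  shows "abelian_subgroup B M"
proof -
  interpret module kring M by fact
  show ?thesis
    by (intro abelian_subgroupI3 additive_subgroup.intro submodule.axioms(1)[OF assms(2)]
        abelian_group_axioms)
qed

lemma
  assumes M: "vector_space_over M" and B: "submodule B kring M"
  shows coset_add: "\<lbrakk>x \<in> carrier M; y \<in> carrier M\<rbrakk> \<Longrightarrow> (B +>\<^bsub>M\<^esub> x) <+>\<^bsub>M\<^esub> (B +>\<^bsub>M\<^esub> y) = B +>\<^bsub>M\<^esub> (x \<oplus>\<^bsub>M\<^esub> y)"
    and coset_eq_iff: "\<lbrakk>x \<in> carrier M; y \<in> carrier M\<rbrakk> \<Longrightarrow> B +>\<^bsub>M\<^esub> x = B +>\<^bsub>M\<^esub> y \<longleftrightarrow> (\<exists>b\<in>B. x = b \<oplus>\<^bsub>M\<^esub> y)"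
    and coset_zero: "B +>\<^bsub>M\<^esub> \<zero>\<^bsub>M\<^esub> = B"
    and coset_self: "x \<in> carrier M \<Longrightarrow> x \<in> B +>\<^bsub>M\<^esub> x"
proof -
  interpret module kring M by fact
  interpret abelian_subgroup B M
    using assms by (rule abelian_subgroup_submodule)
  show "\<lbrakk>x \<in> carrier M; y \<in> carrier M\<rbrakk> \<Longrightarrow> (B +>\<^bsub>M\<^esub> x) <+>\<^bsub>M\<^esub> (B +>\<^bsub>M\<^esub> y) = B +>\<^bsub>M\<^esub> (x \<oplus>\<^bsub>M\<^esub> y)"
    by (rule a_rcos_sum)
  show self: "x \<in> carrier M \<Longrightarrow> x \<in> B +>\<^bsub>M\<^esub> x" for x
    by (rule a_rcos_self)
  show "B +>\<^bsub>M\<^esub> x = B +>\<^bsub>M\<^esub> y \<longleftrightarrow> (\<exists>b\<in>B. x = b \<oplus>\<^bsub>M\<^esub> y)" if "x \<in> carrier M" "y \<in> carrier M"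
  proof -
    have "B +>\<^bsub>M\<^esub> x = B +>\<^bsub>M\<^esub> y \<longleftrightarrow> x \<in> B +>\<^bsub>M\<^esub> y"
      using a_repr_independence'[of x y] self[of x] that by auto
    then show ?thesis
      by (auto simp: a_r_coset_def')
  qed
  show "B +>\<^bsub>M\<^esub> \<zero>\<^bsub>M\<^esub> = B"
    by (rule a_coset_join2) (simp_all add: a_subgroup)
qed

text \<open>Scalar multiplication in \<open>quot_vs\<close> and the map \<open>quot_map\<close> are
  unions over all representatives; they are evaluated by showing that every representative gives the
  same coset.\<close>

lemma UN_coset_const:
  assumes "z \<in> C" "\<And>z'. z' \<in> C \<Longrightarrow> g z' = g z"
  shows "(\<Union>z\<in>C. g z) = g z"
  using assms by blast

lemma coset_smult:
  assumes M: "vector_space_over M" and B: "submodule B kring M" and x: "x \<in> carrier M"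
  shows "(\<Union>z\<in>B +>\<^bsub>M\<^esub> x. B +>\<^bsub>M\<^esub> (a \<odot>\<^bsub>M\<^esub> z)) = B +>\<^bsub>M\<^esub> (a \<odot>\<^bsub>M\<^esub> x)"
proof (rule UN_coset_const)
  interpret module kring M by fact
  interpret B: submodule B kring M by fact
  show "x \<in> B +>\<^bsub>M\<^esub> x"
    by (rule coset_self[OF M B x])
  fix z assume "z \<in> B +>\<^bsub>M\<^esub> x"
  then obtain b where b: "b \<in> B" "z = b \<oplus>\<^bsub>M\<^esub> x"
    by (auto simp: a_r_coset_def')
  have bM: "b \<in> carrier M"
    using b(1) B.subset by auto
  then have "a \<odot>\<^bsub>M\<^esub> z = a \<odot>\<^bsub>M\<^esub> b \<oplus>\<^bsub>M\<^esub> a \<odot>\<^bsub>M\<^esub> x"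
    using b x by (simp add: smult_r_distr)
  moreover have "a \<odot>\<^bsub>M\<^esub> b \<in> B"
    using b by simp
  ultimately show "B +>\<^bsub>M\<^esub> (a \<odot>\<^bsub>M\<^esub> z) = B +>\<^bsub>M\<^esub> (a \<odot>\<^bsub>M\<^esub> x)"
    using b x bM by (subst coset_eq_iff[OF M B]) auto
qed

text \<open>Additivity of \<open>g\<close> is required only between \<open>B\<close> and the one
  element \<open>z\<close>; this already forces all members of the coset to have the same
  image.\<close>

lemma quot_map_coset:
  assumes M: "vector_space_over M" and B: "submodule B kring M"
    and M': "vector_space_over M'" and B': "submodule B' kring M'"
    and z: "z \<in> carrier M" and gz: "g z \<in> carrier M'"
    and g: "\<And>b. b \<in> B \<Longrightarrow> g b \<in> B' \<and> g (b \<oplus>\<^bsub>M\<^esub> z) = g b \<oplus>\<^bsub>M'\<^esub> g z"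
  shows "quot_map M' B' g (B +>\<^bsub>M\<^esub> z) = B' +>\<^bsub>M'\<^esub> g z"
  unfolding quot_map_def
proof (rule UN_coset_const)
  interpret M': module kring M' by fact
  interpret B': submodule B' kring M' by fact
  show "z \<in> B +>\<^bsub>M\<^esub> z"
    by (rule coset_self[OF M B z])
  fix w assume "w \<in> B +>\<^bsub>M\<^esub> z"
  then obtain b where b: "b \<in> B" "w = b \<oplus>\<^bsub>M\<^esub> z"
    by (auto simp: a_r_coset_def')
  have "g b \<in> carrier M'"
    using g[OF b(1)] B'.subset by auto
  then show "B' +>\<^bsub>M'\<^esub> g w = B' +>\<^bsub>M'\<^esub> g z"
    using gz g[OF b(1)] b by (subst coset_eq_iff[OF M' B']) auto
qed

lemma vector_space_quot:
  assumes M: "vector_space_over M" and Z: "submodule Z kring M" and B: "submodule B kring M" and sub: "B \<subseteq> Z"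
  shows "vector_space_over (quot_vs M Z B)"
proof -
  interpret module kring M by fact
  interpret Z: submodule Z kring M by fact
  have c: "z \<in> carrier M" if "z \<in> Z" for z
    using that Z.subset by auto
  note [simp] = coset_add[OF M B] coset_smult[OF M B] c
  have zadd: "x \<oplus>\<^bsub>M\<^esub> y \<in> Z" if "x \<in> Z" "y \<in> Z" for x y
    using Z.m_closed that by simp
  have zinv: "\<exists>w\<in>Z. w \<oplus>\<^bsub>M\<^esub> z = \<zero>\<^bsub>M\<^esub>" if "z \<in> Z" for z
    using Z.m_inv_closed[OF that] that by (intro bexI[of _ "\<ominus>\<^bsub>M\<^esub> z"]) (auto simp: M.l_neg a_inv_def)
  have z0: "\<zero>\<^bsub>M\<^esub> \<in> Z"
    using Z.one_closed by simp
  show ?thesis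
  proof (rule vector_spaceI)
    show "abelian_group (quot_vs M Z B)"
    proof (rule abelian_groupI)
      show "\<zero>\<^bsub>quot_vs M Z B\<^esub> \<in> carrier (quot_vs M Z B)"
        using z0 coset_zero[OF M B] by force
    next
      fix x assume "x \<in> carrier (quot_vs M Z B)"
      then obtain z where z: "z \<in> Z" "x = B +>\<^bsub>M\<^esub> z" by auto
      have "\<zero>\<^bsub>quot_vs M Z B\<^esub> \<oplus>\<^bsub>quot_vs M Z B\<^esub> x = (B +>\<^bsub>M\<^esub> \<zero>\<^bsub>M\<^esub>) <+>\<^bsub>M\<^esub> (B +>\<^bsub>M\<^esub> z)"
        by (simp only: quot_vs_simps z coset_zero[OF M B])
      then show "\<zero>\<^bsub>quot_vs M Z B\<^esub> \<oplus>\<^bsub>quot_vs M Z B\<^esub> x = x"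
        using z by simp
      obtain w where w: "w \<in> Z" "w \<oplus>\<^bsub>M\<^esub> z = \<zero>\<^bsub>M\<^esub>"
        using zinv z by auto
      show "\<exists>y\<in>carrier (quot_vs M Z B). y \<oplus>\<^bsub>quot_vs M Z B\<^esub> x = \<zero>\<^bsub>quot_vs M Z B\<^esub>"
        using w z coset_zero[OF M B] by (intro bexI[of _ "B +>\<^bsub>M\<^esub> w"]) auto
    qed (auto simp: zadd a_ac)
  next
    fix a b :: 'a and x assume "x \<in> carrier (quot_vs M Z B)"
    then obtain z where z: "z \<in> Z" "x = B +>\<^bsub>M\<^esub> z" by auto
    have zs: "c \<odot>\<^bsub>M\<^esub> z \<in> Z" for c
      using z by simp
    show "a \<odot>\<^bsub>quot_vs M Z B\<^esub> x \<in> carrier (quot_vs M Z B)"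
      using z zs by simp
    show "(a + b) \<odot>\<^bsub>quot_vs M Z B\<^esub> x = a \<odot>\<^bsub>quot_vs M Z B\<^esub> x \<oplus>\<^bsub>quot_vs M Z B\<^esub> b \<odot>\<^bsub>quot_vs M Z B\<^esub> x"
      using z zs smult_l_distr[of a b z] by simp
    show "(a * b) \<odot>\<^bsub>quot_vs M Z B\<^esub> x = a \<odot>\<^bsub>quot_vs M Z B\<^esub> (b \<odot>\<^bsub>quot_vs M Z B\<^esub> x)"
      using z zs smult_assoc1[of a b z] by simp
    show "1 \<odot>\<^bsub>quot_vs M Z B\<^esub> x = x"
      using z zs smult_one[of z] by simp
    fix y assume "y \<in> carrier (quot_vs M Z B)"
    then obtain w where w: "w \<in> Z" "y = B +>\<^bsub>M\<^esub> w" by auto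
    then show "a \<odot>\<^bsub>quot_vs M Z B\<^esub> (x \<oplus>\<^bsub>quot_vs M Z B\<^esub> y) = a \<odot>\<^bsub>quot_vs M Z B\<^esub> x \<oplus>\<^bsub>quot_vs M Z B\<^esub> a \<odot>\<^bsub>quot_vs M Z B\<^esub> y"
      using z zs smult_r_distr[of a z w] by simp
  qed
qed

lemma vector_space_direct_sum:
  assumes fin: "finite J" and M: "\<And>j. vector_space_over (M j)"
  shows "vector_space_over (direct_sum J M)"
proof -
  note ag = module.axioms(2)[OF M]
  note [simp] = abelian_groupE(1-3,5)[OF ag] module.smult_closed[OF M, simplified]
  note cd = carrier_direct_sum[OF fin]
  have z: "a \<odot>\<^bsub>M j\<^esub> \<zero>\<^bsub>M j\<^esub> = \<zero>\<^bsub>M j\<^esub>" for a j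
    using module.smult_r_null[OF M] by simp
  show ?thesis
  proof (rule vector_spaceI)
    show "abelian_group (direct_sum J M)"
    proof (rule abelian_groupI)
      fix x assume x: "x \<in> carrier (direct_sum J M)"
      have xc: "x j \<in> carrier (M j)" for j
        using x by (cases "j \<in> J") (auto simp: cd)
      show "\<exists>y\<in>carrier (direct_sum J M). y \<oplus>\<^bsub>direct_sum J M\<^esub> x = \<zero>\<^bsub>direct_sum J M\<^esub>"
      proof (rule bexI)
        show "(\<lambda>j. if j \<in> J then \<ominus>\<^bsub>M j\<^esub> x j else \<zero>\<^bsub>M j\<^esub>) \<oplus>\<^bsub>direct_sum J M\<^esub> x = \<zero>\<^bsub>direct_sum J M\<^esub>"
          using x xc abelian_group.l_neg[OF ag] abelian_groupE(5)[OF ag]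
          by (simp add: cd fun_eq_iff)
        show "(\<lambda>j. if j \<in> J then \<ominus>\<^bsub>M j\<^esub> x j else \<zero>\<^bsub>M j\<^esub>) \<in> carrier (direct_sum J M)"
          using x by (auto simp: cd abelian_group.a_inv_closed[OF ag])
      qed
      show "\<zero>\<^bsub>direct_sum J M\<^esub> \<oplus>\<^bsub>direct_sum J M\<^esub> x = x"
        using xc abelian_groupE(5)[OF ag] by (simp only: direct_sum_simps)
      fix y assume y: "y \<in> carrier (direct_sum J M)"
      have yc: "y j \<in> carrier (M j)" for j
        using y by (cases "j \<in> J") (auto simp: cd)
      show "x \<oplus>\<^bsub>direct_sum J M\<^esub> y \<in> carrier (direct_sum J M)"
        using x y by (auto simp: cd)
      show "x \<oplus>\<^bsub>direct_sum J M\<^esub> y = y \<oplus>\<^bsub>direct_sum J M\<^esub> x"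
        using xc yc by (simp add: abelian_groupE(4)[OF ag])
      fix w assume w: "w \<in> carrier (direct_sum J M)"
      have wc: "w j \<in> carrier (M j)" for j
        using w by (cases "j \<in> J") (auto simp: cd)
      show "x \<oplus>\<^bsub>direct_sum J M\<^esub> y \<oplus>\<^bsub>direct_sum J M\<^esub> w = x \<oplus>\<^bsub>direct_sum J M\<^esub> (y \<oplus>\<^bsub>direct_sum J M\<^esub> w)"
        using xc yc wc by (simp add: abelian_groupE(3)[OF ag])
    qed (auto simp: cd)
  next
    fix a b :: 'b and x assume x: "x \<in> carrier (direct_sum J M)"
    have xc: "x j \<in> carrier (M j)" for j
      using x by (cases "j \<in> J") (auto simp: cd)
    show "a \<odot>\<^bsub>direct_sum J M\<^esub> x \<in> carrier (direct_sum J M)"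
      using x by (auto simp: cd z)
    show "(a + b) \<odot>\<^bsub>direct_sum J M\<^esub> x = a \<odot>\<^bsub>direct_sum J M\<^esub> x \<oplus>\<^bsub>direct_sum J M\<^esub> b \<odot>\<^bsub>direct_sum J M\<^esub> x"
      using xc module.smult_l_distr[OF M, simplified] by (simp add: fun_eq_iff)
    show "(a * b) \<odot>\<^bsub>direct_sum J M\<^esub> x = a \<odot>\<^bsub>direct_sum J M\<^esub> (b \<odot>\<^bsub>direct_sum J M\<^esub> x)"
      using xc module.smult_assoc1[OF M, simplified] by (simp add: fun_eq_iff)
    show "1 \<odot>\<^bsub>direct_sum J M\<^esub> x = x"
      using xc module.smult_one[OF M, simplified] by (simp add: fun_eq_iff)
    fix y assume y: "y \<in> carrier (direct_sum J M)"
    have yc: "y j \<in> carrier (M j)" for j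
      using y by (cases "j \<in> J") (auto simp: cd)
    show "a \<odot>\<^bsub>direct_sum J M\<^esub> (x \<oplus>\<^bsub>direct_sum J M\<^esub> y) = a \<odot>\<^bsub>direct_sum J M\<^esub> x \<oplus>\<^bsub>direct_sum J M\<^esub> a \<odot>\<^bsub>direct_sum J M\<^esub> y"
      using xc yc module.smult_r_distr[OF M, simplified] by (simp add: fun_eq_iff)
  qed
qed

section \<open>Singular homology classes\<close>

lemma sing_chains_simps [simp]:
  "carrier (sing_chains p X) = {c. kchain p X c}"
  "\<zero>\<^bsub>sing_chains p X\<^esub> = 0"
  "c \<oplus>\<^bsub>sing_chains p X\<^esub> c' = c + c'"
  "a \<odot>\<^bsub>sing_chains p X\<^esub> c = chain_scale a c"
  by (simp_all add: sing_chains_def chain_scale_def)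

lemma vector_space_sing_chains: "vector_space_over (sing_chains p X :: ('k::field, ('x, 'k) kchain) vs)"
proof (rule vector_spaceI)
  show "abelian_group (sing_chains p X :: ('k::field, ('x, 'k) kchain) vs)"
  proof (rule abelian_groupI)
    fix c :: "('x, 'k) kchain" assume "c \<in> carrier (sing_chains p X)"
    then show "\<exists>c'\<in>carrier (sing_chains p X). c' \<oplus>\<^bsub>sing_chains p X\<^esub> c = \<zero>\<^bsub>sing_chains p X\<^esub>"
      by (intro bexI[of _ "- c"]) auto
  qed (simp_all add: algebra_simps kchain_add)
qed (simp_all add: kchain_scale kch.scale_left_distrib kch.scale_right_distrib)

lemma sing_cycles_iff: "c \<in> sing_cycles p X \<longleftrightarrow> kchain p X c \<and> sing_boundary p c = 0"
  by (simp add: sing_cycles_def)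

lemma sing_cycles_kchain: "z \<in> sing_cycles p X \<Longrightarrow> kchain p X z"
  by (simp add: sing_cycles_iff)

lemma sing_boundaries_iff:
  "c \<in> sing_boundaries p X \<longleftrightarrow> (\<exists>w. kchain (Suc p) X w \<and> c = sing_boundary (Suc p) w)"
  by (auto simp: sing_boundaries_def)

lemma submodule_sing_cycles: "submodule (sing_cycles p X) kring (sing_chains p X)"
  by (rule vector_subspaceI[OF vector_space_sing_chains])
    (simp_all add: subset_iff[of "sing_cycles p X" "{c. kchain p X c}"] sing_cycles_iff kchain_0 kchain_add kchain_scale klinear_0[OF klinear_sing_boundary]
      klinear_add[OF klinear_sing_boundary] klinear_scale[OF klinear_sing_boundary])

lemma sing_boundaries_0: "0 \<in> sing_boundaries p X"
  unfolding sing_boundaries_iff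
  by (rule exI[of _ 0]) (simp add: klinear_0[OF klinear_sing_boundary])

lemma sing_boundaries_add:
  "c \<in> sing_boundaries p X \<Longrightarrow> c' \<in> sing_boundaries p X \<Longrightarrow> c + c' \<in> sing_boundaries p X"
  unfolding sing_boundaries_iff by (metis kchain_add klinear_add[OF klinear_sing_boundary])

lemma sing_boundaries_scale:
  "c \<in> sing_boundaries p X \<Longrightarrow> chain_scale a c \<in> sing_boundaries p X"
  unfolding sing_boundaries_iff by (metis kchain_scale klinear_scale[OF klinear_sing_boundary])

lemma sing_boundaries_diff:
  "c \<in> sing_boundaries p X \<Longrightarrow> c' \<in> sing_boundaries p X \<Longrightarrow> c - c' \<in> sing_boundaries p X"
  unfolding sing_boundaries_iff by (metis kchain_diff klinear_diff[OF klinear_sing_boundary])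

lemma sing_boundaries_sum:
  "(\<And>i. i \<in> A \<Longrightarrow> g i \<in> sing_boundaries p X) \<Longrightarrow> (\<Sum>i\<in>A. g i) \<in> sing_boundaries p X"
  by (induction A rule: infinite_finite_induct) (auto simp: sing_boundaries_0 sing_boundaries_add)

lemma sing_boundaries_subset: "sing_boundaries p X \<subseteq> sing_cycles p X"
proof
  fix c assume "c \<in> sing_boundaries p X"
  then obtain w where "kchain (Suc p) X w" "c = sing_boundary (Suc p) w"
    unfolding sing_boundaries_iff by blast
  then show "c \<in> sing_cycles p X"
    by (metis (no_types) kchain_sing_boundary sing_boundary_boundary sing_cycles_iff)
qed

lemma submodule_sing_boundaries: "submodule (sing_boundaries p X) kring (sing_chains p X)"
  by (rule vector_subspaceI[OF vector_space_sing_chains])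
    (simp_all add: subset_iff[of "sing_boundaries p X" "{c. kchain p X c}"]
      sing_boundaries_0 sing_boundaries_add sing_boundaries_scale
      sing_cycles_kchain[OF subsetD[OF sing_boundaries_subset]])

lemma sing_cycles_0: "0 \<in> sing_cycles p X"
  and sing_cycles_add: "c \<in> sing_cycles p X \<Longrightarrow> c' \<in> sing_cycles p X \<Longrightarrow> c + c' \<in> sing_cycles p X"
  and sing_cycles_diff: "c \<in> sing_cycles p X \<Longrightarrow> c' \<in> sing_cycles p X \<Longrightarrow> c - c' \<in> sing_cycles p X"
  and sing_cycles_scale: "c \<in> sing_cycles p X \<Longrightarrow> chain_scale a c \<in> sing_cycles p X"
  by (simp_all add: sing_cycles_iff kchain_0 kchain_add kchain_diff kchain_scale
      klinear_0[OF klinear_sing_boundary] klinear_add[OF klinear_sing_boundary]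
      klinear_diff[OF klinear_sing_boundary] klinear_scale[OF klinear_sing_boundary])

lemma sing_cycles_sum:
  "(\<And>i. i \<in> A \<Longrightarrow> g i \<in> sing_cycles p X) \<Longrightarrow> (\<Sum>i\<in>A. g i) \<in> sing_cycles p X"
  by (induction A rule: infinite_finite_induct) (auto simp: sing_cycles_0 sing_cycles_add)

definition hclass :: "nat \<Rightarrow> 'x topology \<Rightarrow> ('x, 'k::field) kchain \<Rightarrow> ('x, 'k) kchain set" where
  "hclass p X z = sing_boundaries p X +>\<^bsub>sing_chains p X\<^esub> z"

lemma carrier_sing_homology: "carrier (sing_homology p X) = hclass p X ` sing_cycles p X"
  by (simp add: sing_homology_def hclass_def[abs_def])

lemma hclass_closed: "z \<in> sing_cycles p X \<Longrightarrow> hclass p X z \<in> carrier (sing_homology p X)"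
  by (simp add: carrier_sing_homology)

lemma zero_sing_homology: "\<zero>\<^bsub>sing_homology p X\<^esub> = hclass p X 0"
  using coset_zero[OF vector_space_sing_chains submodule_sing_boundaries, of p X, symmetric]
  by (simp only: sing_homology_def hclass_def quot_vs_simps sing_chains_simps)

lemma add_hclass:
  "z \<in> sing_cycles p X \<Longrightarrow> w \<in> sing_cycles p X \<Longrightarrow>
    hclass p X z \<oplus>\<^bsub>sing_homology p X\<^esub> hclass p X w = hclass p X (z + w)"
  using coset_add[OF vector_space_sing_chains submodule_sing_boundaries, of z p X w]
  by (simp add: sing_homology_def hclass_def sing_cycles_iff)

lemma smult_hclass:
  "z \<in> sing_cycles p X \<Longrightarrow> a \<odot>\<^bsub>sing_homology p X\<^esub> hclass p X z = hclass p X (chain_scale a z)"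
  using coset_smult[OF vector_space_sing_chains submodule_sing_boundaries, of z p X a]
  by (simp add: sing_homology_def hclass_def sing_cycles_iff)

lemma hclass_eq_iff:
  assumes "z \<in> sing_cycles p X" "w \<in> sing_cycles p X"
  shows "hclass p X z = hclass p X w \<longleftrightarrow> z - w \<in> sing_boundaries p X"
proof -
  have "(\<exists>b\<in>sing_boundaries p X. z = b + w) \<longleftrightarrow> z - w \<in> sing_boundaries p X"
    by (metis add_diff_cancel diff_add_cancel)
  then show ?thesis
    using coset_eq_iff[OF vector_space_sing_chains submodule_sing_boundaries, of z p X w] assms
    by (simp add: hclass_def sing_cycles_iff)
qed

lemma vector_space_sing_homology: "vector_space_over (sing_homology p X)"
  unfolding sing_homology_def
  by (intro vector_space_quot vector_space_sing_chains submodule_sing_cycles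
      submodule_sing_boundaries sing_boundaries_subset)

lemma finsum_hclass:
  fixes g :: "'e \<Rightarrow> ('x, 'k::field) kchain"
  assumes "finite A" "\<And>e. e \<in> A \<Longrightarrow> g e \<in> sing_cycles p X"
  shows "finsum (sing_homology p X) (\<lambda>e. hclass p X (g e)) A = hclass p X (\<Sum>e\<in>A. g e)"
proof -
  interpret module kring "sing_homology p X :: ('k, ('x, 'k) kchain set) vs"
    by (rule vector_space_sing_homology)
  show ?thesis
    using assms
  proof (induction A rule: finite_induct)
    case empty
    then show ?case by (simp add: zero_sing_homology)
  next
    case (insert e A)
    then show ?case
      using M.finsum_insert[of A e "\<lambda>e. hclass p X (g e)"]
      by (simp add: hclass_closed add_hclass sing_cycles_sum)
  qed
qed

text \<open>\<open>simplex_map\<close> restricts the composite to the standard simplex, so it fixes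
  a function only if that function is extensional; singular simplices are, which is what the
  hypothesis on the support supplies.\<close>

lemma sing_chain_map_id:
  assumes "kchain p X c"
  shows "sing_chain_map p (\<lambda>x. x) c = c"
proof -
  have "simplex_map p (\<lambda>x. x) s = s" if "s \<in> Poly_Mapping.keys c" for s
    using assms that by (intro simplex_map_id_gen[of p X]) auto
  then have "sing_chain_map p (\<lambda>x. x) c =
      (\<Sum>s\<in>Poly_Mapping.keys c. Poly_Mapping.single s (Poly_Mapping.lookup c s))"
    unfolding sing_chain_map_def by (intro sum.cong) simp_all
  then show ?thesis
    by (simp add: chain_expansion)
qed

text \<open>The representing cycle is unchanged. The inclusion in degree \<open>p\<close> keeps it a
  cycle of the larger space, the one in degree \<open>Suc p\<close> keeps boundaries
  boundaries.\<close>

lemma sing_homology_map_inclusion: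
  assumes "z \<in> sing_cycles p X" and sub: "singular_simplex_set p X \<subseteq> singular_simplex_set p X'"
    "singular_simplex_set (Suc p) X \<subseteq> singular_simplex_set (Suc p) X'"
  shows "sing_homology_map p X' (\<lambda>x. x) (hclass p X z) = hclass p X' z"
proof -
  have z: "kchain p X z"
    using assms(1) by (rule sing_cycles_kchain)
  have "sing_chain_map p (\<lambda>x. x) b \<in> sing_boundaries p X' \<and>
      sing_chain_map p (\<lambda>x. x) (b + z) = sing_chain_map p (\<lambda>x. x) b + sing_chain_map p (\<lambda>x. x) z"
    if "b \<in> sing_boundaries p X" for b
  proof -
    have b: "kchain p X b"
      using that sing_boundaries_subset sing_cycles_kchain by blast
    have "b \<in> sing_boundaries p X'"
      using that sub(2) unfolding sing_boundaries_iff by blast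
    then show ?thesis
      using sing_chain_map_id[OF b] sing_chain_map_id[OF z] sing_chain_map_id[OF kchain_add[OF b z]]
      by simp
  qed
  then have "sing_homology_map p X' (\<lambda>x. x) (hclass p X z) = hclass p X' (sing_chain_map p (\<lambda>x. x) z)"
    unfolding sing_homology_map_def hclass_def
    using sub(1) z
    by (intro quot_map_coset[OF vector_space_sing_chains submodule_sing_boundaries
        vector_space_sing_chains submodule_sing_boundaries]) (auto simp: sing_chain_map_id)
  then show ?thesis
    by (simp add: sing_chain_map_id[OF z])
qed

section \<open>Normalised cycles and primitives\<close>

lemma subspace_kchain: "kch.subspace {c. kchain p X c}"
  by (simp add: kch.subspace_def kchain_add kchain_scale)

lemma subspace_sing_boundaries: "kch.subspace (sing_boundaries p X)"
  by (simp add: kch.subspace_def sing_boundaries_0 sing_boundaries_add sing_boundaries_scale)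

text \<open>Over a field the boundary map on the chains of \<open>X\<close> has a linear right
  inverse on its image. Linearity of the fillings is what later makes gluing linear.\<close>

lemma primitive_exists:
  fixes X :: "'x topology"
  shows "\<exists>g :: ('x, 'k::field) kchain \<Rightarrow> ('x, 'k) kchain. klinear g \<and> (\<forall>y. kchain (Suc p) X (g y)) \<and>
     (\<forall>y\<in>sing_boundaries p X. sing_boundary (Suc p) (g y) = y)"
proof -
  obtain g :: "('x, 'k) kchain \<Rightarrow> ('x, 'k) kchain" where
    "g ` UNIV \<subseteq> {c. kchain (Suc p) X c}" "klinear g"
    "\<forall>v\<in>sing_boundary (Suc p) ` {c. kchain (Suc p) X c}. sing_boundary (Suc p) (g v) = v"
    using kch2.linear_exists_right_inverse_on[OF klinear_sing_boundary subspace_kchain] by blast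
  then show ?thesis
    by (intro exI[of _ g]) (auto simp: sing_boundaries_iff)
qed

text \<open>The identity minus a projection onto the boundaries selects one representative from each
  homology class, in a linear way.\<close>

lemma normaliser_exists:
  fixes X :: "'x topology"
  shows "\<exists>R :: ('x, 'k::field) kchain \<Rightarrow> ('x, 'k) kchain. klinear R \<and> (\<forall>z. R z - z \<in> sing_boundaries p X) \<and>
     (\<forall>b\<in>sing_boundaries p X. R b = 0)"
proof -
  \<comment> \<open>A linear left inverse of the inclusion of the boundaries is a projection onto
    them.\<close>
  obtain g :: "('x, 'k) kchain \<Rightarrow> ('x, 'k) kchain" where
    g: "g ` UNIV \<subseteq> sing_boundaries p X" "klinear g" "\<forall>v\<in>sing_boundaries p X. g v = v"
    using kch2.linear_exists_left_inverse_on[OF klinear_id subspace_sing_boundaries[of p X]]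
    by (auto simp: inj_on_def)
  have "- g z \<in> sing_boundaries p X" for z
    using g(1) sing_boundaries_diff[OF sing_boundaries_0, of "g z"] by auto
  then show ?thesis
    using g by (intro exI[of _ "\<lambda>z. z - g z"]) (simp add: klinear_diff_fun klinear_id)
qed

definition primitive :: "nat \<Rightarrow> 'x topology \<Rightarrow> ('x, 'k::field) kchain \<Rightarrow> ('x, 'k) kchain" where
  "primitive p X = (SOME g. klinear g \<and> (\<forall>y. kchain (Suc p) X (g y)) \<and>
     (\<forall>y\<in>sing_boundaries p X. sing_boundary (Suc p) (g y) = y))"

definition normaliser :: "nat \<Rightarrow> 'x topology \<Rightarrow> ('x, 'k::field) kchain \<Rightarrow> ('x, 'k) kchain" where
  "normaliser p X = (SOME R. klinear R \<and> (\<forall>z. R z - z \<in> sing_boundaries p X) \<and>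
     (\<forall>b\<in>sing_boundaries p X. R b = 0))"

lemma klinear_primitive: "klinear (primitive p X)"
  and kchain_primitive: "kchain (Suc p) X (primitive p X y)"
  and sing_boundary_primitive: "y \<in> sing_boundaries p X \<Longrightarrow> sing_boundary (Suc p) (primitive p X y) = y"
  using someI_ex[OF primitive_exists[of p X], folded primitive_def] by blast+

lemma klinear_normaliser: "klinear (normaliser p X)"
  and normaliser_diff: "normaliser p X z - z \<in> sing_boundaries p X"
  and normaliser_boundary: "b \<in> sing_boundaries p X \<Longrightarrow> normaliser p X b = 0"
  using someI_ex[OF normaliser_exists[of p X], folded normaliser_def] by blast+

lemma normaliser_cycle: "z \<in> sing_cycles p X \<Longrightarrow> normaliser p X z \<in> sing_cycles p X"
  using sing_cycles_add[OF subsetD[OF sing_boundaries_subset normaliser_diff], of z p X z] by simp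

lemma normaliser_boundary_iff:
  "normaliser p X z \<in> sing_boundaries p X \<longleftrightarrow> z \<in> sing_boundaries p X"
proof
  assume "normaliser p X z \<in> sing_boundaries p X"
  from sing_boundaries_diff[OF this normaliser_diff[of p X z]] show "z \<in> sing_boundaries p X"
    by simp
qed (simp add: normaliser_boundary sing_boundaries_0)

lemma ksubdiv_diff:
  assumes "z \<in> sing_cycles p X"
  shows "ksubdiv p n z - z \<in> sing_boundaries p X"
  using ksubdiv_homotopy[of z p X n] assms by (auto simp: sing_cycles_iff sing_boundaries_iff)

lemma ksubdiv_boundary_iff:
  assumes "z \<in> sing_cycles p X"
  shows "ksubdiv p n z \<in> sing_boundaries p X \<longleftrightarrow> z \<in> sing_boundaries p X"
  using sing_boundaries_diff[OF _ ksubdiv_diff[OF assms, of n], of "ksubdiv p n z"]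
    sing_boundaries_add[OF ksubdiv_diff[OF assms, of n], of z] by auto

section \<open>Covers with one-dimensional nerve\<close>

lemma singular_simplex_preimage:
  "singular_simplex p (preimage X f V) s \<longleftrightarrow> singular_simplex p X s \<and> (\<forall>t\<in>standard_simplex p. f (s t) \<in> V)"
proof -
  have "s t \<in> topspace X" if "singular_simplex p X s" "t \<in> standard_simplex p" for t
    using that by (auto simp: singular_simplex_def topspace_standard_simplex
        dest!: continuous_map_image_subset_topspace)
  then show ?thesis
    by (auto simp: preimage_def singular_simplex_subtopology)
qed

text \<open>The inclusion is asked only at values of \<open>f\<close>: in later uses an open
  \<open>V\<close> may leave the union of the cover while its preimage is still covered.\<close>

lemma singular_simplex_preimage_mono:
  assumes "\<And>x. x \<in> topspace X \<Longrightarrow> f x \<in> V \<Longrightarrow> f x \<in> W"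
  shows "singular_simplex_set p (preimage X f V) \<subseteq> singular_simplex_set p (preimage X f W)"
  unfolding preimage_def using assms by (auto elim!: singular_simplex_mono)

lemma kchain_preimage_mono:
  assumes "kchain p (preimage X f V) c" "\<And>x. x \<in> topspace X \<Longrightarrow> f x \<in> V \<Longrightarrow> f x \<in> W"
  shows "kchain p (preimage X f W) c"
  using order_trans[OF assms(1) singular_simplex_preimage_mono] assms(2) by blast

lemma sing_cycles_preimage_mono:
  assumes "c \<in> sing_cycles p (preimage X f V)" "\<And>x. x \<in> topspace X \<Longrightarrow> f x \<in> V \<Longrightarrow> f x \<in> W"
  shows "c \<in> sing_cycles p (preimage X f W)"
  using assms kchain_preimage_mono[of c p X f V W] by (simp add: sing_cycles_iff)

lemma sing_boundaries_preimage_mono: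
  assumes "c \<in> sing_boundaries p (preimage X f V)" "\<And>x. x \<in> topspace X \<Longrightarrow> f x \<in> V \<Longrightarrow> f x \<in> W"
  shows "c \<in> sing_boundaries p (preimage X f W)"
  using assms kchain_preimage_mono[of _ "Suc p" X f V W] unfolding sing_boundaries_iff by blast

lemma kchain_preimage_lookup:
  assumes "kchain p (preimage X f V) c" "Poly_Mapping.lookup c s \<noteq> 0" "t \<in> standard_simplex p"
  shows "f (s t) \<in> V"
  using assms by (auto simp: singular_simplex_preimage in_keys_iff subset_iff)

section \<open>Mayer-Vietoris on the level of chains\<close>

locale nerve_cover =
  fixes X :: "'x topology" and f :: "'x \<Rightarrow> 'y" and I :: "'i set" and U :: "'i \<Rightarrow> 'y set" and r :: "'i rel"
  assumes finite_I: "finite I"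
    and linear_r: "linear_order_on I r"
    and open_U: "\<And>i. i \<in> I \<Longrightarrow> openin X {x \<in> topspace X. f x \<in> U i}"
    and one_dim: "\<And>i j k. \<lbrakk>i \<in> I; j \<in> I; k \<in> I; i \<noteq> j; j \<noteq> k; i \<noteq> k\<rbrakk> \<Longrightarrow> U i \<inter> U j \<inter> U k = {}"
begin

abbreviation P :: "'y set \<Rightarrow> 'x topology" where
  "P V \<equiv> preimage X f V"

abbreviation UU :: "'i set \<Rightarrow> 'y set" where
  "UU \<sigma> \<equiv> (\<Inter>i\<in>\<sigma>. U i)"

definition edges :: "'i set set" where
  "edges = simplices_of_dim (nerve I U) 1"

lemma edgesE:
  assumes "e \<in> edges" "i \<in> e"
  obtains j where "i \<in> I" "j \<in> I" "i \<noteq> j" "e = {i, j}"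
proof -
  have "card e = 2" "e \<subseteq> I"
    using assms by (auto simp: edges_def simplices_of_dim_def nerve_def)
  then obtain a b where "e = {a, b}" "a \<noteq> b"
    by (meson card_2_iff)
  then show ?thesis
    using assms \<open>e \<subseteq> I\<close> that by fastforce
qed

lemma edgesI: "\<lbrakk>i \<in> I; j \<in> I; i \<noteq> j; y \<in> U i; y \<in> U j\<rbrakk> \<Longrightarrow> {i, j} \<in> edges"
  by (auto simp: edges_def simplices_of_dim_def nerve_def)

lemma edges_subset: "e \<in> edges \<Longrightarrow> e \<subseteq> I"
  by (auto simp: edges_def simplices_of_dim_def nerve_def)

lemma edges_nonempty: "e \<in> edges \<Longrightarrow> \<exists>i. i \<in> e"
  by (auto simp: edges_def simplices_of_dim_def nerve_def)

lemma finite_edges: "finite edges"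
  by (rule finite_subset[of _ "Pow I"]) (use edges_subset finite_I in auto)

lemma incidence_pair:
  assumes "i \<in> I" "j \<in> I" "i \<noteq> j"
  shows "(incidence r {i} {i, j} :: 'k::field) = (if (i, j) \<in> r then - 1 else 1)"
proof -
  have "{i, j} - {i} = {j}"
    using assms by auto
  then have "{w\<in>{i}. \<exists>v\<in>{i, j} - {i}. (w, v) \<in> r} = (if (i, j) \<in> r then {i} else {})"
    by auto
  then show ?thesis
    unfolding incidence_def by simp
qed

text \<open>A linear order contains exactly one of \<open>(i, j)\<close> and \<open>(j, i)\<close>,
  so the two ends of an edge get opposite signs. The cancellation in \<open>sum_delta\<close> comes
  from this.\<close>

lemma incidence_opposite:
  assumes "i \<in> I" "j \<in> I" "i \<noteq> j"
  shows "incidence r {j} {i, j} = - (incidence r {i} {i, j} :: 'k::field)"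
proof -
  have "(i, j) \<in> r \<or> (j, i) \<in> r" "\<not> ((i, j) \<in> r \<and> (j, i) \<in> r)"
    using linear_r assms
    by (auto simp: linear_order_on_def partial_order_on_def total_on_def antisym_def)
  then show ?thesis
    using incidence_pair[of i j, where 'k='k] incidence_pair[of j i, where 'k='k] assms
    by (auto simp: insert_commute)
qed

lemma incidence_square: "(incidence r \<sigma> \<tau> :: 'k::field) * incidence r \<sigma> \<tau> = 1"
  unfolding incidence_def by (simp flip: power_add power2_eq_square add: power_mult[symmetric] mult.commute)

text \<open>The component at vertex \<open>i\<close> of the cellular boundary, taken on singular
  chains instead of homology classes. All edges of the nerve are summed; a subcomplex enters only
  through the support of \<open>\<eta>\<close>.\<close>

definition edge_sum :: "('i set \<Rightarrow> ('x, 'k::field) kchain) \<Rightarrow> 'i \<Rightarrow> ('x, 'k) kchain" where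
  "edge_sum \<eta> i = (\<Sum>e\<in>{e\<in>edges. i \<in> e}. chain_scale (incidence r {i} e) (\<eta> e))"

notation edge_sum (\<open>\<delta>\<close>)

lemma delta_linear: "klinear h \<Longrightarrow> h (\<delta> \<eta> i) = \<delta> (\<lambda>e. h (\<eta> e)) i"
  by (simp add: edge_sum_def klinear_sum klinear_scale)

lemma delta_add: "\<delta> (\<lambda>e. \<eta> e + \<eta>' e) i = \<delta> \<eta> i + \<delta> \<eta>' i"
  by (simp add: edge_sum_def kch.scale_right_distrib sum.distrib)

lemma delta_diff: "\<delta> (\<lambda>e. \<eta> e - \<eta>' e) i = \<delta> \<eta> i - \<delta> \<eta>' i"
  by (simp add: edge_sum_def kch.scale_right_diff_distrib sum_subtractf)

lemma delta_0: "(\<And>e. e \<in> edges \<Longrightarrow> i \<in> e \<Longrightarrow> \<eta> e = 0) \<Longrightarrow> \<delta> \<eta> i = 0"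
  unfolding edge_sum_def by (rule sum.neutral) auto

lemma delta_in_subspace:
  assumes "kch.subspace S" "\<And>e. e \<in> edges \<Longrightarrow> i \<in> e \<Longrightarrow> \<eta> e \<in> S"
  shows "\<delta> \<eta> i \<in> S"
  unfolding edge_sum_def
  by (intro kch.subspace_sum kch.subspace_scale assms) auto

lemma delta_kchain:
  assumes "\<And>e. e \<in> edges \<Longrightarrow> kchain p (P (UU e)) (\<eta> e)"
  shows "kchain p (P (U i)) (\<delta> \<eta> i)"
proof -
  have "\<delta> \<eta> i \<in> {c. kchain p (P (U i)) c}"
  proof (rule delta_in_subspace[OF subspace_kchain], rule CollectI)
    fix e assume "e \<in> edges" "i \<in> e"
    then show "kchain p (P (U i)) (\<eta> e)"
      by (intro kchain_preimage_mono[OF assms]) auto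
  qed
  then show ?thesis by simp
qed

lemma delta_boundaries:
  assumes "\<And>e. e \<in> edges \<Longrightarrow> \<eta> e \<in> sing_boundaries p (P (UU e))"
  shows "\<delta> \<eta> i \<in> sing_boundaries p (P (U i))"
  by (rule delta_in_subspace[OF subspace_sing_boundaries])
    (rule sing_boundaries_preimage_mono[OF assms], auto)

lemma delta_cycles:
  assumes "\<And>e. e \<in> edges \<Longrightarrow> \<eta> e \<in> sing_cycles p (P (UU e))"
  shows "\<delta> \<eta> i \<in> sing_cycles p (P (U i))"
  unfolding edge_sum_def
  by (rule sing_cycles_sum, rule sing_cycles_scale, rule sing_cycles_preimage_mono[OF assms]) auto

text \<open>Every edge is counted at its two ends with opposite signs. Hence
  \<open>\<delta> \<eta> i\<close> may be added at each vertex without changing the sum over all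
  vertices.\<close>

lemma sum_delta:
  fixes \<eta> :: "'i set \<Rightarrow> ('x, 'k::field) kchain"
  shows "(\<Sum>i\<in>I. \<delta> \<eta> i) = 0"
proof -
  have "(\<Sum>i\<in>I. \<delta> \<eta> i) = (\<Sum>i\<in>I. \<Sum>e\<in>{e\<in>edges. i \<in> e}. chain_scale (incidence r {i} e) (\<eta> e))"
    by (simp add: edge_sum_def)
  also have "\<dots> = (\<Sum>e\<in>edges. \<Sum>i\<in>{i\<in>I. i \<in> e}. chain_scale (incidence r {i} e) (\<eta> e))"
    by (rule sum.swap_restrict) (simp_all add: finite_I finite_edges)
  also have "\<dots> = 0"
  proof (rule sum.neutral, rule ballI)
    fix e assume e: "e \<in> edges"
    then obtain i where "i \<in> e" using edges_nonempty by auto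
    with e obtain j where j: "i \<in> I" "j \<in> I" "i \<noteq> j" "e = {i, j}"
      by (rule edgesE)
    then have "{i\<in>I. i \<in> e} = {i, j}" by auto
    then show "(\<Sum>i\<in>{i\<in>I. i \<in> e}. chain_scale (incidence r {i} e) (\<eta> e)) = 0"
      using j incidence_opposite[of i j, where 'k='k] by simp
  qed
  finally show ?thesis .
qed

lemma edge_simplex_unique:
  assumes "e \<in> edges" "e' \<in> edges" "i \<in> e" "i \<in> e'" "e \<noteq> e'"
    and "kchain p (P (UU e)) c" "kchain p (P (UU e')) c'" "Poly_Mapping.lookup c s \<noteq> 0"
  shows "Poly_Mapping.lookup c' s = 0"
proof (rule ccontr)
  assume "Poly_Mapping.lookup c' s \<noteq> 0"
  \<comment> \<open>A simplex belonging to two edges at \<open>i\<close> would have its points over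
    a triple intersection, so one arbitrary point of the standard simplex gives the
    contradiction.\<close>
  obtain t :: "nat \<Rightarrow> real" where t: "t \<in> standard_simplex p"
    using nonempty_standard_simplex by blast
  obtain j where j: "i \<in> I" "j \<in> I" "i \<noteq> j" "e = {i, j}"
    using assms(1,3) by (rule edgesE)
  obtain k where k: "i \<in> I" "k \<in> I" "i \<noteq> k" "e' = {i, k}"
    using assms(2,4) by (rule edgesE)
  have "f (s t) \<in> UU e" "f (s t) \<in> UU e'"
    using kchain_preimage_lookup assms(6-8) t \<open>Poly_Mapping.lookup c' s \<noteq> 0\<close> by metis+
  then have "f (s t) \<in> U i \<inter> U j \<inter> U k"
    using j k by auto
  moreover have "j \<noteq> k"
    using assms(5) j k by auto
  ultimately show False
    using one_dim j k by blast
qed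

text \<open>Distinct edges at \<open>i\<close> carry disjoint sets of simplices, so their chains
  cannot cancel in \<open>\<delta> \<eta> i\<close>: one vertex detects every edge that contains
  it.\<close>

lemma delta_injective:
  fixes \<eta> :: "'i set \<Rightarrow> ('x, 'k::field) kchain"
  assumes "\<And>e. e \<in> edges \<Longrightarrow> kchain p (P (UU e)) (\<eta> e)" "\<delta> \<eta> i = 0" "e \<in> edges" "i \<in> e"
  shows "\<eta> e = 0"
proof (rule ccontr)
  assume "\<eta> e \<noteq> 0"
  then obtain s where s: "Poly_Mapping.lookup (\<eta> e) s \<noteq> 0"
    by (metis lookup_zero poly_mapping_eqI)
  have "Poly_Mapping.lookup (\<eta> e') s = 0" if "e' \<in> edges" "i \<in> e'" "e' \<noteq> e" for e'
    using edge_simplex_unique[OF assms(3) that(1) assms(4) that(2)] assms(1) assms(3) that s by metis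
  then have "Poly_Mapping.lookup (\<delta> \<eta> i) s = (\<Sum>e'\<in>{e}. incidence r {i} e' * Poly_Mapping.lookup (\<eta> e') s)"
    unfolding edge_sum_def lookup_sum lookup_chain_scale
    by (intro sum.mono_neutral_right) (use assms finite_edges in auto)
  moreover have "(incidence r {i} e :: 'k) \<noteq> 0"
    using incidence_square[of "{i}" e, where 'k='k] by force
  ultimately show False
    using assms(2) s by simp
qed

text \<open>A simplex occurring in \<open>w i\<close> must be cancelled at another vertex. As no
  three sets meet, there is just one such \<open>j\<close>; it has the opposite coefficient, and the
  simplex lies over \<open>U i \<inter> U j\<close>. The chain on that edge collects these
  simplices. It can be nonzero on any edge with both ends in \<open>J\<close>, which is why full
  subcomplexes are needed later.\<close>

lemma delta_exact:
  fixes w :: "'i \<Rightarrow> ('x, 'k::field) kchain"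
  assumes J: "J \<subseteq> I" and w: "\<And>i. i \<in> J \<Longrightarrow> kchain p (P (U i)) (w i)" and 0: "(\<Sum>i\<in>J. w i) = 0"
  obtains g where "\<And>e. e \<in> edges \<Longrightarrow> kchain p (P (UU e)) (g e)" "\<And>e. \<not> (e \<in> edges \<and> e \<subseteq> J) \<Longrightarrow> g e = 0"
    "\<And>i. i \<in> J \<Longrightarrow> w i = \<delta> g i"
proof -
  define S where "S e = singular_simplex_set p (P (UU e))" for e
  \<comment> \<open>An arbitrary end of \<open>e\<close> is used. Passing to the other end changes
    both the sign and the restricted chain by -1 (\<open>antisym\<close>), so the choice is
    immaterial; and a sign is its own inverse.\<close>
  define g where "g e = (if e \<in> edges \<and> e \<subseteq> J
      then let i = (SOME i. i \<in> e) in chain_scale (incidence r {i} e) (chain_restrict (S e) (w i)) else 0)" for e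
  obtain t :: "nat \<Rightarrow> real" where t: "t \<in> standard_simplex p"
    using nonempty_standard_simplex by blast
  have finJ: "finite J"
    using J finite_I finite_subset by blast
  have in_U: "f (s t) \<in> U i" if "i \<in> J" "Poly_Mapping.lookup (w i) s \<noteq> 0" "t \<in> standard_simplex p" for i s t
    using kchain_preimage_lookup[OF w[OF that(1)] that(2,3)] .
  have antisym: "chain_restrict (S {i, j}) (w j) = - chain_restrict (S {i, j}) (w i)"
    if "i \<in> J" "j \<in> J" "i \<noteq> j" for i j
  proof (rule poly_mapping_eqI)
    fix s
    show "Poly_Mapping.lookup (chain_restrict (S {i, j}) (w j)) s = Poly_Mapping.lookup (- chain_restrict (S {i, j}) (w i)) s"
    proof (cases "s \<in> S {i, j}")
      case True
      then have ft: "f (s t) \<in> U i" "f (s t) \<in> U j"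
        using t by (auto simp: S_def singular_simplex_preimage)
      have "Poly_Mapping.lookup (w k) s = 0" if "k \<in> J" "k \<noteq> i" "k \<noteq> j" for k
        using in_U[OF that(1) _ t, of s] ft one_dim[of i j k] that \<open>i \<in> J\<close> \<open>j \<in> J\<close> \<open>i \<noteq> j\<close> J by auto
      then have "(\<Sum>k\<in>J. Poly_Mapping.lookup (w k) s) = (\<Sum>k\<in>{i, j}. Poly_Mapping.lookup (w k) s)"
        by (intro sum.mono_neutral_right) (use finJ that in auto)
      moreover have "(\<Sum>k\<in>J. Poly_Mapping.lookup (w k) s) = 0"
        using arg_cong[OF 0, of "\<lambda>c. Poly_Mapping.lookup c s"] by (simp add: lookup_sum)
      ultimately show ?thesis
        using that by (simp add: lookup_chain_restrict eq_neg_iff_add_eq_0 add.commute)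
    qed (simp add: lookup_chain_restrict)
  qed
  have g_eq: "g e = chain_scale (incidence r {i} e) (chain_restrict (S e) (w i))"
    if e: "e \<in> edges" "e \<subseteq> J" "i \<in> e" for e i
  proof -
    define k where "k = (SOME i. i \<in> e)"
    have "k \<in> e"
      unfolding k_def using e(3) by (rule someI)
    obtain j where j: "i \<in> I" "j \<in> I" "i \<noteq> j" "e = {i, j}"
      using e(1,3) by (rule edgesE)
    have "chain_scale (incidence r {k} e) (chain_restrict (S e) (w k))
        = chain_scale (incidence r {i} e) (chain_restrict (S e) (w i))"
    proof (cases "k = i")
      case False
      then have "k = j" using \<open>k \<in> e\<close> j by auto
      then show ?thesis
        using antisym[of i j] incidence_opposite[of i j, where 'k='k] j e(2) by simp
    qed simp
    then show ?thesis
      using e by (simp add: g_def k_def[symmetric])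
  qed
  have g_chain: "kchain p (P (UU e)) (g e)" for e
    by (auto simp: g_def Let_def keys_chain_restrict S_def dest!: keys_chain_scale_subset[THEN subsetD])
  have g_0: "g e = 0" if "\<not> (e \<in> edges \<and> e \<subseteq> J)" for e
    unfolding g_def using that by (rule if_not_P)
  have w_eq: "w i = \<delta> g i" if i: "i \<in> J" for i
  proof (rule poly_mapping_eqI)
    fix s
    let ?E = "{e \<in> edges. i \<in> e}"
    have lookup_g: "incidence r {i} e * Poly_Mapping.lookup (g e) s
        = (if e \<subseteq> J \<and> s \<in> S e then Poly_Mapping.lookup (w i) s else 0)" if "e \<in> ?E" for e
    proof (cases "e \<subseteq> J")
      case True
      with that g_eq[of e i] incidence_square[of "{i}" e, where 'k='k] show ?thesis
        by (simp add: lookup_chain_restrict mult.assoc[symmetric])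
    qed (simp add: g_0)
    have sum_eq: "Poly_Mapping.lookup (\<delta> g i) s
        = (\<Sum>e\<in>?E. if e \<subseteq> J \<and> s \<in> S e then Poly_Mapping.lookup (w i) s else 0)"
      unfolding edge_sum_def lookup_sum lookup_chain_scale using lookup_g by (intro sum.cong) simp_all
    show "Poly_Mapping.lookup (w i) s = Poly_Mapping.lookup (\<delta> g i) s"
    proof (cases "Poly_Mapping.lookup (w i) s = 0")
      case True
      then show ?thesis
        unfolding sum_eq by (simp cong: if_cong)
    next
      case False
      have "(\<Sum>k\<in>J. Poly_Mapping.lookup (w k) s) = 0"
        using arg_cong[OF 0, of "\<lambda>c. Poly_Mapping.lookup c s"] by (simp add: lookup_sum)
      then obtain j where j: "j \<in> J" "j \<noteq> i" "Poly_Mapping.lookup (w j) s \<noteq> 0"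
        using sum.remove[OF finJ i, of "\<lambda>k. Poly_Mapping.lookup (w k) s"] False
        by (metis (no_types, lifting) DiffE add.right_neutral insertI1 sum.neutral)
      have "singular_simplex p X s"
        using w[OF i] False by (auto simp: in_keys_iff singular_simplex_preimage subset_iff)
      then have sS: "s \<in> S {i, j}"
        using in_U[OF i False] in_U[OF j(1,3)] by (simp add: S_def singular_simplex_preimage)
      have e: "{i, j} \<in> edges"
        using in_U[OF i False t] in_U[OF j(1,3) t] i j J by (intro edgesI) auto
      have "e = {i, j}" if e1: "e \<in> ?E" and e2: "e \<subseteq> J \<and> s \<in> S e" for e
      proof -
        obtain k where k: "i \<in> I" "k \<in> I" "i \<noteq> k" "e = {i, k}"
          using edgesE[of e i] e1 by blast
        have "f (s t) \<in> U i \<inter> U j \<inter> U k"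
          using e2 k in_U[OF i False t] in_U[OF j(1,3) t] t by (auto simp: S_def singular_simplex_preimage)
        then show ?thesis
          using one_dim[of i j k] k j J by auto
      qed
      then have "Poly_Mapping.lookup (\<delta> g i) s
        = (\<Sum>e\<in>{{i, j}}. if e \<subseteq> J \<and> s \<in> S e then Poly_Mapping.lookup (w i) s else 0)"
        unfolding sum_eq by (intro sum.mono_neutral_right) (use e finite_edges in auto)
      then show ?thesis
        using i j sS by simp
    qed
  qed
  show ?thesis
    by (rule that[OF g_chain g_0 w_eq])
qed

end

lemma normaliser_0: "normaliser m X 0 = 0"
  by (rule klinear_0[OF klinear_normaliser])

subsection \<open>The comparison map on chains\<close>

context nerve_cover
begin

definition subcomplex :: "'i set set \<Rightarrow> bool" where
  "subcomplex K \<longleftrightarrow> K \<subseteq> nerve I U \<and> (\<forall>\<sigma>\<in>K. \<forall>\<tau>\<subseteq>\<sigma>. \<tau> \<noteq> {} \<longrightarrow> \<tau> \<in> K)"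

text \<open>Fullness is tested on edges, the top-dimensional simplices here.\<close>

definition full_subcomplex :: "'i set set \<Rightarrow> bool" where
  "full_subcomplex K \<longleftrightarrow> subcomplex K \<and> (\<forall>e\<in>edges. (\<forall>i\<in>e. {i} \<in> K) \<longrightarrow> e \<in> K)"

definition vertices :: "'i set set \<Rightarrow> 'i set" where
  "vertices K = {i. {i} \<in> K}"

abbreviation covered :: "'i set set \<Rightarrow> 'y set" where
  "covered K \<equiv> (\<Union>i\<in>vertices K. U i)"

text \<open>Cellular chains of \<open>K\<close>, lifted from homology classes to singular cycles.\<close>

definition lifts :: "nat \<Rightarrow> 'i set set \<Rightarrow> nat \<Rightarrow> ('i set \<Rightarrow> ('x, 'k::field) kchain) set" where
  "lifts n K p = {\<xi>. (\<forall>\<sigma>. \<xi> \<sigma> \<in> sing_cycles n (P (UU \<sigma>))) \<and> (\<forall>\<sigma>. \<sigma> \<notin> simplices_of_dim K p \<longrightarrow> \<xi> \<sigma> = 0)}"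

text \<open>In total degree \<open>n\<close> the edges carry cycles of degree \<open>n - 1\<close>;
  degree 0 belongs to the cosheaf of index -1, which is zero. The condition ranges over all
  \<open>i\<close>: away from the vertices of a subcomplex \<open>K\<close> it holds because
  \<open>\<delta> \<eta> i = 0\<close> there.\<close>

definition lifted_cycles :: "nat \<Rightarrow> 'i set set \<Rightarrow> ('i set \<Rightarrow> ('x, 'k::field) kchain) set" where
  "lifted_cycles n K = (case n of 0 \<Rightarrow> {\<lambda>_. 0}
     | Suc m \<Rightarrow> {\<eta>\<in>lifts m K 1. \<forall>i. \<delta> \<eta> i \<in> sing_boundaries m (P (U i))})"

text \<open>Normalising before filling makes the result depend only on the homology classes of the
  \<open>\<eta> e\<close>. Otherwise two representatives of the same class could receive fillings
  that differ by cycles of nonzero class, and gluing would not descend to homology.\<close>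

definition correction :: "nat \<Rightarrow> ('i set \<Rightarrow> ('x, 'k::field) kchain) \<Rightarrow> 'i \<Rightarrow> ('x, 'k) kchain" where
  "correction n \<eta> i = (case n of 0 \<Rightarrow> 0
     | Suc m \<Rightarrow> primitive m (P (U i)) (\<delta> (\<lambda>e. normaliser m (P (UU e)) (\<eta> e)) i))"

text \<open>For \<open>n > 0\<close> the chains \<open>normaliser (\<eta> e)\<close> sum up to boundaries at each vertex; filling these inside
  the sets \<open>U i\<close> and adding up gives a cycle. All choices are linear and local, so that the result does
  not depend on a subcomplex.\<close>

definition glue :: "nat \<Rightarrow> ('i set \<Rightarrow> ('x, 'k::field) kchain) \<Rightarrow> ('i set \<Rightarrow> ('x, 'k) kchain) \<Rightarrow> ('x, 'k) kchain" where
  "glue n \<xi> \<eta> = (\<Sum>i\<in>I. \<xi> {i} + correction n \<eta> i)"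

lemma simplices_of_dim_0: "\<sigma> \<in> simplices_of_dim K 0 \<longleftrightarrow> (\<exists>i\<in>vertices K. \<sigma> = {i})"
  by (auto simp: simplices_of_dim_def vertices_def card_1_singleton_iff)

lemma subcomplex_vertices: "subcomplex K \<Longrightarrow> vertices K \<subseteq> I"
  by (auto simp: subcomplex_def vertices_def nerve_def)

lemma subcomplex_edge:
  assumes "subcomplex K" "e \<in> simplices_of_dim K 1"
  shows "e \<in> edges" "e \<subseteq> vertices K"
  using assms by (auto simp: subcomplex_def edges_def simplices_of_dim_def vertices_def)

lemma full_subcomplex_edge: "full_subcomplex K \<Longrightarrow> e \<in> edges \<Longrightarrow> e \<subseteq> vertices K \<Longrightarrow> e \<in> simplices_of_dim K 1"
  by (auto simp: full_subcomplex_def simplices_of_dim_def vertices_def edges_def subset_iff)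

lemma lifts_cycle: "\<xi> \<in> lifts n K p \<Longrightarrow> \<xi> \<sigma> \<in> sing_cycles n (P (UU \<sigma>))"
  and lifts_outside: "\<xi> \<in> lifts n K p \<Longrightarrow> \<sigma> \<notin> simplices_of_dim K p \<Longrightarrow> \<xi> \<sigma> = 0"
  by (auto simp: lifts_def)

lemma lifts_vertex_cycle: "\<xi> \<in> lifts n K 0 \<Longrightarrow> \<xi> {i} \<in> sing_cycles n (P (U i))"
  using lifts_cycle[of \<xi> n K 0 "{i}"] by simp

lemma lifts_vertex_outside: "\<xi> \<in> lifts n K 0 \<Longrightarrow> i \<notin> vertices K \<Longrightarrow> \<xi> {i} = 0"
  by (auto simp: simplices_of_dim_0 intro: lifts_outside)

lemma lifts_mono:
  assumes "K \<subseteq> K'" shows "lifts n K p \<subseteq> lifts n K' p"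
  using assms by (auto simp: lifts_def simplices_of_dim_def)

lemma lifted_cycles_mono:
  assumes "K \<subseteq> K'" shows "lifted_cycles n K \<subseteq> lifted_cycles n K'"
  using lifts_mono[OF assms] by (auto simp: lifted_cycles_def split: nat.splits)

lemma zero_lifts: "(\<lambda>_. 0) \<in> lifts n K p"
  by (simp add: lifts_def sing_cycles_0)

lemma lifts_add: "\<xi> \<in> lifts n K p \<Longrightarrow> \<xi>' \<in> lifts n K p \<Longrightarrow> (\<lambda>\<sigma>. \<xi> \<sigma> + \<xi>' \<sigma>) \<in> lifts n K p"
  and lifts_diff: "\<xi> \<in> lifts n K p \<Longrightarrow> \<xi>' \<in> lifts n K p \<Longrightarrow> (\<lambda>\<sigma>. \<xi> \<sigma> - \<xi>' \<sigma>) \<in> lifts n K p"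
  and lifts_scale: "\<xi> \<in> lifts n K p \<Longrightarrow> (\<lambda>\<sigma>. chain_scale a (\<xi> \<sigma>)) \<in> lifts n K p"
  by (auto simp: lifts_def sing_cycles_add sing_cycles_diff sing_cycles_scale)

lemma delta_scale: "\<delta> (\<lambda>e. chain_scale a (\<eta> e)) i = chain_scale a (\<delta> \<eta> i)"
  by (simp add: edge_sum_def kch.scale_sum_right mult.commute)

lemma lifted_cycles_add:
    "\<eta> \<in> lifted_cycles n K \<Longrightarrow> \<eta>' \<in> lifted_cycles n K \<Longrightarrow> (\<lambda>\<sigma>. \<eta> \<sigma> + \<eta>' \<sigma>) \<in> lifted_cycles n K"
  and lifted_cycles_diff:
    "\<eta> \<in> lifted_cycles n K \<Longrightarrow> \<eta>' \<in> lifted_cycles n K \<Longrightarrow> (\<lambda>\<sigma>. \<eta> \<sigma> - \<eta>' \<sigma>) \<in> lifted_cycles n K"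
  and lifted_cycles_scale:
    "\<eta> \<in> lifted_cycles n K \<Longrightarrow> (\<lambda>\<sigma>. chain_scale a (\<eta> \<sigma>)) \<in> lifted_cycles n K"
  by (auto simp: lifted_cycles_def lifts_add lifts_diff lifts_scale delta_add delta_diff delta_scale
      sing_boundaries_add sing_boundaries_diff sing_boundaries_scale split: nat.splits)

lemma correction_add: "correction n (\<lambda>\<sigma>. \<eta> \<sigma> + \<eta>' \<sigma>) i = correction n \<eta> i + correction n \<eta>' i"
  and correction_diff: "correction n (\<lambda>\<sigma>. \<eta> \<sigma> - \<eta>' \<sigma>) i = correction n \<eta> i - correction n \<eta>' i"
  and correction_scale: "correction n (\<lambda>\<sigma>. chain_scale a (\<eta> \<sigma>)) i = chain_scale a (correction n \<eta> i)"
  by (simp_all add: correction_def klinear_add[OF klinear_normaliser] klinear_diff[OF klinear_normaliser]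
      klinear_scale[OF klinear_normaliser] klinear_add[OF klinear_primitive] klinear_diff[OF klinear_primitive]
      klinear_scale[OF klinear_primitive] delta_add delta_diff delta_scale split: nat.split)

lemma glue_add: "glue n (\<lambda>\<sigma>. \<xi> \<sigma> + \<xi>' \<sigma>) (\<lambda>\<sigma>. \<eta> \<sigma> + \<eta>' \<sigma>) = glue n \<xi> \<eta> + glue n \<xi>' \<eta>'"
  and glue_diff: "glue n (\<lambda>\<sigma>. \<xi> \<sigma> - \<xi>' \<sigma>) (\<lambda>\<sigma>. \<eta> \<sigma> - \<eta>' \<sigma>) = glue n \<xi> \<eta> - glue n \<xi>' \<eta>'"
  and glue_scale: "glue n (\<lambda>\<sigma>. chain_scale a (\<xi> \<sigma>)) (\<lambda>\<sigma>. chain_scale a (\<eta> \<sigma>)) = chain_scale a (glue n \<xi> \<eta>)"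
  by (simp_all add: glue_def correction_add correction_diff correction_scale sum.distrib sum_subtractf
      kch.scale_sum_right kch.scale_right_distrib)

text \<open>Normalising moves an edge chain by a boundary over the intersection of two sets, and
  this stays a boundary over each of them.\<close>

lemma delta_normaliser:
  assumes "\<delta> \<eta> i \<in> sing_boundaries m (P (U i))"
  shows "\<delta> (\<lambda>e. normaliser m (P (UU e)) (\<eta> e)) i \<in> sing_boundaries m (P (U i))"
proof -
  have "\<delta> (\<lambda>e. normaliser m (P (UU e)) (\<eta> e) - \<eta> e) i \<in> sing_boundaries m (P (U i))"
    by (rule delta_boundaries) (rule normaliser_diff)
  from sing_boundaries_add[OF this assms] show ?thesis
    by (simp add: delta_diff)
qed

lemma sing_boundary_correction:
  assumes "\<eta> \<in> lifted_cycles (Suc m) K"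
  shows "sing_boundary (Suc m) (correction (Suc m) \<eta> i) = \<delta> (\<lambda>e. normaliser m (P (UU e)) (\<eta> e)) i"
  using assms by (simp add: correction_def lifted_cycles_def sing_boundary_primitive delta_normaliser)

lemma kchain_correction: "kchain n (P (U i)) (correction n \<eta> i)"
  by (cases n) (simp_all add: correction_def kchain_primitive)

lemma correction_outside:
  assumes "subcomplex K" "\<eta> \<in> lifted_cycles n K" "i \<notin> vertices K"
  shows "correction n \<eta> i = 0"
proof (cases n)
  case (Suc m)
  then have \<eta>: "\<eta> \<in> lifts m K 1"
    using assms(2) by (simp add: lifted_cycles_def)
  have "\<eta> e = 0" if "i \<in> e" for e
    using lifts_outside[OF \<eta>, of e] subcomplex_edge(2)[OF assms(1), of e] that assms(3) by auto
  then have "\<delta> (\<lambda>e. normaliser m (P (UU e)) (\<eta> e)) i = 0"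
    by (intro delta_0) (simp add: normaliser_0)
  then show ?thesis
    by (simp add: correction_def Suc klinear_0[OF klinear_primitive])
qed (simp add: correction_def)

lemma kchain_covered: "kchain p (P (U i)) c \<Longrightarrow> i \<in> vertices K \<Longrightarrow> kchain p (P (covered K)) c"
  by (erule kchain_preimage_mono) blast

lemma boundaries_covered:
  "c \<in> sing_boundaries p (P (U i)) \<Longrightarrow> i \<in> vertices K \<Longrightarrow> c \<in> sing_boundaries p (P (covered K))"
  by (erule sing_boundaries_preimage_mono) blast

lemma glue_eq:
  assumes "subcomplex K" "\<xi> \<in> lifts n K 0" "\<eta> \<in> lifted_cycles n K"
  shows "glue n \<xi> \<eta> = (\<Sum>i\<in>vertices K. \<xi> {i} + correction n \<eta> i)"
  unfolding glue_def
  by (rule sum.mono_neutral_right)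
    (use assms in \<open>auto simp: finite_I lifts_vertex_outside correction_outside dest: subcomplex_vertices\<close>)

text \<open>The vertex cycles contribute nothing to the boundary, and the corrections contribute
  \<open>\<delta>\<close> of the normalised edge cycles, which cancels by
  \<open>sum_delta\<close>.\<close>

lemma glue_cycle:
  assumes K: "subcomplex K" and \<xi>: "\<xi> \<in> lifts n K 0" and \<eta>: "\<eta> \<in> lifted_cycles n K"
  shows "glue n \<xi> \<eta> \<in> sing_cycles n (P (covered K))"
proof -
  have "kchain n (P (covered K)) (glue n \<xi> \<eta>)"
    unfolding glue_eq[OF assms]
  proof (rule kchain_sum)
    fix i assume "i \<in> vertices K"
    with kchain_add[OF sing_cycles_kchain[OF lifts_vertex_cycle[OF \<xi>]] kchain_correction]
    show "kchain n (P (covered K)) (\<xi> {i} + correction n \<eta> i)"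
      by (rule kchain_covered)
  qed
  moreover have "sing_boundary n (glue n \<xi> \<eta>) = 0"
  proof (cases n)
    case 0
    then show ?thesis by (simp add: sing_boundary_def)
  next
    case (Suc m)
    have "sing_boundary n (\<xi> {i}) = 0" for i
      using lifts_vertex_cycle[OF \<xi>, of i] by (simp add: sing_cycles_iff)
    then have "sing_boundary n (glue n \<xi> \<eta>) = (\<Sum>i\<in>I. \<delta> (\<lambda>e. normaliser m (P (UU e)) (\<eta> e)) i)"
      using \<eta> sing_boundary_correction[of \<eta> m K] unfolding Suc
      by (simp add: glue_def klinear_sum[OF klinear_sing_boundary] klinear_add[OF klinear_sing_boundary])
    then show ?thesis
      by (simp add: sum_delta)
  qed
  ultimately show ?thesis
    by (simp add: sing_cycles_iff)
qed

text \<open>These are the lifts of zero classes in first cellular homology: without triangles there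
  are no boundaries to divide by, so each edge must carry a zero class itself.\<close>

definition null_lift :: "nat \<Rightarrow> ('i set \<Rightarrow> ('x, 'k::field) kchain) \<Rightarrow> bool" where
  "null_lift n \<eta> \<longleftrightarrow> (case n of 0 \<Rightarrow> True | Suc m \<Rightarrow> (\<forall>e. \<eta> e \<in> sing_boundaries m (P (UU e))))"

lemma correction_null: "null_lift n \<eta> \<Longrightarrow> correction n \<eta> i = 0"
  by (auto simp: null_lift_def correction_def normaliser_boundary klinear_0[OF klinear_primitive] delta_0
      split: nat.splits)

text \<open>This makes gluing well defined on homology. A null \<open>\<eta>\<close> has no
  correction, and subtracting \<open>\<delta> \<theta> i\<close> at every vertex keeps the total
  while turning each summand into a boundary inside one \<open>U i\<close>.\<close>

lemma glue_null:
  assumes K: "subcomplex K" and \<xi>: "\<xi> \<in> lifts n K 0" and \<eta>: "null_lift n \<eta>"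
    and \<theta>: "\<theta> \<in> lifts n K 1" and eq: "\<And>i. i \<in> vertices K \<Longrightarrow> \<xi> {i} - \<delta> \<theta> i \<in> sing_boundaries n (P (U i))"
  shows "glue n \<xi> \<eta> \<in> sing_boundaries n (P (covered K))"
proof -
  have "glue n \<xi> \<eta> = (\<Sum>i\<in>I. \<xi> {i})"
    by (simp add: glue_def correction_null[OF \<eta>])
  also have "\<dots> = (\<Sum>i\<in>I. \<xi> {i} - \<delta> \<theta> i)"
    by (simp add: sum_subtractf sum_delta)
  also have "\<dots> = (\<Sum>i\<in>vertices K. \<xi> {i} - \<delta> \<theta> i)"
  proof (rule sum.mono_neutral_right)
    show "\<forall>i\<in>I - vertices K. \<xi> {i} - \<delta> \<theta> i = 0"
    proof
      fix i assume i: "i \<in> I - vertices K"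
      have "\<delta> \<theta> i = 0"
        using i subcomplex_edge(2)[OF K] lifts_outside[OF \<theta>] by (intro delta_0) blast
      then show "\<xi> {i} - \<delta> \<theta> i = 0"
        using i lifts_vertex_outside[OF \<xi>] by simp
    qed
  qed (simp_all add: finite_I subcomplex_vertices[OF K])
  also have "\<dots> \<in> sing_boundaries n (P (covered K))"
    by (rule sing_boundaries_sum, rule boundaries_covered[OF eq])
  finally show ?thesis .
qed

section \<open>Bijectivity of gluing on homology for full subcomplexes\<close>

lemma small_chain_covered:
  assumes K: "subcomplex K" and c: "kchain p (P (covered K)) c"
  obtains N w where "ksubdiv p N c = (\<Sum>i\<in>vertices K. w i)" "\<And>i. i \<in> vertices K \<Longrightarrow> kchain p (P (U i)) (w i)"
proof -
  let ?W = "\<lambda>i. {x \<in> topspace X. f x \<in> U i}"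
  have sub: "subtopology (P (covered K)) (?W i) = P (U i)" if "i \<in> vertices K" for i
    using that unfolding preimage_def subtopology_subtopology by (intro arg_cong[of _ _ "subtopology X"]) auto
  have op: "openin (P (covered K)) (?W i)" if "i \<in> vertices K" for i
    unfolding preimage_def openin_subtopology
    using that open_U[of i] subcomplex_vertices[OF K] by (intro exI[of _ "?W i"]) auto
  have cov: "topspace (P (covered K)) \<subseteq> (\<Union>i\<in>vertices K. ?W i)"
    by (auto simp: preimage_def)
  have fin: "finite (vertices K)"
    using subcomplex_vertices[OF K] finite_I finite_subset by blast
  show ?thesis
  proof (rule small_ksubdiv_exists[OF fin op cov c])
    fix N w
    assume eq: "ksubdiv p N c = (\<Sum>i\<in>vertices K. w i)"
      and w: "\<And>i. i \<in> vertices K \<Longrightarrow> kchain p (subtopology (P (covered K)) (?W i)) (w i)"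
    have "kchain p (P (U i)) (w i)" if "i \<in> vertices K" for i
      using w[OF that] unfolding sub[OF that] .
    with eq show ?thesis
      by (rule that)
  qed
qed

text \<open>A filling \<open>c\<close> of the glued cycle is subdivided and split into
  \<open>w i\<close>. The defects \<open>v i\<close> add up to zero, hence have the form
  \<open>\<delta> g i\<close>. Comparing boundaries, \<open>g e\<close> fills the subdivided
  normalised edge cycle, so \<open>\<eta>\<close> is null; then the \<open>g e\<close> are cycles
  and exhibit \<open>\<xi>\<close> as a cellular boundary modulo singular boundaries.\<close>

lemma glue_injective:
  fixes \<xi> \<eta> :: "'i set \<Rightarrow> ('x, 'k::field) kchain"
  assumes full: "full_subcomplex K" and \<xi>: "\<xi> \<in> lifts n K 0" and \<eta>: "\<eta> \<in> lifted_cycles n K"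
    and bd: "glue n \<xi> \<eta> \<in> sing_boundaries n (P (covered K))"
  shows "null_lift n \<eta> \<and> (\<exists>\<theta>\<in>lifts n K 1. \<forall>i\<in>vertices K. \<xi> {i} - \<delta> \<theta> i \<in> sing_boundaries n (P (U i)))"
proof -
  have K: "subcomplex K"
    using full by (simp add: full_subcomplex_def)
  let ?V = "vertices K" and ?\<beta> = "correction n \<eta>"
  obtain c where c: "kchain (Suc n) (P (covered K)) c" "glue n \<xi> \<eta> = sing_boundary (Suc n) c"
    using bd by (auto simp: sing_boundaries_iff)
  obtain N w where w: "ksubdiv (Suc n) N c = (\<Sum>i\<in>?V. w i)" "\<And>i. i \<in> ?V \<Longrightarrow> kchain (Suc n) (P (U i)) (w i)"
    using small_chain_covered[OF K c(1)] by metis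
  \<comment> \<open>This measures how far \<open>w i\<close> is from filling the subdivided
    contribution of vertex \<open>i\<close>; so far only the sum over all vertices is known to
    vanish.\<close>
  define v where "v i = ksubdiv n N (\<xi> {i} + ?\<beta> i) - sing_boundary (Suc n) (w i)" for i
  have "(\<Sum>i\<in>?V. v i) = ksubdiv n N (glue n \<xi> \<eta>) - sing_boundary (Suc n) (\<Sum>i\<in>?V. w i)"
    by (simp add: v_def sum_subtractf glue_eq[OF K \<xi> \<eta>] klinear_sum[OF klinear_ksubdiv]
        klinear_sum[OF klinear_sing_boundary])
  also have "\<dots> = 0"
    using sing_boundary_ksubdiv[OF c(1), of N] by (simp add: c(2) w(1)[symmetric])
  finally have v0: "(\<Sum>i\<in>?V. v i) = 0" .
  have \<xi>c: "kchain n (P (U i)) (\<xi> {i})" for i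
    using lifts_vertex_cycle[OF \<xi>] by (rule sing_cycles_kchain)
  have vc: "kchain n (P (U i)) (v i)" if "i \<in> ?V" for i
    unfolding v_def
    by (intro kchain_diff kchain_ksubdiv kchain_add \<xi>c kchain_correction kchain_sing_boundary w(2) that)
  obtain g where g: "\<And>e. e \<in> edges \<Longrightarrow> kchain n (P (UU e)) (g e)"
    "\<And>e. \<not> (e \<in> edges \<and> e \<subseteq> ?V) \<Longrightarrow> g e = 0" "\<And>i. i \<in> ?V \<Longrightarrow> v i = \<delta> g i"
    using delta_exact[OF subcomplex_vertices[OF K] vc v0] by metis
  have gc: "kchain n (P (UU e)) (g e)" for e
    using g(1,2)[of e] by (cases "e \<in> edges") (auto simp: kchain_0)
  have main: "null_lift n \<eta> \<and> (\<forall>e. sing_boundary n (g e) = 0)"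
  proof (cases n)
    case 0
    then show ?thesis by (simp add: null_lift_def sing_boundary_def)
  next
    case (Suc m)
    define \<rho> where "\<rho> e = normaliser m (P (UU e)) (\<eta> e)" for e
    have \<eta>1: "\<eta> \<in> lifts m K 1"
      using \<eta> by (simp add: Suc lifted_cycles_def)
    have \<rho>Z: "\<rho> e \<in> sing_cycles m (P (UU e))" for e
      unfolding \<rho>_def by (intro normaliser_cycle lifts_cycle[OF \<eta>1])
    have \<xi>0: "sing_boundary n (\<xi> {i}) = 0" for i
      using lifts_vertex_cycle[OF \<xi>, of i] by (simp add: sing_cycles_iff)
    \<comment> \<open>Taking boundaries in \<open>v i = \<delta> g i\<close> removes
      \<open>\<xi>\<close> and \<open>w\<close>, and subdivision commutes with the boundary. By
      \<open>delta_injective\<close> the result becomes an equation on every single edge.\<close>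
    have delta0: "\<delta> (\<lambda>e. ksubdiv m N (\<rho> e) - sing_boundary n (g e)) i = 0" if i: "i \<in> ?V" for i
    proof -
      have "sing_boundary n (v i) = ksubdiv m N (sing_boundary n (\<xi> {i} + ?\<beta> i))
          - sing_boundary n (sing_boundary (Suc n) (w i))"
        using sing_boundary_ksubdiv[of "\<xi> {i} + ?\<beta> i" m "P (U i)" N] kchain_add[OF \<xi>c[of i] kchain_correction[where i=i and n=n and \<eta>=\<eta>]]
        by (simp add: v_def klinear_diff[OF klinear_sing_boundary] Suc)
      also have "\<dots> = ksubdiv m N (\<delta> \<rho> i)"
        using sing_boundary_boundary[OF w(2)[OF i]] sing_boundary_correction[of \<eta> m K i] \<eta> \<xi>0[of i]
        by (simp add: klinear_add[OF klinear_sing_boundary] Suc \<rho>_def[abs_def])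
      finally have "\<delta> (\<lambda>e. ksubdiv m N (\<rho> e)) i = \<delta> (\<lambda>e. sing_boundary n (g e)) i"
        using g(3)[OF i] by (simp add: delta_linear[OF klinear_ksubdiv] delta_linear[OF klinear_sing_boundary])
      then show ?thesis
        by (simp add: delta_diff)
    qed
    have kc: "kchain m (P (UU e)) (ksubdiv m N (\<rho> e) - sing_boundary n (g e))" for e
      using gc[of e] unfolding Suc
      by (intro kchain_diff kchain_ksubdiv sing_cycles_kchain[OF \<rho>Z] kchain_sing_boundary)
    have null: "\<eta> e \<in> sing_boundaries m (P (UU e))" for e
    proof (cases "e \<in> edges \<and> e \<subseteq> ?V")
      case True
      then obtain i where i: "i \<in> e" "i \<in> ?V" using edges_nonempty by blast
      have "ksubdiv m N (\<rho> e) - sing_boundary n (g e) = 0"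
        using delta_injective[OF kc delta0[OF i(2)], of e] True i by simp
      then have "ksubdiv m N (\<rho> e) \<in> sing_boundaries m (P (UU e))"
        using gc[of e] by (auto simp: sing_boundaries_iff Suc)
      then have "\<rho> e \<in> sing_boundaries m (P (UU e))"
        using \<rho>Z ksubdiv_boundary_iff by blast
      then show ?thesis
        by (simp add: \<rho>_def normaliser_boundary_iff)
    next
      case False
      then have "\<eta> e = 0"
        using subcomplex_edge[OF K, of e] lifts_outside[OF \<eta>1, of e] by blast
      then show ?thesis by (simp add: sing_boundaries_0)
    qed
    \<comment> \<open>The normaliser sends boundaries to 0, not merely to boundaries, so the edge
      equation now makes \<open>g e\<close> a cycle.\<close>
    then have "\<rho> e = 0" for e
      by (simp add: \<rho>_def normaliser_boundary)
    then have "sing_boundary n (g e) = 0" if "e \<in> edges" "e \<subseteq> ?V" for e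
    proof -
      obtain i where i: "i \<in> e" "i \<in> ?V" using edges_nonempty \<open>e \<in> edges\<close> \<open>e \<subseteq> ?V\<close> by blast
      have "ksubdiv m N (\<rho> e) - sing_boundary n (g e) = 0"
        using delta_injective[OF kc delta0[OF i(2)], of e] that i by simp
      then show ?thesis
        using \<open>\<And>e. \<rho> e = 0\<close> by (simp add: klinear_0[OF klinear_ksubdiv])
    qed
    then have "sing_boundary n (g e) = 0" for e
      using g(2)[of e] klinear_0[OF klinear_sing_boundary] by metis
    with null show ?thesis
      by (simp add: null_lift_def Suc)
  qed
  have gl: "g \<in> lifts n K 1"
    unfolding lifts_def
  proof (intro CollectI conjI allI impI)
    show "g \<sigma> \<in> sing_cycles n (P (UU \<sigma>))" for \<sigma>
      using main gc by (simp add: sing_cycles_iff)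
    \<comment> \<open>Fullness is used here: \<open>g\<close> may be nonzero on every edge between
      vertices of \<open>K\<close>, so these edges have to belong to \<open>K\<close>.\<close>
    show "g \<sigma> = 0" if "\<sigma> \<notin> simplices_of_dim K 1" for \<sigma>
      using g(2)[of \<sigma>] full_subcomplex_edge[OF full, of \<sigma>] that by blast
  qed
  have "\<xi> {i} - \<delta> g i \<in> sing_boundaries n (P (U i))" if i: "i \<in> ?V" for i
  proof -
    have "\<xi> {i} - \<delta> g i = sing_boundary (Suc n) (w i) - (ksubdiv n N (\<xi> {i}) - \<xi> {i})"
      using g(3)[OF i] main by (simp add: v_def correction_null algebra_simps)
    moreover have "sing_boundary (Suc n) (w i) \<in> sing_boundaries n (P (U i))"
      using w(2)[OF i] by (auto simp: sing_boundaries_iff)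
    ultimately show ?thesis
      using ksubdiv_diff[OF lifts_vertex_cycle[OF \<xi>]] by (simp only: sing_boundaries_diff)
  qed
  with main gl show ?thesis by blast
qed

text \<open>This is the connecting homomorphism made explicit. After subdivision \<open>z\<close> is
  a sum of \<open>w i\<close>, and the boundaries of the \<open>w i\<close> come from edge chains
  \<open>g\<close> that form a lifted cycle. Gluing uses normalised cycles in place of
  \<open>g\<close>; the discrepancy is filled by edge chains \<open>h\<close>, whose contribution to
  the total is zero.\<close>

lemma glue_surjective:
  fixes z :: "('x, 'k::field) kchain"
  assumes full: "full_subcomplex K" and z: "z \<in> sing_cycles n (P (covered K))"
  obtains \<xi> \<eta> where "\<xi> \<in> lifts n K 0" "\<eta> \<in> lifted_cycles n K"
    "glue n \<xi> \<eta> - z \<in> sing_boundaries n (P (covered K))"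
proof -
  have K: "subcomplex K"
    using full by (simp add: full_subcomplex_def)
  let ?V = "vertices K"
  obtain N w where w: "ksubdiv n N z = (\<Sum>i\<in>?V. w i)" "\<And>i. i \<in> ?V \<Longrightarrow> kchain n (P (U i)) (w i)"
    using small_chain_covered[OF K sing_cycles_kchain[OF z]] by metis
  \<comment> \<open>Only the construction of \<open>\<eta>\<close> and \<open>h\<close>
    distinguishes \<open>n = 0\<close>, where both are zero; afterwards \<open>\<xi>\<close> is
    defined uniformly.\<close>
  have "\<exists>\<eta> h. \<eta> \<in> lifted_cycles n K \<and> (\<forall>i\<in>?V. kchain n (P (U i)) (\<delta> h i)) \<and> (\<forall>i. i \<notin> ?V \<longrightarrow> \<delta> h i = 0) \<and>
      (\<forall>i\<in>?V. sing_boundary n (w i - correction n \<eta> i + \<delta> h i) = 0)"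
  proof (cases n)
    case 0
    then show ?thesis
      by (intro exI[of _ "\<lambda>_. 0"]) (simp add: lifted_cycles_def sing_boundary_def delta_0 kchain_0)
  next
    case (Suc m)
    have bsum: "(\<Sum>i\<in>?V. sing_boundary n (w i)) = 0"
    proof -
      have "(\<Sum>i\<in>?V. sing_boundary n (w i)) = sing_boundary n (ksubdiv n N z)"
        by (simp add: w(1) klinear_sum[OF klinear_sing_boundary])
      also have "\<dots> = 0"
        using sing_boundary_ksubdiv[of z m _ N] sing_cycles_kchain[OF z] z
        by (simp add: Suc sing_cycles_iff klinear_0[OF klinear_ksubdiv])
      finally show ?thesis .
    qed
    have wb: "kchain m (P (U i)) (sing_boundary n (w i))" if "i \<in> ?V" for i
      using w(2)[OF that] unfolding Suc by (rule kchain_sing_boundary)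
    obtain g where g: "\<And>e. e \<in> edges \<Longrightarrow> kchain m (P (UU e)) (g e)"
      "\<And>e. \<not> (e \<in> edges \<and> e \<subseteq> ?V) \<Longrightarrow> g e = 0" "\<And>i. i \<in> ?V \<Longrightarrow> sing_boundary n (w i) = \<delta> g i"
      using delta_exact[OF subcomplex_vertices[OF K] wb bsum] by metis
    have gc: "kchain m (P (UU e)) (g e)" for e
      using g(1,2)[of e] by (cases "e \<in> edges") (auto simp: kchain_0)
    \<comment> \<open>The boundary of \<open>w i\<close> is \<open>\<delta> g i\<close>; its own
      boundary vanishes, so \<open>delta_injective\<close> at one end of \<open>e\<close> shows that
      \<open>g e\<close> is a cycle.\<close>
    have g_bd: "sing_boundary m (g e) = 0" for e
    proof (cases "e \<in> edges \<and> e \<subseteq> ?V")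
      case True
      then obtain i where i: "i \<in> e" "i \<in> ?V" using edges_nonempty by blast
      show ?thesis
      proof (cases m)
        case 0
        then show ?thesis by (simp add: sing_boundary_def)
      next
        case (Suc l)
        have "\<delta> (\<lambda>e. sing_boundary m (g e)) i = 0"
          using sing_boundary_boundary[of "w i" m] w(2)[OF i(2)] g(3)[OF i(2)] \<open>n = Suc m\<close>
          by (simp flip: delta_linear[OF klinear_sing_boundary])
        moreover have "kchain l (P (UU e)) (sing_boundary m (g e))" for e
          using gc[of e] unfolding Suc by (rule kchain_sing_boundary)
        ultimately show ?thesis
          using delta_injective[where p=l and i=i and e=e and \<eta>="\<lambda>e. sing_boundary m (g e)"] True i by blast
      qed
    next
      case False
      then show ?thesis by (simp add: g(2) klinear_0[OF klinear_sing_boundary])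
    qed
    have gl: "g \<in> lifts m K 1"
      unfolding lifts_def
    proof (intro CollectI conjI allI impI)
      show "g \<sigma> \<in> sing_cycles m (P (UU \<sigma>))" for \<sigma>
        using g_bd gc by (simp add: sing_cycles_iff)
      show "g \<sigma> = 0" if "\<sigma> \<notin> simplices_of_dim K 1" for \<sigma>
        using g(2)[of \<sigma>] full_subcomplex_edge[OF full, of \<sigma>] that by blast
    qed
    have "\<delta> g i \<in> sing_boundaries m (P (U i))" for i
    proof (cases "i \<in> ?V")
      case True
      then show ?thesis
        unfolding sing_boundaries_iff using g(3) w(2) Suc by metis
    next
      case False
      then have "\<delta> g i = 0"
        using g(2) by (intro delta_0) blast
      then show ?thesis
        by (simp add: sing_boundaries_0)
    qed
    then have gz: "g \<in> lifted_cycles n K"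
      using gl by (simp add: lifted_cycles_def Suc)
    define \<rho> where "\<rho> e = normaliser m (P (UU e)) (g e)" for e
    define h where "h e = primitive m (P (UU e)) (\<rho> e - g e)" for e
    have hb: "sing_boundary n (h e) = \<rho> e - g e" for e
      unfolding h_def \<rho>_def Suc by (intro sing_boundary_primitive normaliser_diff)
    have "\<delta> h i = 0" if "i \<notin> ?V" for i
    proof (rule delta_0)
      fix e assume "i \<in> e"
      then have "g e = 0" using g(2) that by blast
      then show "h e = 0"
        by (simp add: h_def \<rho>_def klinear_0[OF klinear_primitive] normaliser_0)
    qed
    moreover have "kchain n (P (U i)) (\<delta> h i)" for i
      unfolding h_def Suc by (intro delta_kchain kchain_primitive)
    moreover have "sing_boundary n (w i - correction n g i + \<delta> h i) = 0" if "i \<in> ?V" for i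
    proof -
      have "sing_boundary n (correction n g i) = \<delta> \<rho> i"
        using gz sing_boundary_correction[of g m K i] by (simp add: Suc \<rho>_def[abs_def])
      moreover have "sing_boundary n (\<delta> h i) = \<delta> \<rho> i - \<delta> g i"
        by (simp add: delta_linear[OF klinear_sing_boundary] hb delta_diff)
      ultimately show ?thesis
        using g(3)[OF that] by (simp add: klinear_add[OF klinear_sing_boundary] klinear_diff[OF klinear_sing_boundary])
    qed
    ultimately show ?thesis
      using gz by blast
  qed
  then obtain \<eta> h where \<eta>: "\<eta> \<in> lifted_cycles n K" and h: "\<And>i. i \<in> ?V \<Longrightarrow> kchain n (P (U i)) (\<delta> h i)"
    "\<And>i. i \<notin> ?V \<Longrightarrow> \<delta> h i = 0" and cyc: "\<And>i. i \<in> ?V \<Longrightarrow> sing_boundary n (w i - correction n \<eta> i + \<delta> h i) = 0"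
    by blast
  \<comment> \<open>What is left at a vertex once the correction is removed. The term
    \<open>\<delta> h\<close> makes it a cycle and disappears from the sum over all
    vertices.\<close>
  define \<xi> where "\<xi> \<sigma> = (if \<sigma> \<in> simplices_of_dim K 0
      then w (the_elem \<sigma>) - correction n \<eta> (the_elem \<sigma>) + \<delta> h (the_elem \<sigma>) else 0)" for \<sigma>
  have \<xi>_vertex: "\<xi> {i} = w i - correction n \<eta> i + \<delta> h i" if "i \<in> ?V" for i
    using that by (simp add: \<xi>_def simplices_of_dim_0)
  have "\<xi> \<in> lifts n K 0"
    unfolding lifts_def
  proof (intro CollectI conjI allI impI)
    fix \<sigma>
    show "\<xi> \<sigma> \<in> sing_cycles n (P (UU \<sigma>))"
    proof (cases "\<sigma> \<in> simplices_of_dim K 0")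
      case True
      then obtain i where i: "i \<in> ?V" "\<sigma> = {i}"
        by (auto simp: simplices_of_dim_0)
      have "kchain n (P (U i)) (\<xi> {i})"
        unfolding \<xi>_vertex[OF i(1)] by (intro kchain_add kchain_diff w(2) h(1) kchain_correction i)
      then show ?thesis
        using cyc[OF i(1)] \<xi>_vertex[OF i(1)] i by (simp add: sing_cycles_iff)
    qed (simp add: \<xi>_def sing_cycles_0)
  qed (simp add: \<xi>_def)
  moreover have "glue n \<xi> \<eta> - z \<in> sing_boundaries n (P (covered K))"
  proof -
    have "glue n \<xi> \<eta> = (\<Sum>i\<in>?V. w i + \<delta> h i)"
      unfolding glue_eq[OF K \<open>\<xi> \<in> lifts n K 0\<close> \<eta>] by (rule sum.cong) (simp_all add: \<xi>_vertex)
    also have "\<dots> = ksubdiv n N z + (\<Sum>i\<in>?V. \<delta> h i)"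
      by (simp add: sum.distrib w(1))
    also have "(\<Sum>i\<in>?V. \<delta> h i) = (\<Sum>i\<in>I. \<delta> h i)"
      by (rule sum.mono_neutral_left) (use h(2) subcomplex_vertices[OF K] finite_I in auto)
    finally have "glue n \<xi> \<eta> = ksubdiv n N z"
      by (simp add: sum_delta)
    then show ?thesis
      using ksubdiv_diff[OF z] by simp
  qed
  ultimately show ?thesis
    using \<eta> that by blast
qed

end

section \<open>Homology of the cellular Leray cosheaf\<close>

context nerve_cover
begin

abbreviation leray_part :: "nat \<Rightarrow> ('i, 'k::field, ('x, 'k) kchain set) cellular_cosheaf" where
  "leray_part \<equiv> cellular_part U (leray TYPE('k) X f)"

lemma leray_part_simps:
  "cob (leray_part n) \<sigma> = sing_homology n (P (UU \<sigma>))"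
  "cmor (leray_part n) \<sigma> \<tau> = sing_homology_map n (P (UU \<sigma>)) (\<lambda>x. x)"
  by (simp_all add: cellular_part_def leray_def)

lemma subcomplex_finite:
  assumes "subcomplex K" shows "finite (simplices_of_dim K p)"
  by (rule finite_subset[of _ "Pow I"])
    (use assms finite_I in \<open>auto simp: subcomplex_def simplices_of_dim_def nerve_def\<close>)

lemma no_triangles:
  assumes "subcomplex K" shows "simplices_of_dim K (Suc (Suc 0)) = {}"
proof (rule ccontr)
  assume "simplices_of_dim K (Suc (Suc 0)) \<noteq> {}"
  then obtain \<sigma> where "\<sigma> \<in> K" "card \<sigma> = 3"
    by (auto simp: simplices_of_dim_def numeral_3_eq_3)
  then have \<sigma>: "\<sigma> \<subseteq> I" "(\<Inter>i\<in>\<sigma>. U i) \<noteq> {}" "card \<sigma> = 3"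
    using assms by (auto simp: subcomplex_def nerve_def)
  then obtain i j k where "\<sigma> = {i, j, k}" "i \<noteq> j" "j \<noteq> k" "i \<noteq> k"
    by (metis card_3_iff)
  then show False
    using \<sigma> one_dim[of i j k] by auto
qed

lemma vector_space_cell_chains:
  assumes "subcomplex K" "\<And>\<sigma>. vector_space_over (cob F \<sigma>)"
  shows "vector_space_over (cell_chains K F p)"
  unfolding cell_chains_def by (intro vector_space_direct_sum subcomplex_finite assms)

text \<open>Without triangles the only 2-chain is zero, so first cellular homology is the space of
  cycles up to a trivial quotient.\<close>

lemma cell_boundaries_1:
  assumes K: "subcomplex K" and F: "\<And>\<sigma>. vector_space_over (cob F \<sigma>)"
  shows "cell_boundaries r K F 1 = {\<zero>\<^bsub>cell_chains K F 1\<^esub>}"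
proof -
  have "carrier (cell_chains K F (Suc 1)) = {\<lambda>\<sigma>. \<zero>\<^bsub>cob F \<sigma>\<^esub>}"
    unfolding cell_chains_def carrier_direct_sum[OF subcomplex_finite[OF K]]
    using no_triangles[OF K] by auto
  moreover have "cell_boundary r K F 1 c \<sigma> = \<zero>\<^bsub>cob F \<sigma>\<^esub>" for c \<sigma>
  proof -
    interpret module kring "cob F \<sigma>" by (rule F)
    show ?thesis
      using no_triangles[OF K] by (simp add: cell_boundary_def)
  qed
  ultimately show ?thesis
    by (auto simp: cell_boundaries_def cell_chains_def fun_eq_iff)
qed

definition cell_lift :: "nat \<Rightarrow> ('i set \<Rightarrow> ('x, 'k::field) kchain) \<Rightarrow> 'i set \<Rightarrow> ('x, 'k) kchain set" where
  "cell_lift n \<xi> = (\<lambda>\<sigma>. hclass n (P (UU \<sigma>)) (\<xi> \<sigma>))"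

lemma vector_space_leray_part: "vector_space_over (cob (leray_part n) \<sigma>)"
  by (simp add: leray_part_simps vector_space_sing_homology)

text \<open>A cycle is chosen in each homology class. Off the complex the zero chain itself is
  taken, not just some cycle of zero class, so that lifts over a subcomplex are lifts over every
  larger one.\<close>

lemma carrier_cell_chains:
  assumes K: "subcomplex K"
  shows "carrier (cell_chains K (leray_part n) p) = cell_lift n ` lifts n K p"
proof
  show "cell_lift n ` lifts n K p \<subseteq> carrier (cell_chains K (leray_part n) p)"
    unfolding cell_chains_def carrier_direct_sum[OF subcomplex_finite[OF K]]
    by (auto simp: leray_part_simps cell_lift_def lifts_def hclass_closed zero_sing_homology)
  show "carrier (cell_chains K (leray_part n) p) \<subseteq> cell_lift n ` lifts n K p"
  proof
    fix x assume "x \<in> carrier (cell_chains K (leray_part n) p)"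
    then have x: "\<And>\<sigma>. \<sigma> \<in> simplices_of_dim K p \<Longrightarrow> x \<sigma> \<in> carrier (sing_homology n (P (UU \<sigma>)))"
      "\<And>\<sigma>. \<sigma> \<notin> simplices_of_dim K p \<Longrightarrow> x \<sigma> = hclass n (P (UU \<sigma>)) 0"
      unfolding cell_chains_def carrier_direct_sum[OF subcomplex_finite[OF K]]
      by (auto simp: leray_part_simps zero_sing_homology)
    have "\<forall>\<sigma>. \<exists>z. z \<in> sing_cycles n (P (UU \<sigma>)) \<and> x \<sigma> = hclass n (P (UU \<sigma>)) z \<and>
        (\<sigma> \<notin> simplices_of_dim K p \<longrightarrow> z = 0)"
    proof
      fix \<sigma>
      show "\<exists>z. z \<in> sing_cycles n (P (UU \<sigma>)) \<and> x \<sigma> = hclass n (P (UU \<sigma>)) z \<and>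
        (\<sigma> \<notin> simplices_of_dim K p \<longrightarrow> z = 0)"
        using x[of \<sigma>] by (cases "\<sigma> \<in> simplices_of_dim K p") (auto simp: carrier_sing_homology sing_cycles_0)
    qed
    then obtain \<xi> where \<xi>: "\<And>\<sigma>. \<xi> \<sigma> \<in> sing_cycles n (P (UU \<sigma>)) \<and> x \<sigma> = hclass n (P (UU \<sigma>)) (\<xi> \<sigma>) \<and>
        (\<sigma> \<notin> simplices_of_dim K p \<longrightarrow> \<xi> \<sigma> = 0)"
      by metis
    then have "x = cell_lift n \<xi>" "\<xi> \<in> lifts n K p"
      by (auto simp: cell_lift_def lifts_def)
    then show "x \<in> cell_lift n ` lifts n K p"
      by blast
  qed
qed

lemma cell_chains_simps:
  "\<zero>\<^bsub>cell_chains K (leray_part n) p\<^esub> = cell_lift n (\<lambda>_. 0)"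
  "\<xi> \<in> lifts n K p \<Longrightarrow> \<xi>' \<in> lifts n K p \<Longrightarrow>
    cell_lift n \<xi> \<oplus>\<^bsub>cell_chains K' (leray_part n) p\<^esub> cell_lift n \<xi>' = cell_lift n (\<lambda>\<sigma>. \<xi> \<sigma> + \<xi>' \<sigma>)"
  "\<xi> \<in> lifts n K p \<Longrightarrow> a \<odot>\<^bsub>cell_chains K' (leray_part n) p\<^esub> cell_lift n \<xi> = cell_lift n (\<lambda>\<sigma>. chain_scale a (\<xi> \<sigma>))"
  by (auto simp: cell_chains_def cell_lift_def leray_part_simps zero_sing_homology add_hclass smult_hclass lifts_cycle)

lemma cell_lift_eq_iff:
  "\<xi> \<in> lifts n K p \<Longrightarrow> \<xi>' \<in> lifts n K p \<Longrightarrow>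
    cell_lift n \<xi> = cell_lift n \<xi>' \<longleftrightarrow> (\<forall>\<sigma>. \<xi> \<sigma> - \<xi>' \<sigma> \<in> sing_boundaries n (P (UU \<sigma>)))"
  by (simp add: cell_lift_def fun_eq_iff hclass_eq_iff lifts_cycle)

text \<open>Repackages the vertex chains as a function on simplices, so that cellular boundaries of
  lifts are again given by lifts.\<close>

definition vertex_lift :: "'i set set \<Rightarrow> ('i set \<Rightarrow> ('x, 'k::field) kchain) \<Rightarrow> 'i set \<Rightarrow> ('x, 'k) kchain" where
  "vertex_lift K \<eta> \<sigma> = (if \<sigma> \<in> simplices_of_dim K 0 then \<delta> \<eta> (the_elem \<sigma>) else 0)"

lemma vertex_lift_vertex: "i \<in> vertices K \<Longrightarrow> vertex_lift K \<eta> {i} = \<delta> \<eta> i"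
  by (simp add: vertex_lift_def simplices_of_dim_0)

lemma delta_lift_outside:
  assumes "subcomplex K" "\<eta> \<in> lifts n K 1" "i \<notin> vertices K"
  shows "\<delta> \<eta> i = 0"
  by (rule delta_0) (use assms subcomplex_edge(2)[OF assms(1)] lifts_outside[OF assms(2)] in blast)

lemma vertex_lift_lifts:
  assumes "\<eta> \<in> lifts n K 1" shows "vertex_lift K \<eta> \<in> lifts n K 0"
  using assms by (auto simp: lifts_def vertex_lift_def simplices_of_dim_0 sing_cycles_0 intro!: delta_cycles)

lemma vertex_lift_subcomplex:
  assumes K: "subcomplex K" and \<eta>: "\<eta> \<in> lifts n K 1" and sub: "K \<subseteq> K'"
  shows "vertex_lift K' \<eta> = vertex_lift K \<eta>"
proof
  fix \<sigma>
  show "vertex_lift K' \<eta> \<sigma> = vertex_lift K \<eta> \<sigma>"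
  proof (cases "\<sigma> \<in> simplices_of_dim K' 0 \<and> \<sigma> \<notin> simplices_of_dim K 0")
    case True
    then obtain i where "\<sigma> = {i}" "i \<in> vertices K'" "i \<notin> vertices K"
      by (auto simp: simplices_of_dim_0)
    then show ?thesis
      using True delta_lift_outside[OF K \<eta>, of i] by (simp add: vertex_lift_def)
  next
    case False
    then show ?thesis
      using sub by (auto simp: vertex_lift_def simplices_of_dim_def)
  qed
qed

text \<open>This turns cellular cycles and boundaries into statements about \<open>\<delta>\<close>
  and singular boundaries, to which the results on gluing apply.\<close>

lemma cell_boundary_lift:
  fixes \<eta> :: "'i set \<Rightarrow> ('x, 'k::field) kchain"
  assumes K: "subcomplex K" and \<eta>: "\<eta> \<in> lifts n K 1"
  shows "cell_boundary r K (leray_part n) 0 (cell_lift n \<eta>) = cell_lift n (vertex_lift K \<eta>)"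
proof
  fix \<sigma>
  show "cell_boundary r K (leray_part n) 0 (cell_lift n \<eta>) \<sigma> = cell_lift n (vertex_lift K \<eta>) \<sigma>"
  proof (cases "\<sigma> \<in> simplices_of_dim K 0")
    case False
    then show ?thesis
      by (simp add: cell_boundary_def cell_lift_def vertex_lift_def leray_part_simps zero_sing_homology)
  next
    case True
    then obtain i where i: "i \<in> vertices K" "\<sigma> = {i}"
      by (auto simp: simplices_of_dim_0)
    let ?H = "sing_homology n (P (U i)) :: ('k, ('x, 'k) kchain set) vs"
    let ?T = "{\<tau>\<in>simplices_of_dim K (Suc 0). {i} \<subseteq> \<tau>}"
    interpret module kring ?H by (rule vector_space_sing_homology)
    have cyc: "\<eta> \<tau> \<in> sing_cycles n (P (U i))" if "i \<in> \<tau>" for \<tau>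
      using lifts_cycle[OF \<eta>, of \<tau>] by (rule sing_cycles_preimage_mono) (use that in auto)
    have face: "incidence r {i} \<tau> \<odot>\<^bsub>?H\<^esub> sing_homology_map n (P (U i)) (\<lambda>x. x) (cell_lift n \<eta> \<tau>)
        = hclass n (P (U i)) (chain_scale (incidence r {i} \<tau>) (\<eta> \<tau>))" if "\<tau> \<in> ?T" for \<tau>
    proof -
      have "sing_homology_map n (P (U i)) (\<lambda>x. x) (cell_lift n \<eta> \<tau>) = hclass n (P (U i)) (\<eta> \<tau>)"
        unfolding cell_lift_def
        by (rule sing_homology_map_inclusion[OF lifts_cycle[OF \<eta>]]; rule singular_simplex_preimage_mono)
          (use that in auto)
      then show ?thesis
        using cyc that by (simp add: smult_hclass)
    qed
    have "cell_boundary r K (leray_part n) 0 (cell_lift n \<eta>) \<sigma>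
      = finsum ?H (\<lambda>\<tau>. incidence r {i} \<tau> \<odot>\<^bsub>?H\<^esub> sing_homology_map n (P (U i)) (\<lambda>x. x) (cell_lift n \<eta> \<tau>)) ?T"
      using True by (simp add: cell_boundary_def leray_part_simps i(2))
    also have "\<dots> = finsum ?H (\<lambda>\<tau>. hclass n (P (U i)) (chain_scale (incidence r {i} \<tau>) (\<eta> \<tau>))) ?T"
      by (rule M.finsum_cong') (auto simp: face hclass_closed sing_cycles_scale cyc)
    also have "\<dots> = hclass n (P (U i)) (\<Sum>\<tau>\<in>?T. chain_scale (incidence r {i} \<tau>) (\<eta> \<tau>))"
      by (rule finsum_hclass) (use subcomplex_finite[OF K] cyc in \<open>auto simp: sing_cycles_scale\<close>)
    \<comment> \<open>Edges of the nerve outside \<open>K\<close> may be added to the sum, since the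
      lift is 0 on them.\<close>
    also have "(\<Sum>\<tau>\<in>?T. chain_scale (incidence r {i} \<tau>) (\<eta> \<tau>)) = \<delta> \<eta> i"
      unfolding edge_sum_def
      by (rule sum.mono_neutral_left)
        (use finite_edges subcomplex_edge(1)[OF K] lifts_outside[OF \<eta>] in auto)
    finally show ?thesis
      using i by (simp add: cell_lift_def vertex_lift_vertex)
  qed
qed

lemma cell_boundaries_0:
  fixes K :: "'i set set"
  assumes "subcomplex K"
  shows "cell_boundaries r K (leray_part n) 0 = (\<lambda>\<eta>. cell_lift n (vertex_lift K \<eta>)) ` lifts n K 1"
  unfolding cell_boundaries_def carrier_cell_chains[OF assms] image_image One_nat_def[symmetric]
  by (intro image_cong refl cell_boundary_lift[OF assms])

lemma vertex_lift_add: "vertex_lift K (\<lambda>\<sigma>. \<eta> \<sigma> + \<eta>' \<sigma>) = (\<lambda>\<sigma>. vertex_lift K \<eta> \<sigma> + vertex_lift K \<eta>' \<sigma>)"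
  and vertex_lift_scale: "vertex_lift K (\<lambda>\<sigma>. chain_scale a (\<eta> \<sigma>)) = (\<lambda>\<sigma>. chain_scale a (vertex_lift K \<eta> \<sigma>))"
  and vertex_lift_zero: "vertex_lift K (\<lambda>_. 0) = (\<lambda>_. 0)"
  by (auto simp: vertex_lift_def delta_add delta_scale delta_0)

lemma submodule_cell_boundaries_0:
  fixes K :: "'i set set"
  assumes K: "subcomplex K"
  shows "submodule (cell_boundaries r K (leray_part n) 0) (kring :: 'k::field ring) (cell_chains K (leray_part n) 0)"
proof (rule vector_subspaceI[OF vector_space_cell_chains[OF K vector_space_leray_part]])
  show "cell_boundaries r K (leray_part n) 0 \<subseteq> carrier (cell_chains K (leray_part n) 0)"
    unfolding cell_boundaries_0[OF K] carrier_cell_chains[OF K] using vertex_lift_lifts by blast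
  show "\<zero>\<^bsub>cell_chains K (leray_part n) 0\<^esub> \<in> cell_boundaries r K (leray_part n) 0"
    unfolding cell_boundaries_0[OF K] cell_chains_simps
    by (rule image_eqI[OF _ zero_lifts]) (simp add: vertex_lift_zero)
next
  fix x y :: "'i set \<Rightarrow> ('x, 'k) kchain set"
  assume "x \<in> cell_boundaries r K (leray_part n) 0" "y \<in> cell_boundaries r K (leray_part n) 0"
  then obtain \<eta> \<eta>' where e: "\<eta> \<in> lifts n K 1" "x = cell_lift n (vertex_lift K \<eta>)"
    "\<eta>' \<in> lifts n K 1" "y = cell_lift n (vertex_lift K \<eta>')"
    unfolding cell_boundaries_0[OF K] by blast
  have "x \<oplus>\<^bsub>cell_chains K (leray_part n) 0\<^esub> y = cell_lift n (vertex_lift K (\<lambda>\<sigma>. \<eta> \<sigma> + \<eta>' \<sigma>))"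
    unfolding e(2,4) vertex_lift_add
    by (rule cell_chains_simps(2)[OF vertex_lift_lifts[OF e(1)] vertex_lift_lifts[OF e(3)]])
  then show "x \<oplus>\<^bsub>cell_chains K (leray_part n) 0\<^esub> y \<in> cell_boundaries r K (leray_part n) 0"
    unfolding cell_boundaries_0[OF K] using lifts_add[OF e(1,3)] by blast
next
  fix a :: 'k and x :: "'i set \<Rightarrow> ('x, 'k) kchain set"
  assume "x \<in> cell_boundaries r K (leray_part n) 0"
  then obtain \<eta> where e: "\<eta> \<in> lifts n K 1" "x = cell_lift n (vertex_lift K \<eta>)"
    unfolding cell_boundaries_0[OF K] by blast
  have "a \<odot>\<^bsub>cell_chains K (leray_part n) 0\<^esub> x = cell_lift n (vertex_lift K (\<lambda>\<sigma>. chain_scale a (\<eta> \<sigma>)))"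
    unfolding e(2) vertex_lift_scale by (rule cell_chains_simps(3)[OF vertex_lift_lifts[OF e(1)]])
  then show "a \<odot>\<^bsub>cell_chains K (leray_part n) 0\<^esub> x \<in> cell_boundaries r K (leray_part n) 0"
    unfolding cell_boundaries_0[OF K] using lifts_scale[OF e(1)] by blast
qed

definition class0 :: "nat \<Rightarrow> 'i set set \<Rightarrow> ('i set \<Rightarrow> ('x, 'k::field) kchain) \<Rightarrow> ('i set \<Rightarrow> ('x, 'k) kchain set) set" where
  "class0 n K \<xi> = cell_boundaries r K (leray_part n) 0 +>\<^bsub>cell_chains K (leray_part n) 0\<^esub> cell_lift n \<xi>"

lemma cell_lift_chain: "subcomplex K \<Longrightarrow> \<xi> \<in> lifts n K p \<Longrightarrow> cell_lift n \<xi> \<in> carrier (cell_chains K (leray_part n) p)"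
  by (simp add: carrier_cell_chains)

lemma carrier_cell_homology_0:
  assumes "subcomplex K"
  shows "carrier (cell_homology r K (leray_part n) 0) = class0 n K ` lifts n K 0"
  by (auto simp: cell_homology_def cell_cycles_def class0_def carrier_cell_chains[OF assms])

lemma class0_add:
  assumes K: "subcomplex K" and \<xi>: "\<xi> \<in> lifts n K 0" "\<xi>' \<in> lifts n K 0"
  shows "class0 n K \<xi> \<oplus>\<^bsub>cell_homology r K (leray_part n) 0\<^esub> class0 n K \<xi>' = class0 n K (\<lambda>\<sigma>. \<xi> \<sigma> + \<xi>' \<sigma>)"
  using coset_add[OF vector_space_cell_chains[OF K vector_space_leray_part] submodule_cell_boundaries_0[OF K],
      OF cell_lift_chain[OF K \<xi>(1)] cell_lift_chain[OF K \<xi>(2)]] cell_chains_simps(2)[OF \<xi>, of K]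
  by (simp add: cell_homology_def class0_def)

lemma class0_smult:
  assumes K: "subcomplex K" and \<xi>: "\<xi> \<in> lifts n K 0"
  shows "a \<odot>\<^bsub>cell_homology r K (leray_part n) 0\<^esub> class0 n K \<xi> = class0 n K (\<lambda>\<sigma>. chain_scale a (\<xi> \<sigma>))"
  using coset_smult[OF vector_space_cell_chains[OF K vector_space_leray_part] submodule_cell_boundaries_0[OF K],
      OF cell_lift_chain[OF K \<xi>], of a] cell_chains_simps(3)[OF \<xi>, of K a]
  by (simp add: cell_homology_def class0_def)

text \<open>Applied to a difference of lifts, the right-hand side is the hypothesis of
  \<open>glue_null\<close> and the conclusion of \<open>glue_injective\<close>. Off the vertices
  nothing has to be checked, as all lifts vanish there.\<close>

lemma class0_eq_iff:
  fixes \<xi> \<xi>' :: "'i set \<Rightarrow> ('x, 'k::field) kchain"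
  assumes K: "subcomplex K" and \<xi>: "\<xi> \<in> lifts n K 0" "\<xi>' \<in> lifts n K 0"
  shows "class0 n K \<xi> = class0 n K \<xi>' \<longleftrightarrow>
    (\<exists>\<theta>\<in>lifts n K 1. \<forall>i\<in>vertices K. \<xi> {i} - \<xi>' {i} - \<delta> \<theta> i \<in> sing_boundaries n (P (U i)))"
proof -
  have eq: "cell_lift n \<xi> = cell_lift n (vertex_lift K \<theta>) \<oplus>\<^bsub>cell_chains K (leray_part n) 0\<^esub> cell_lift n \<xi>'
      \<longleftrightarrow> (\<forall>i\<in>vertices K. \<xi> {i} - \<xi>' {i} - \<delta> \<theta> i \<in> sing_boundaries n (P (U i)))"
    if \<theta>: "\<theta> \<in> lifts n K 1" for \<theta>
  proof -
    have "cell_lift n \<xi> = cell_lift n (vertex_lift K \<theta>) \<oplus>\<^bsub>cell_chains K (leray_part n) 0\<^esub> cell_lift n \<xi>'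
      \<longleftrightarrow> (\<forall>\<sigma>. \<xi> \<sigma> - (vertex_lift K \<theta> \<sigma> + \<xi>' \<sigma>) \<in> sing_boundaries n (P (UU \<sigma>)))"
      using cell_chains_simps(2)[OF vertex_lift_lifts[OF \<theta>] \<xi>(2), of K]
        cell_lift_eq_iff[OF \<xi>(1) lifts_add[OF vertex_lift_lifts[OF \<theta>] \<xi>(2)]] by simp
    also have "\<dots> \<longleftrightarrow> (\<forall>i\<in>vertices K. \<xi> {i} - (vertex_lift K \<theta> {i} + \<xi>' {i}) \<in> sing_boundaries n (P (UU {i})))"
    proof (intro iffI allI ballI)
      fix \<sigma> assume *: "\<forall>i\<in>vertices K. \<xi> {i} - (vertex_lift K \<theta> {i} + \<xi>' {i}) \<in> sing_boundaries n (P (UU {i}))"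
      show "\<xi> \<sigma> - (vertex_lift K \<theta> \<sigma> + \<xi>' \<sigma>) \<in> sing_boundaries n (P (UU \<sigma>))"
      proof (cases "\<sigma> \<in> simplices_of_dim K 0")
        case True
        then show ?thesis using * unfolding simplices_of_dim_0 by blast
      next
        case False
        then show ?thesis
          using lifts_outside[OF \<xi>(1) False] lifts_outside[OF \<xi>(2) False]
          by (simp add: vertex_lift_def sing_boundaries_0)
      qed
    qed blast
    also have "\<dots> \<longleftrightarrow> (\<forall>i\<in>vertices K. \<xi> {i} - \<xi>' {i} - \<delta> \<theta> i \<in> sing_boundaries n (P (U i)))"
      by (simp add: vertex_lift_vertex algebra_simps)
    finally show ?thesis .
  qed
  have "class0 n K \<xi> = class0 n K \<xi>' \<longleftrightarrow>
    (\<exists>b\<in>cell_boundaries r K (leray_part n) 0. cell_lift n \<xi> = b \<oplus>\<^bsub>cell_chains K (leray_part n) 0\<^esub> cell_lift n \<xi>')"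
    unfolding class0_def
    by (rule coset_eq_iff[OF vector_space_cell_chains[OF K vector_space_leray_part] submodule_cell_boundaries_0[OF K]
      cell_lift_chain[OF K \<xi>(1)] cell_lift_chain[OF K \<xi>(2)]])
  then show ?thesis
    unfolding cell_boundaries_0[OF K] using eq by blast
qed

text \<open>The representative is kept. Boundaries over \<open>K\<close> remain boundaries over
  \<open>K'\<close> because \<open>\<delta>\<close> of a lift over \<open>K\<close> vanishes off the
  vertices of \<open>K\<close>.\<close>

lemma class0_inclusion:
  fixes \<xi> :: "'i set \<Rightarrow> ('x, 'k::field) kchain"
  assumes K: "subcomplex K" and K': "subcomplex K'" and sub: "K \<subseteq> K'" and \<xi>: "\<xi> \<in> lifts n K 0"
  shows "cell_homology_incl r K' (leray_part n) 0 (class0 n K \<xi>) = class0 n K' \<xi>"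
  unfolding cell_homology_incl_def class0_def
proof (rule quot_map_coset[OF vector_space_cell_chains[OF K vector_space_leray_part] submodule_cell_boundaries_0[OF K]
      vector_space_cell_chains[OF K' vector_space_leray_part] submodule_cell_boundaries_0[OF K']])
  show "cell_lift n \<xi> \<in> carrier (cell_chains K (leray_part n) 0)"
    by (rule cell_lift_chain[OF K \<xi>])
  show "cell_lift n \<xi> \<in> carrier (cell_chains K' (leray_part n) 0)"
    by (rule cell_lift_chain[OF K']) (use lifts_mono[OF sub] \<xi> in blast)
  fix b :: "'i set \<Rightarrow> ('x, 'k) kchain set"
  assume "b \<in> cell_boundaries r K (leray_part n) 0"
  then obtain \<eta> where \<eta>: "\<eta> \<in> lifts n K 1" "b = cell_lift n (vertex_lift K \<eta>)"
    unfolding cell_boundaries_0[OF K] by blast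
  have "b \<in> cell_boundaries r K' (leray_part n) 0"
    unfolding cell_boundaries_0[OF K']
  proof (rule image_eqI)
    show "b = cell_lift n (vertex_lift K' \<eta>)"
      unfolding \<eta>(2) vertex_lift_subcomplex[OF K \<eta>(1) sub] ..
    show "\<eta> \<in> lifts n K' 1"
      by (rule subsetD[OF lifts_mono[OF sub] \<eta>(1)])
  qed
  then show "b \<in> cell_boundaries r K' (leray_part n) 0 \<and>
      b \<oplus>\<^bsub>cell_chains K (leray_part n) 0\<^esub> cell_lift n \<xi> = b \<oplus>\<^bsub>cell_chains K' (leray_part n) 0\<^esub> cell_lift n \<xi>"
    by (simp add: cell_chains_def)
qed

subsection \<open>The degree-one part\<close>

abbreviation prev_part :: "nat \<Rightarrow> ('i, 'k::field, ('x, 'k) kchain set) cellular_cosheaf" where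
  "prev_part \<equiv> prev_degree leray_part"

text \<open>In degree 0 the value \<open>undefined\<close> is the only element of
  \<open>zero_vs\<close>, on which the cosheaf of index -1 is built.\<close>

definition prev_lift :: "nat \<Rightarrow> ('i set \<Rightarrow> ('x, 'k::field) kchain) \<Rightarrow> 'i set \<Rightarrow> ('x, 'k) kchain set" where
  "prev_lift n \<eta> = (case n of 0 \<Rightarrow> \<lambda>_. undefined | Suc m \<Rightarrow> cell_lift m \<eta>)"

lemma vector_space_prev_part: "vector_space_over (cob (prev_part n) \<sigma>)"
  by (cases n) (simp_all add: prev_degree_def zero_cosheaf_def vector_space_zero_vs vector_space_leray_part)

lemma cell_cycles_1:
  fixes K :: "'i set set"
  assumes K: "subcomplex K"
  shows "cell_cycles r K (prev_part n :: ('i, 'k::field, ('x, 'k) kchain set) cellular_cosheaf) 1 = prev_lift n ` lifted_cycles n K"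
proof (cases n)
  case 0
  let ?F = "zero_cosheaf :: ('i, 'k, ('x, 'k) kchain set) cellular_cosheaf"
  have carr: "carrier (cell_chains K ?F p) = {\<lambda>_. undefined}" for p
    unfolding cell_chains_def carrier_direct_sum[OF subcomplex_finite[OF K]]
    by (auto simp: zero_cosheaf_def zero_vs_def fun_eq_iff)
  have "cell_boundary r K ?F 0 c = \<zero>\<^bsub>cell_chains K ?F 0\<^esub>" for c
  proof
    fix \<sigma>
    let ?Z = "zero_vs :: ('k, ('x, 'k) kchain set) vs"
    interpret module kring ?Z
      by (rule vector_space_zero_vs)
    \<comment> \<open>The carrier has a single element, so membership alone forces every boundary to
      be zero.\<close>
    have "finsum ?Z (\<lambda>\<tau>. a \<tau> \<odot>\<^bsub>?Z\<^esub> b \<tau>) A \<in> carrier ?Z" for a b and A :: "'i set set"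
      by (rule M.finsum_closed) (simp add: zero_vs_def)
    moreover have "carrier ?Z = {\<zero>\<^bsub>?Z\<^esub>}" "cob ?F \<sigma> = ?Z"
      by (simp_all add: zero_cosheaf_def zero_vs_def)
    ultimately show "cell_boundary r K ?F 0 c \<sigma> = \<zero>\<^bsub>cell_chains K ?F 0\<^esub> \<sigma>"
      by (simp add: cell_boundary_def cell_chains_def)
  qed
  then show ?thesis
    using carr by (auto simp: cell_cycles_def 0 prev_degree_def prev_lift_def lifted_cycles_def)
next
  case (Suc m)
  have "cell_boundary r K (leray_part m) 0 (cell_lift m \<eta>) = \<zero>\<^bsub>cell_chains K (leray_part m) 0\<^esub>
      \<longleftrightarrow> (\<forall>i. \<delta> \<eta> i \<in> sing_boundaries m (P (U i)))"
    if \<eta>: "\<eta> \<in> lifts m K 1" for \<eta> :: "'i set \<Rightarrow> ('x, 'k) kchain"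
  proof -
    have "cell_boundary r K (leray_part m) 0 (cell_lift m \<eta>) = \<zero>\<^bsub>cell_chains K (leray_part m) 0\<^esub>
        \<longleftrightarrow> (\<forall>\<sigma>. vertex_lift K \<eta> \<sigma> \<in> sing_boundaries m (P (UU \<sigma>)))"
      unfolding cell_boundary_lift[OF K \<eta>] cell_chains_simps(1)
      using cell_lift_eq_iff[OF vertex_lift_lifts[OF \<eta>] zero_lifts] by simp
    also have "\<dots> \<longleftrightarrow> (\<forall>i\<in>vertices K. vertex_lift K \<eta> {i} \<in> sing_boundaries m (P (UU {i})))"
    proof (intro iffI allI ballI)
      fix \<sigma> assume *: "\<forall>i\<in>vertices K. vertex_lift K \<eta> {i} \<in> sing_boundaries m (P (UU {i}))"
      show "vertex_lift K \<eta> \<sigma> \<in> sing_boundaries m (P (UU \<sigma>))"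
      proof (cases "\<sigma> \<in> simplices_of_dim K 0")
        case True
        then show ?thesis using * unfolding simplices_of_dim_0 by blast
      qed (simp add: vertex_lift_def sing_boundaries_0)
    qed blast
    also have "\<dots> \<longleftrightarrow> (\<forall>i. \<delta> \<eta> i \<in> sing_boundaries m (P (U i)))"
    proof (intro iffI allI ballI)
      fix i assume *: "\<forall>i\<in>vertices K. vertex_lift K \<eta> {i} \<in> sing_boundaries m (P (UU {i}))"
      show "\<delta> \<eta> i \<in> sing_boundaries m (P (U i))"
        using * delta_lift_outside[OF K \<eta>, of i]
        by (cases "i \<in> vertices K") (auto simp: vertex_lift_vertex sing_boundaries_0)
    qed (simp add: vertex_lift_vertex)
    finally show ?thesis .
  qed
  then show ?thesis
    by (auto simp: cell_cycles_def Suc prev_degree_def prev_lift_def lifted_cycles_def carrier_cell_chains[OF K])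
qed

lemma prev_lift_add:
  assumes "\<eta> \<in> lifted_cycles n K" "\<eta>' \<in> lifted_cycles n K"
  shows "prev_lift n \<eta> \<oplus>\<^bsub>cell_chains K' (prev_part n) 1\<^esub> prev_lift n \<eta>' = prev_lift n (\<lambda>\<sigma>. \<eta> \<sigma> + \<eta>' \<sigma>)"
proof (cases n)
  case 0
  then show ?thesis
    by (simp add: prev_lift_def prev_degree_def cell_chains_def) (simp add: zero_cosheaf_def zero_vs_def)
next
  case (Suc m)
  then show ?thesis
    using assms by (auto simp: lifted_cycles_def prev_lift_def prev_degree_def intro!: cell_chains_simps(2)[of _ _ K])
qed

lemma prev_lift_smult:
  assumes "\<eta> \<in> lifted_cycles n K"
  shows "a \<odot>\<^bsub>cell_chains K' (prev_part n) 1\<^esub> prev_lift n \<eta> = prev_lift n (\<lambda>\<sigma>. chain_scale a (\<eta> \<sigma>))"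
proof (cases n)
  case 0
  then show ?thesis
    by (simp add: prev_lift_def prev_degree_def cell_chains_def) (simp add: zero_cosheaf_def zero_vs_def)
next
  case (Suc m)
  then show ?thesis
    using assms by (auto simp: lifted_cycles_def prev_lift_def prev_degree_def intro!: cell_chains_simps(3)[of _ _ K])
qed

lemma prev_lift_eq_iff:
  assumes "\<eta> \<in> lifted_cycles n K" "\<eta>' \<in> lifted_cycles n K"
  shows "prev_lift n \<eta> = prev_lift n \<eta>' \<longleftrightarrow> null_lift n (\<lambda>\<sigma>. \<eta> \<sigma> - \<eta>' \<sigma>)"
  using assms by (auto simp: lifted_cycles_def prev_lift_def null_lift_def cell_lift_eq_iff split: nat.splits)

lemma prev_lift_chain:
  assumes "subcomplex K" "\<eta> \<in> lifted_cycles n K"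
  shows "prev_lift n \<eta> \<in> carrier (cell_chains K (prev_part n) 1)"
proof -
  have "prev_lift n \<eta> \<in> cell_cycles r K (prev_part n) 1"
    using cell_cycles_1[OF assms(1)] assms(2) by blast
  then show ?thesis
    by (simp add: cell_cycles_def)
qed

lemma submodule_cell_boundaries_1:
  fixes K :: "'i set set"
  assumes K: "subcomplex K"
  shows "submodule (cell_boundaries r K (prev_part n) 1) (kring :: 'k::field ring) (cell_chains K (prev_part n) 1)"
proof -
  interpret module kring "cell_chains K (prev_part n :: ('i, 'k, ('x, 'k) kchain set) cellular_cosheaf) 1"
    by (rule vector_space_cell_chains[OF K vector_space_prev_part])
  show ?thesis
    unfolding cell_boundaries_1[OF K vector_space_prev_part]
    by (rule vector_subspaceI[OF vector_space_cell_chains[OF K vector_space_prev_part]])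
        (use M.zero_closed M.l_zero[OF M.zero_closed] smult_r_null in simp_all)
qed

definition class1 :: "nat \<Rightarrow> 'i set set \<Rightarrow> ('i set \<Rightarrow> ('x, 'k::field) kchain) \<Rightarrow> ('i set \<Rightarrow> ('x, 'k) kchain set) set" where
  "class1 n K \<eta> = cell_boundaries r K (prev_part n) 1 +>\<^bsub>cell_chains K (prev_part n) 1\<^esub> prev_lift n \<eta>"

lemma carrier_cell_homology_1:
  assumes "subcomplex K"
  shows "carrier (cell_homology r K (prev_part n) 1) = class1 n K ` lifted_cycles n K"
  using cell_cycles_1[OF assms, of n] by (auto simp: cell_homology_def class1_def)

lemma class1_add:
  assumes K: "subcomplex K" and \<eta>: "\<eta> \<in> lifted_cycles n K" "\<eta>' \<in> lifted_cycles n K"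
  shows "class1 n K \<eta> \<oplus>\<^bsub>cell_homology r K (prev_part n) 1\<^esub> class1 n K \<eta>' = class1 n K (\<lambda>\<sigma>. \<eta> \<sigma> + \<eta>' \<sigma>)"
  using coset_add[OF vector_space_cell_chains[OF K vector_space_prev_part] submodule_cell_boundaries_1[OF K],
      OF prev_lift_chain[OF K \<eta>(1)] prev_lift_chain[OF K \<eta>(2)]] prev_lift_add[OF \<eta>, of K]
  by (simp add: cell_homology_def class1_def)

lemma class1_smult:
  assumes K: "subcomplex K" and \<eta>: "\<eta> \<in> lifted_cycles n K"
  shows "a \<odot>\<^bsub>cell_homology r K (prev_part n) 1\<^esub> class1 n K \<eta> = class1 n K (\<lambda>\<sigma>. chain_scale a (\<eta> \<sigma>))"
  using coset_smult[OF vector_space_cell_chains[OF K vector_space_prev_part] submodule_cell_boundaries_1[OF K],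
      OF prev_lift_chain[OF K \<eta>], of a] prev_lift_smult[OF \<eta>, of K a]
  by (simp add: cell_homology_def class1_def)

text \<open>The boundaries form the zero subspace, so classes agree only if the underlying cellular
  chains do.\<close>

lemma class1_eq_iff:
  fixes \<eta> \<eta>' :: "'i set \<Rightarrow> ('x, 'k::field) kchain"
  assumes K: "subcomplex K" and \<eta>: "\<eta> \<in> lifted_cycles n K" "\<eta>' \<in> lifted_cycles n K"
  shows "class1 n K \<eta> = class1 n K \<eta>' \<longleftrightarrow> null_lift n (\<lambda>\<sigma>. \<eta> \<sigma> - \<eta>' \<sigma>)"
proof -
  let ?M = "cell_chains K (prev_part n :: ('i, 'k, ('x, 'k) kchain set) cellular_cosheaf) 1"
  interpret module kring ?M
    by (rule vector_space_cell_chains[OF K vector_space_prev_part])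
  have "class1 n K \<eta> = class1 n K \<eta>' \<longleftrightarrow> (\<exists>b\<in>cell_boundaries r K (prev_part n) 1. prev_lift n \<eta> = b \<oplus>\<^bsub>?M\<^esub> prev_lift n \<eta>')"
    unfolding class1_def
    by (rule coset_eq_iff[OF vector_space_cell_chains[OF K vector_space_prev_part] submodule_cell_boundaries_1[OF K]
      prev_lift_chain[OF K \<eta>(1)] prev_lift_chain[OF K \<eta>(2)]])
  also have "\<dots> \<longleftrightarrow> prev_lift n \<eta> = prev_lift n \<eta>'"
    unfolding cell_boundaries_1[OF K vector_space_prev_part]
    using M.l_zero[OF prev_lift_chain[OF K \<eta>(2)]] by simp
  finally show ?thesis
    by (simp add: prev_lift_eq_iff[OF \<eta>])
qed

lemma class1_inclusion:
  fixes \<eta> :: "'i set \<Rightarrow> ('x, 'k::field) kchain"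
  assumes K: "subcomplex K" and K': "subcomplex K'" and sub: "K \<subseteq> K'" and \<eta>: "\<eta> \<in> lifted_cycles n K"
  shows "cell_homology_incl r K' (prev_part n) 1 (class1 n K \<eta>) = class1 n K' \<eta>"
  unfolding cell_homology_incl_def class1_def
proof (rule quot_map_coset[OF vector_space_cell_chains[OF K vector_space_prev_part] submodule_cell_boundaries_1[OF K]
      vector_space_cell_chains[OF K' vector_space_prev_part] submodule_cell_boundaries_1[OF K']])
  show "prev_lift n \<eta> \<in> carrier (cell_chains K (prev_part n) 1)"
    by (rule prev_lift_chain[OF K \<eta>])
  show "prev_lift n \<eta> \<in> carrier (cell_chains K' (prev_part n) 1)"
    by (rule prev_lift_chain[OF K']) (use lifted_cycles_mono[OF sub] \<eta> in blast)
  fix b :: "'i set \<Rightarrow> ('x, 'k) kchain set"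
  assume "b \<in> cell_boundaries r K (prev_part n) 1"
  then show "b \<in> cell_boundaries r K' (prev_part n) 1 \<and>
      b \<oplus>\<^bsub>cell_chains K (prev_part n) 1\<^esub> prev_lift n \<eta> = b \<oplus>\<^bsub>cell_chains K' (prev_part n) 1\<^esub> prev_lift n \<eta>"
    unfolding cell_boundaries_1[OF K vector_space_prev_part] cell_boundaries_1[OF K' vector_space_prev_part]
    by (simp add: cell_chains_def)
qed

end

section \<open>The interleaving\<close>

lemma prod_vs_simps:
  "carrier (prod_vs M N) = carrier M \<times> carrier N"
  "(x, y) \<oplus>\<^bsub>prod_vs M N\<^esub> (x', y') = (x \<oplus>\<^bsub>M\<^esub> x', y \<oplus>\<^bsub>N\<^esub> y')"
  "a \<odot>\<^bsub>prod_vs M N\<^esub> (x, y) = (a \<odot>\<^bsub>M\<^esub> x, a \<odot>\<^bsub>N\<^esub> y)"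
  by (simp_all add: prod_vs_def)

locale total_nerve_cover = nerve_cover X f I U r
  for X :: "'x topology" and f :: "'x \<Rightarrow> 'y" and I :: "'i set" and U :: "'i \<Rightarrow> 'y set" and r :: "'i rel" +
  assumes cover: "\<And>x. x \<in> topspace X \<Longrightarrow> \<exists>i\<in>I. f x \<in> U i"
begin

abbreviation meeting :: "'y set \<Rightarrow> 'i set set" where
  "meeting V \<equiv> meeting_complex I U V"

text \<open>In contrast to \<open>meeting_complex\<close>, the intersection of the two sets of an
  edge may miss \<open>V\<close>. This makes the complex full, so that gluing is invertible over
  it.\<close>

definition meeting_hull :: "'y set \<Rightarrow> 'i set set" where
  "meeting_hull V = {\<sigma>\<in>nerve I U. \<forall>i\<in>\<sigma>. U i \<inter> V \<noteq> {}}"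

text \<open>This is all that the interleaving uses of the metric; with it in place of thickenings,
  the maps and their identities become combinatorial.\<close>

definition star_in :: "'y set \<Rightarrow> 'y set \<Rightarrow> bool" where
  "star_in V V' \<longleftrightarrow> (\<forall>i\<in>I. U i \<inter> V \<noteq> {} \<longrightarrow> U i \<subseteq> V')"

lemma subcomplex_meeting: "subcomplex (meeting V)"
  unfolding subcomplex_def meeting_complex_def nerve_def
  by (auto intro: finite_subset) blast+

lemma full_subcomplex_hull: "full_subcomplex (meeting_hull V)"
  unfolding full_subcomplex_def subcomplex_def meeting_hull_def edges_def simplices_of_dim_def nerve_def
  by (auto intro: finite_subset) blast+

lemma subcomplex_hull: "subcomplex (meeting_hull V)"
  using full_subcomplex_hull by (simp add: full_subcomplex_def)

lemma vertices_hull: "vertices (meeting_hull V) = {i\<in>I. U i \<inter> V \<noteq> {}}"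
  by (auto simp: vertices_def meeting_hull_def nerve_def)

lemma vertices_meeting: "vertices (meeting V) = {i\<in>I. U i \<inter> V \<noteq> {}}"
  by (auto simp: vertices_def meeting_complex_def nerve_def)

lemma meeting_mono: "V \<subseteq> W \<Longrightarrow> meeting V \<subseteq> meeting W"
  by (auto simp: meeting_complex_def)

lemma hull_mono: "V \<subseteq> W \<Longrightarrow> meeting_hull V \<subseteq> meeting_hull W"
  by (auto simp: meeting_hull_def)

lemma covered_meeting: "star_in V V' \<Longrightarrow> covered (meeting V) \<subseteq> V'"
  by (auto simp: vertices_meeting star_in_def)

lemma covered_hull: "star_in V V' \<Longrightarrow> covered (meeting_hull V) \<subseteq> V'"
  by (auto simp: vertices_hull star_in_def)

lemma star_in_trans: "star_in V V' \<Longrightarrow> star_in V' V'' \<Longrightarrow> star_in V V''"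
  unfolding star_in_def by blast

text \<open>Covering the image of \<open>f\<close> allows a singular cycle over \<open>V\<close> to
  be regarded as a cycle over the union of the sets that meet \<open>V\<close>.\<close>

lemma in_covered_hull: "x \<in> topspace X \<Longrightarrow> f x \<in> V \<Longrightarrow> f x \<in> covered (meeting_hull V)"
  using cover[of x] by (auto simp: vertices_hull)

lemma in_star: "star_in V V' \<Longrightarrow> x \<in> topspace X \<Longrightarrow> f x \<in> V \<Longrightarrow> f x \<in> V'"
  using in_covered_hull covered_hull by blast

lemma meeting_subset_hull:
  assumes "star_in V V'" shows "meeting V \<subseteq> meeting_hull V'"
proof
  fix \<sigma> assume \<sigma>: "\<sigma> \<in> meeting V"
  have "U i \<inter> V' \<noteq> {}" if "i \<in> \<sigma>" for i
  proof -
    have "i \<in> I" "U i \<inter> V \<noteq> {}"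
      using \<sigma> that by (auto simp: meeting_complex_def nerve_def)
    then show ?thesis
      using assms unfolding star_in_def by blast
  qed
  then show "\<sigma> \<in> meeting_hull V'"
    using \<sigma> by (simp add: meeting_hull_def meeting_complex_def)
qed

text \<open>This is where passing from a set to its star repairs the edges missing in the meeting complex.\<close>

lemma hull_subset_meeting:
  assumes "star_in V V'" shows "meeting_hull V \<subseteq> meeting V'"
proof
  fix \<sigma> assume \<sigma>: "\<sigma> \<in> meeting_hull V"
  then obtain i where i: "i \<in> \<sigma>"
    by (auto simp: meeting_hull_def nerve_def)
  then have "U i \<subseteq> V'"
    using \<sigma> assms unfolding meeting_hull_def nerve_def star_in_def by blast
  then have "UU \<sigma> \<subseteq> V'"
    using i by blast
  moreover have "\<sigma> \<in> nerve I U" "UU \<sigma> \<noteq> {}"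
    using \<sigma> by (auto simp: meeting_hull_def nerve_def)
  ultimately show "\<sigma> \<in> meeting V'"
    by (auto simp: meeting_complex_def)
qed

definition cell_class :: "nat \<Rightarrow> 'y set \<Rightarrow> ('i set \<Rightarrow> ('x, 'k::field) kchain) \<Rightarrow> ('i set \<Rightarrow> ('x, 'k) kchain)
    \<Rightarrow> ('i set \<Rightarrow> ('x, 'k) kchain set) set \<times> ('i set \<Rightarrow> ('x, 'k) kchain set) set" where
  "cell_class n V \<xi> \<eta> = (class0 n (meeting V) \<xi>, class1 n (meeting V) \<eta>)"

abbreviation extension :: "('y, 'k::field, ('i set \<Rightarrow> ('x, 'k) kchain set) set \<times> ('i set \<Rightarrow> ('x, 'k) kchain set) set) precosheaf" where
  "extension \<equiv> continuous_extension r I U leray_part"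

abbreviation Leray :: "('y, 'k::field, ('x, 'k) kchain set) precosheaf" where
  "Leray \<equiv> leray TYPE('k) X f"

lemma Leray_ob: "ob Leray V n = sing_homology n (P V)"
  by (simp add: leray_def)

lemma carrier_Leray: "carrier (ob Leray V n) = hclass n (P V) ` sing_cycles n (P V)"
  by (simp add: Leray_ob carrier_sing_homology)

lemma Leray_mor:
  assumes "z \<in> sing_cycles n (P V)" "\<And>x. x \<in> topspace X \<Longrightarrow> f x \<in> V \<Longrightarrow> f x \<in> W"
  shows "mor Leray V W n (hclass n (P V) z) = hclass n (P W) z"
  using assms by (simp add: leray_def sing_homology_map_inclusion singular_simplex_preimage_mono)

lemma extension_ob:
  "ob extension V n = prod_vs (cell_homology r (meeting V) (leray_part n) 0) (cell_homology r (meeting V) (prev_part n) 1)"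
  by (simp add: continuous_extension_def)

lemma extensionE:
  assumes "w \<in> carrier (ob extension V n)"
  obtains \<xi> \<eta> where "\<xi> \<in> lifts n (meeting V) 0" "\<eta> \<in> lifted_cycles n (meeting V)" "w = cell_class n V \<xi> \<eta>"
  using assms unfolding extension_ob prod_vs_simps carrier_cell_homology_0[OF subcomplex_meeting]
    carrier_cell_homology_1[OF subcomplex_meeting] cell_class_def by blast

lemma extension_mor:
  assumes "\<xi> \<in> lifts n (meeting V) 0" "\<eta> \<in> lifted_cycles n (meeting V)" "meeting V \<subseteq> meeting W"
  shows "mor extension V W n (cell_class n V \<xi> \<eta>) = cell_class n W \<xi> \<eta>"
  using class0_inclusion[OF subcomplex_meeting subcomplex_meeting assms(3,1)]
    class1_inclusion[OF subcomplex_meeting subcomplex_meeting assms(3,2)]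
  by (simp add: continuous_extension_def cell_class_def)

lemma cell_class_closed:
  assumes "\<xi> \<in> lifts n (meeting V) 0" "\<eta> \<in> lifted_cycles n (meeting V)"
  shows "cell_class n V \<xi> \<eta> \<in> carrier (ob extension V n)"
  using assms unfolding extension_ob prod_vs_simps carrier_cell_homology_0[OF subcomplex_meeting]
    carrier_cell_homology_1[OF subcomplex_meeting] cell_class_def by blast

lemma cell_class_add:
  assumes "\<xi> \<in> lifts n (meeting V) 0" "\<eta> \<in> lifted_cycles n (meeting V)"
    "\<xi>' \<in> lifts n (meeting V) 0" "\<eta>' \<in> lifted_cycles n (meeting V)"
  shows "cell_class n V \<xi> \<eta> \<oplus>\<^bsub>ob extension V n\<^esub> cell_class n V \<xi>' \<eta>'
    = cell_class n V (\<lambda>\<sigma>. \<xi> \<sigma> + \<xi>' \<sigma>) (\<lambda>\<sigma>. \<eta> \<sigma> + \<eta>' \<sigma>)"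
  using class0_add[OF subcomplex_meeting assms(1,3)] class1_add[OF subcomplex_meeting assms(2,4)]
  by (simp add: extension_ob prod_vs_simps cell_class_def)

lemma cell_class_smult:
  assumes "\<xi> \<in> lifts n (meeting V) 0" "\<eta> \<in> lifted_cycles n (meeting V)"
  shows "a \<odot>\<^bsub>ob extension V n\<^esub> cell_class n V \<xi> \<eta>
    = cell_class n V (\<lambda>\<sigma>. chain_scale a (\<xi> \<sigma>)) (\<lambda>\<sigma>. chain_scale a (\<eta> \<sigma>))"
  using class0_smult[OF subcomplex_meeting assms(1)] class1_smult[OF subcomplex_meeting assms(2)]
  by (simp add: extension_ob prod_vs_simps cell_class_def)

section \<open>The two interleaving maps\<close>

definition to_leray where
  "to_leray n V V' w = (SOME \<zeta>. \<exists>\<xi>\<in>lifts n (meeting V) 0. \<exists>\<eta>\<in>lifted_cycles n (meeting V).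
     w = cell_class n V \<xi> \<eta> \<and> \<zeta> = hclass n (P V') (glue n \<xi> \<eta>))"

text \<open>A class over \<open>V\<close> is moved into the union of the sets meeting
  \<open>V\<close>, decomposed by inverting the gluing over the hull, and the resulting lifts are
  read in the larger complex \<open>meeting V'\<close>. Independence of the choices is
  \<open>from_leray_hclass\<close>.\<close>

definition from_leray where
  "from_leray n V V' \<zeta> = (SOME w. \<exists>\<xi>\<in>lifts n (meeting_hull V) 0. \<exists>\<eta>\<in>lifted_cycles n (meeting_hull V).
     \<exists>z\<in>sing_cycles n (P V). \<zeta> = hclass n (P V) z \<and>
       glue n \<xi> \<eta> - z \<in> sing_boundaries n (P (covered (meeting_hull V))) \<and> w = cell_class n V' \<xi> \<eta>)"

lemma glue_in_cycles:
  assumes "star_in V V'" "\<xi> \<in> lifts n (meeting V) 0" "\<eta> \<in> lifted_cycles n (meeting V)"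
  shows "glue n \<xi> \<eta> \<in> sing_cycles n (P V')"
  using glue_cycle[OF subcomplex_meeting assms(2,3)]
  by (rule sing_cycles_preimage_mono) (use covered_meeting[OF assms(1)] in blast)

text \<open>Two representations of one class differ by a pair to which \<open>glue_null\<close>
  applies, and the sets meeting \<open>V\<close> lie in \<open>V'\<close>.\<close>

lemma to_leray_cell_class:
  fixes \<xi> \<eta> :: "'i set \<Rightarrow> ('x, 'k::field) kchain"
  assumes star: "star_in V V'" and \<xi>: "\<xi> \<in> lifts n (meeting V) 0" and \<eta>: "\<eta> \<in> lifted_cycles n (meeting V)"
  shows "to_leray n V V' (cell_class n V \<xi> \<eta>) = hclass n (P V') (glue n \<xi> \<eta>)"
  unfolding to_leray_def
proof (rule some_equality)
  fix \<zeta> assume "\<exists>\<xi>'\<in>lifts n (meeting V) 0. \<exists>\<eta>'\<in>lifted_cycles n (meeting V).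
     cell_class n V \<xi> \<eta> = cell_class n V \<xi>' \<eta>' \<and> \<zeta> = hclass n (P V') (glue n \<xi>' \<eta>')"
  then obtain \<xi>' \<eta>' where \<xi>': "\<xi>' \<in> lifts n (meeting V) 0" and \<eta>': "\<eta>' \<in> lifted_cycles n (meeting V)"
    and eq: "class0 n (meeting V) \<xi>' = class0 n (meeting V) \<xi>" "class1 n (meeting V) \<eta>' = class1 n (meeting V) \<eta>"
    and \<zeta>: "\<zeta> = hclass n (P V') (glue n \<xi>' \<eta>')"
    unfolding cell_class_def by auto
  obtain \<theta> where \<theta>: "\<theta> \<in> lifts n (meeting V) 1"
    "\<And>i. i \<in> vertices (meeting V) \<Longrightarrow> \<xi>' {i} - \<xi> {i} - \<delta> \<theta> i \<in> sing_boundaries n (P (U i))"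
    using eq(1) class0_eq_iff[OF subcomplex_meeting \<xi>' \<xi>] by blast
  have "glue n (\<lambda>\<sigma>. \<xi>' \<sigma> - \<xi> \<sigma>) (\<lambda>\<sigma>. \<eta>' \<sigma> - \<eta> \<sigma>) \<in> sing_boundaries n (P (covered (meeting V)))"
    using eq(2) class1_eq_iff[OF subcomplex_meeting \<eta>' \<eta>]
    by (intro glue_null[OF subcomplex_meeting lifts_diff[OF \<xi>' \<xi>] _ \<theta>]) auto
  then have "glue n \<xi>' \<eta>' - glue n \<xi> \<eta> \<in> sing_boundaries n (P V')"
    unfolding glue_diff by (rule sing_boundaries_preimage_mono) (use covered_meeting[OF star] in blast)
  then show "\<zeta> = hclass n (P V') (glue n \<xi> \<eta>)"
    unfolding \<zeta> by (subst hclass_eq_iff) (rule glue_in_cycles[OF star] \<xi> \<eta> \<xi>' \<eta>' | assumption)+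
qed (use \<xi> \<eta> in blast)

lemma hull_lifts_meeting:
  assumes "star_in V V'"
  shows "\<xi> \<in> lifts n (meeting_hull V) p \<Longrightarrow> \<xi> \<in> lifts n (meeting V') p"
    and "\<eta> \<in> lifted_cycles n (meeting_hull V) \<Longrightarrow> \<eta> \<in> lifted_cycles n (meeting V')"
  using lifts_mono[OF hull_subset_meeting[OF assms]] lifted_cycles_mono[OF hull_subset_meeting[OF assms]] by blast+

text \<open>The difference of two admissible decompositions glues to a boundary, so
  \<open>glue_injective\<close> identifies their classes over the hull, and hence also their images
  over \<open>meeting V'\<close>.\<close>

lemma from_leray_hclass:
  fixes \<xi> \<eta> :: "'i set \<Rightarrow> ('x, 'k::field) kchain"
  assumes star: "star_in V V'" and \<xi>: "\<xi> \<in> lifts n (meeting_hull V) 0" and \<eta>: "\<eta> \<in> lifted_cycles n (meeting_hull V)"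
    and z: "z \<in> sing_cycles n (P V)" and glue: "glue n \<xi> \<eta> - z \<in> sing_boundaries n (P (covered (meeting_hull V)))"
  shows "from_leray n V V' (hclass n (P V) z) = cell_class n V' \<xi> \<eta>"
  unfolding from_leray_def
proof (rule some_equality)
  let ?K = "meeting_hull V"
  fix w assume "\<exists>\<xi>'\<in>lifts n ?K 0. \<exists>\<eta>'\<in>lifted_cycles n ?K. \<exists>z'\<in>sing_cycles n (P V). hclass n (P V) z = hclass n (P V) z' \<and>
       glue n \<xi>' \<eta>' - z' \<in> sing_boundaries n (P (covered ?K)) \<and> w = cell_class n V' \<xi>' \<eta>'"
  then obtain \<xi>' \<eta>' z' where \<xi>': "\<xi>' \<in> lifts n ?K 0" and \<eta>': "\<eta>' \<in> lifted_cycles n ?K"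
    and z': "z' \<in> sing_cycles n (P V)" "hclass n (P V) z = hclass n (P V) z'"
    and glue': "glue n \<xi>' \<eta>' - z' \<in> sing_boundaries n (P (covered ?K))" and w: "w = cell_class n V' \<xi>' \<eta>'"
    by blast
  have "z - z' \<in> sing_boundaries n (P V)"
    using z'(2) hclass_eq_iff[OF z z'(1)] by simp
  then have zz: "z - z' \<in> sing_boundaries n (P (covered ?K))"
    by (rule sing_boundaries_preimage_mono) (rule in_covered_hull)
  have "glue n (\<lambda>\<sigma>. \<xi>' \<sigma> - \<xi> \<sigma>) (\<lambda>\<sigma>. \<eta>' \<sigma> - \<eta> \<sigma>) = (glue n \<xi>' \<eta>' - z') - (glue n \<xi> \<eta> - z) - (z - z')"
    unfolding glue_diff by simp
  also have "\<dots> \<in> sing_boundaries n (P (covered ?K))"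
    by (intro sing_boundaries_diff glue glue' zz)
  finally have "null_lift n (\<lambda>\<sigma>. \<eta>' \<sigma> - \<eta> \<sigma>) \<and>
      (\<exists>\<theta>\<in>lifts n ?K 1. \<forall>i\<in>vertices ?K. \<xi>' {i} - \<xi> {i} - \<delta> \<theta> i \<in> sing_boundaries n (P (U i)))"
    by (rule glue_injective[OF full_subcomplex_hull lifts_diff[OF \<xi>' \<xi>] lifted_cycles_diff[OF \<eta>' \<eta>]])
  then have "class0 n ?K \<xi>' = class0 n ?K \<xi>" "class1 n ?K \<eta>' = class1 n ?K \<eta>"
    using class0_eq_iff[OF subcomplex_hull \<xi>' \<xi>] class1_eq_iff[OF subcomplex_hull \<eta>' \<eta>] by blast+
  then show "w = cell_class n V' \<xi> \<eta>"
    unfolding w cell_class_def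
    using class0_inclusion[OF subcomplex_hull subcomplex_meeting hull_subset_meeting[OF star]]
      class1_inclusion[OF subcomplex_hull subcomplex_meeting hull_subset_meeting[OF star]] \<xi> \<xi>' \<eta> \<eta>'
    by metis
qed (use \<xi> \<eta> z glue in blast)

text \<open>A decomposition exists because gluing over the hull is surjective on homology.\<close>

lemma from_lerayE:
  fixes z :: "('x, 'k::field) kchain"
  assumes star: "star_in V V'" and z: "z \<in> sing_cycles n (P V)"
  obtains \<xi> \<eta> where "\<xi> \<in> lifts n (meeting_hull V) 0" "\<eta> \<in> lifted_cycles n (meeting_hull V)"
    "glue n \<xi> \<eta> - z \<in> sing_boundaries n (P (covered (meeting_hull V)))"
    "from_leray n V V' (hclass n (P V) z) = cell_class n V' \<xi> \<eta>"
proof -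
  have "z \<in> sing_cycles n (P (covered (meeting_hull V)))"
    using z by (rule sing_cycles_preimage_mono) (rule in_covered_hull)
  then obtain \<xi> \<eta> where *: "\<xi> \<in> lifts n (meeting_hull V) 0" "\<eta> \<in> lifted_cycles n (meeting_hull V)"
    "glue n \<xi> \<eta> - z \<in> sing_boundaries n (P (covered (meeting_hull V)))"
    by (rule glue_surjective[OF full_subcomplex_hull])
  from * from_leray_hclass[OF star *(1,2) z *(3)] show ?thesis
    by (rule that)
qed

lemma to_leray_linear:
  assumes star: "star_in V V'"
  shows "to_leray n V V' \<in> linear_maps (ob extension V n) (ob (Leray :: ('y, 'k::field, ('x, 'k) kchain set) precosheaf) V' n)"
  unfolding linear_maps_def
proof (intro CollectI conjI ballI allI)
  show "to_leray n V V' \<in> carrier (ob extension V n) \<rightarrow> carrier (ob Leray V' n)"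
    by (auto simp: to_leray_cell_class[OF star] Leray_ob intro!: hclass_closed glue_in_cycles[OF star] elim!: extensionE)
next
  fix x y :: "('i set \<Rightarrow> ('x, 'k) kchain set) set \<times> ('i set \<Rightarrow> ('x, 'k) kchain set) set"
  assume "x \<in> carrier (ob extension V n)" "y \<in> carrier (ob extension V n)"
  then show "to_leray n V V' (x \<oplus>\<^bsub>ob extension V n\<^esub> y) = to_leray n V V' x \<oplus>\<^bsub>ob Leray V' n\<^esub> to_leray n V V' y"
    by (auto simp: to_leray_cell_class[OF star] cell_class_add lifts_add lifted_cycles_add Leray_ob
      add_hclass glue_in_cycles[OF star] glue_add elim!: extensionE)
next
  fix a :: 'k and x :: "('i set \<Rightarrow> ('x, 'k) kchain set) set \<times> ('i set \<Rightarrow> ('x, 'k) kchain set) set"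
  assume "x \<in> carrier (ob extension V n)"
  then show "to_leray n V V' (a \<odot>\<^bsub>ob extension V n\<^esub> x) = a \<odot>\<^bsub>ob Leray V' n\<^esub> to_leray n V V' x"
    by (auto simp: to_leray_cell_class[OF star] cell_class_smult lifts_scale lifted_cycles_scale Leray_ob
      smult_hclass glue_in_cycles[OF star] glue_scale elim!: extensionE)
qed

text \<open>Sums and multiples of admissible decompositions are admissible, so linearity follows
  from the independence of choices.\<close>

lemma from_leray_linear:
  assumes star: "star_in V V'"
  shows "from_leray n V V' \<in> linear_maps (ob (Leray :: ('y, 'k::field, ('x, 'k) kchain set) precosheaf) V n) (ob extension V' n)"
proof -
  note hm = hull_lifts_meeting[OF star]
  have represent: "\<exists>z\<in>sing_cycles n (P V). x = hclass n (P V) z \<and>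
      (\<exists>\<xi>\<in>lifts n (meeting_hull V) 0. \<exists>\<eta>\<in>lifted_cycles n (meeting_hull V).
        glue n \<xi> \<eta> - z \<in> sing_boundaries n (P (covered (meeting_hull V))) \<and>
        from_leray n V V' x = cell_class n V' \<xi> \<eta>)"
    if x: "x \<in> carrier (ob Leray V n)" for x :: "('x, 'k) kchain set"
  proof -
    obtain z where z: "z \<in> sing_cycles n (P V)" "x = hclass n (P V) z"
      using x unfolding carrier_Leray by blast
    then show ?thesis
      by (metis (no_types) from_lerayE[OF star z(1)])
  qed
  have closed: "from_leray n V V' \<in> carrier (ob (Leray :: ('y, 'k, ('x, 'k) kchain set) precosheaf) V n) \<rightarrow> carrier (ob extension V' n)"
  proof
    fix x :: "('x, 'k) kchain set" assume "x \<in> carrier (ob Leray V n)"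
    from represent[OF this] show "from_leray n V V' x \<in> carrier (ob extension V' n)"
      using hm cell_class_closed by metis
  qed
  have smult: "from_leray n V V' (a \<odot>\<^bsub>ob Leray V n\<^esub> x) = a \<odot>\<^bsub>ob extension V' n\<^esub> from_leray n V V' x"
    if x: "x \<in> carrier (ob Leray V n)" for a :: 'k and x
  proof -
    obtain z \<xi> \<eta> where z: "z \<in> sing_cycles n (P V)" "x = hclass n (P V) z"
      and e: "\<xi> \<in> lifts n (meeting_hull V) 0" "\<eta> \<in> lifted_cycles n (meeting_hull V)"
      "glue n \<xi> \<eta> - z \<in> sing_boundaries n (P (covered (meeting_hull V)))"
      "from_leray n V V' x = cell_class n V' \<xi> \<eta>"
      using represent[OF x] by blast
    have "chain_scale a (glue n \<xi> \<eta>) - chain_scale a z \<in> sing_boundaries n (P (covered (meeting_hull V)))"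
      using sing_boundaries_scale[OF e(3), of a] by (simp add: kch.scale_right_diff_distrib)
    then have "from_leray n V V' (hclass n (P V) (chain_scale a z))
        = cell_class n V' (\<lambda>\<sigma>. chain_scale a (\<xi> \<sigma>)) (\<lambda>\<sigma>. chain_scale a (\<eta> \<sigma>))"
      by (intro from_leray_hclass[OF star] lifts_scale lifted_cycles_scale sing_cycles_scale e z) (simp add: glue_scale)
    then show ?thesis
      using e(4) by (simp add: Leray_ob z(2) smult_hclass z(1) cell_class_smult hm e(1,2))
  qed
  have add: "from_leray n V V' (x \<oplus>\<^bsub>ob Leray V n\<^esub> y)
      = from_leray n V V' x \<oplus>\<^bsub>ob extension V' n\<^esub> from_leray n V V' y"
    if x: "x \<in> carrier (ob Leray V n)" and y: "y \<in> carrier (ob Leray V n)" for x y :: "('x, 'k) kchain set"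
  proof -
    obtain z \<xi> \<eta> where z: "z \<in> sing_cycles n (P V)" "x = hclass n (P V) z"
      and e: "\<xi> \<in> lifts n (meeting_hull V) 0" "\<eta> \<in> lifted_cycles n (meeting_hull V)"
      "glue n \<xi> \<eta> - z \<in> sing_boundaries n (P (covered (meeting_hull V)))"
      "from_leray n V V' x = cell_class n V' \<xi> \<eta>"
      using represent[OF x] by blast
    obtain z' \<xi>' \<eta>' where z': "z' \<in> sing_cycles n (P V)" "y = hclass n (P V) z'"
      and e': "\<xi>' \<in> lifts n (meeting_hull V) 0" "\<eta>' \<in> lifted_cycles n (meeting_hull V)"
      "glue n \<xi>' \<eta>' - z' \<in> sing_boundaries n (P (covered (meeting_hull V)))"
      "from_leray n V V' y = cell_class n V' \<xi>' \<eta>'"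
      using represent[OF y] by blast
    have "glue n \<xi> \<eta> + glue n \<xi>' \<eta>' - (z + z') \<in> sing_boundaries n (P (covered (meeting_hull V)))"
      using sing_boundaries_add[OF e(3) e'(3)] by (simp add: algebra_simps)
    then have "from_leray n V V' (hclass n (P V) (z + z')) = cell_class n V' (\<lambda>\<sigma>. \<xi> \<sigma> + \<xi>' \<sigma>) (\<lambda>\<sigma>. \<eta> \<sigma> + \<eta>' \<sigma>)"
      by (intro from_leray_hclass[OF star] lifts_add lifted_cycles_add sing_cycles_add e e' z z') (simp add: glue_add)
    then show ?thesis
      unfolding e(4) e'(4)
      by (simp add: Leray_ob z(2) z'(2) add_hclass z(1) z'(1) cell_class_add hm e(1,2) e'(1,2))
  qed
  show ?thesis
    unfolding linear_maps_def by (intro CollectI conjI ballI allI closed add smult)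
qed

text \<open>Both sides are the class of the same chain \<open>glue n \<xi> \<eta>\<close>, whose
  formula involves neither \<open>V\<close> nor \<open>W\<close>.\<close>

lemma to_leray_natural:
  assumes star: "star_in V V'" "star_in W W'" and sub: "V \<subseteq> W" "V' \<subseteq> W'" and x: "x \<in> carrier (ob extension V n)"
  shows "to_leray n W W' (mor extension V W n x) = mor Leray V' W' n (to_leray n V V' x)"
proof -
  obtain \<xi> \<eta> where e: "\<xi> \<in> lifts n (meeting V) 0" "\<eta> \<in> lifted_cycles n (meeting V)" "x = cell_class n V \<xi> \<eta>"
    using x by (rule extensionE)
  have "mor Leray V' W' n (to_leray n V V' x) = hclass n (P W') (glue n \<xi> \<eta>)"
    unfolding e(3) to_leray_cell_class[OF star(1) e(1,2)]
    by (rule Leray_mor[OF glue_in_cycles[OF star(1) e(1,2)]]) (use sub(2) in blast)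
  moreover have "to_leray n W W' (cell_class n W \<xi> \<eta>) = hclass n (P W') (glue n \<xi> \<eta>)"
    using e(1,2) lifts_mono[OF meeting_mono[OF sub(1)]] lifted_cycles_mono[OF meeting_mono[OF sub(1)]]
    by (intro to_leray_cell_class[OF star(2)]) blast+
  ultimately show ?thesis
    using extension_mor[OF e(1,2) meeting_mono[OF sub(1)]] e(3) by simp
qed

text \<open>A decomposition over the hull of \<open>V\<close> is also an admissible one over the
  hull of \<open>W\<close>.\<close>

lemma from_leray_natural:
  assumes star: "star_in V V'" "star_in W W'" and sub: "V \<subseteq> W" "V' \<subseteq> W'" and x: "x \<in> carrier (ob Leray V n)"
  shows "from_leray n W W' (mor Leray V W n x) = mor extension V' W' n (from_leray n V V' x)"
proof -
  obtain z where z: "z \<in> sing_cycles n (P V)" "x = hclass n (P V) z"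
    using x unfolding carrier_Leray by blast
  obtain \<xi> \<eta> where e: "\<xi> \<in> lifts n (meeting_hull V) 0" "\<eta> \<in> lifted_cycles n (meeting_hull V)"
    "glue n \<xi> \<eta> - z \<in> sing_boundaries n (P (covered (meeting_hull V)))"
    "from_leray n V V' x = cell_class n V' \<xi> \<eta>"
    unfolding z(2) by (rule from_lerayE[OF star(1) z(1)])
  have zW: "z \<in> sing_cycles n (P W)"
    using z(1) by (rule sing_cycles_preimage_mono) (use sub in blast)
  have "glue n \<xi> \<eta> - z \<in> sing_boundaries n (P (covered (meeting_hull W)))"
    using e(3) by (rule sing_boundaries_preimage_mono) (use sub(1) in \<open>auto simp: vertices_hull\<close>)
  then have "from_leray n W W' (hclass n (P W) z) = cell_class n W' \<xi> \<eta>"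
    using e(1,2) lifts_mono[OF hull_mono[OF sub(1)]] lifted_cycles_mono[OF hull_mono[OF sub(1)]] zW
    by (intro from_leray_hclass[OF star(2)]) blast+
  moreover have "mor Leray V W n x = hclass n (P W) z"
    unfolding z(2) by (rule Leray_mor[OF z(1)]) (use sub in blast)
  moreover have "mor extension V' W' n (cell_class n V' \<xi> \<eta>) = cell_class n W' \<xi> \<eta>"
    using e(1,2) by (intro extension_mor hull_lifts_meeting[OF star(1)] meeting_mono sub(2))
  ultimately show ?thesis
    using e(4) by simp
qed

text \<open>Since \<open>meeting V\<close> lies in the hull of \<open>V'\<close>, the given lifts
  are themselves an admissible decomposition of the class to which they glue.\<close>

lemma from_leray_to_leray:
  assumes star: "star_in V V'" "star_in V' V''" and x: "x \<in> carrier (ob extension V n)"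
  shows "from_leray n V' V'' (to_leray n V V' x) = mor extension V V'' n x"
proof -
  obtain \<xi> \<eta> where e: "\<xi> \<in> lifts n (meeting V) 0" "\<eta> \<in> lifted_cycles n (meeting V)" "x = cell_class n V \<xi> \<eta>"
    using x by (rule extensionE)
  note sub = meeting_subset_hull[OF star(1)]
  have "from_leray n V' V'' (hclass n (P V') (glue n \<xi> \<eta>)) = cell_class n V'' \<xi> \<eta>"
  proof (rule from_leray_hclass[OF star(2)])
    show "\<xi> \<in> lifts n (meeting_hull V') 0" "\<eta> \<in> lifted_cycles n (meeting_hull V')"
      using e(1,2) lifts_mono[OF sub] lifted_cycles_mono[OF sub] by blast+
    show "glue n \<xi> \<eta> \<in> sing_cycles n (P V')"
      by (rule glue_in_cycles[OF star(1) e(1,2)])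
  \<comment> \<open>With \<open>z\<close> taken to be the glued cycle, the difference required to be
    a boundary is 0.\<close>
  qed (simp add: sing_boundaries_0)
  then show ?thesis
    using extension_mor[OF e(1,2) order_trans[OF sub hull_subset_meeting[OF star(2)]]]
    by (simp add: e(3) to_leray_cell_class[OF star(1) e(1,2)])
qed

text \<open>The glued cycle is homologous to \<open>z\<close> within the union of the sets meeting
  \<open>V\<close>, and this union lies in \<open>V''\<close> by composing the two star
  relations.\<close>

lemma to_leray_from_leray:
  assumes star: "star_in V V'" "star_in V' V''" and x: "x \<in> carrier (ob Leray V n)"
  shows "to_leray n V' V'' (from_leray n V V' x) = mor Leray V V'' n x"
proof -
  note star' = star_in_trans[OF star]
  obtain z where z: "z \<in> sing_cycles n (P V)" "x = hclass n (P V) z"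
    using x unfolding carrier_Leray by blast
  obtain \<xi> \<eta> where e: "\<xi> \<in> lifts n (meeting_hull V) 0" "\<eta> \<in> lifted_cycles n (meeting_hull V)"
    "glue n \<xi> \<eta> - z \<in> sing_boundaries n (P (covered (meeting_hull V)))"
    "from_leray n V V' x = cell_class n V' \<xi> \<eta>"
    unfolding z(2) by (rule from_lerayE[OF star(1) z(1)])
  note hm = hull_lifts_meeting(1)[OF star(1) e(1)] hull_lifts_meeting(2)[OF star(1) e(2)]
  have zV: "z \<in> sing_cycles n (P V'')"
    using z(1) by (rule sing_cycles_preimage_mono) (rule in_star[OF star'])
  have "glue n \<xi> \<eta> - z \<in> sing_boundaries n (P V'')"
    using e(3) by (rule sing_boundaries_preimage_mono) (use covered_hull[OF star'] in blast)
  then have "hclass n (P V'') (glue n \<xi> \<eta>) = hclass n (P V'') z"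
    using hclass_eq_iff[OF glue_in_cycles[OF star(2) hm] zV] by simp
  moreover have "mor Leray V V'' n x = hclass n (P V'') z"
    unfolding z(2) by (rule Leray_mor[OF z(1)]) (rule in_star[OF star'])
  ultimately show ?thesis
    using to_leray_cell_class[OF star(2) hm] by (simp add: e(4))
qed

end

section \<open>Thickenings and the resolution in a metric space\<close>

lemma (in Metric_space) mem_thickening:
  assumes "0 < \<epsilon>"
  shows "y \<in> thickening M d \<epsilon> V \<longleftrightarrow> y \<in> M \<and> (\<exists>v\<in>V. d y v < \<epsilon>)"
  using assms by (simp add: thickening_def INF_less_iff ennreal_less_iff)

lemma (in Metric_space) thickening_mono:
  assumes "V \<subseteq> W" shows "thickening M d a V \<subseteq> thickening M d a W"
proof -
  have "(INF v\<in>W. ennreal (d y v)) \<le> (INF v\<in>V. ennreal (d y v))" for y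
    by (rule INF_superset_mono[OF assms]) simp
  then show ?thesis
    using assms by (auto simp: thickening_def intro: le_less_trans)
qed

lemma (in Metric_space) thickening_increasing:
  assumes "V \<subseteq> M" "0 \<le> a" "a \<le> b" shows "thickening M d a V \<subseteq> thickening M d b V"
proof (cases "a = 0")
  case True
  show ?thesis
  proof (cases "b = 0")
    case False
    \<comment> \<open>The unthickened set lies in every thickening of positive radius, since its
      points have distance 0 from themselves.\<close>
    then have "0 < b" using assms by simp
    then show ?thesis
      using assms(1) True by (force simp: mem_thickening thickening_def[of _ _ 0])
  qed (simp add: True)
next
  case False
  then show ?thesis
    using assms by (force simp: mem_thickening)
qed

lemma (in Metric_space) dist_less_of_resolution:
  assumes "resolution I U d < ennreal \<epsilon>" "i \<in> I" "x \<in> U i" "y \<in> U i"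
  shows "d x y < \<epsilon>"
proof -
  have "ennreal (d x y) \<le> resolution I U d"
    unfolding resolution_def using assms(2-4) by (blast intro: SUP_upper2 order_refl)
  then have "ennreal (d x y) < ennreal \<epsilon>"
    using assms(1) by (rule le_less_trans)
  then show ?thesis
    by (simp add: ennreal_less_iff)
qed

text \<open>If \<open>U i\<close> meets the \<open>a\<close>-thickening in \<open>p\<close>, every
  \<open>u\<close> in \<open>U i\<close> is closer than \<open>\<epsilon>\<close> to
  \<open>p\<close>, and the triangle inequality adds this to the distance from \<open>p\<close> to
  \<open>V\<close>. The case \<open>a = 0\<close> is separate because the 0-thickening is
  \<open>V\<close> itself and not given by a strict inequality.\<close>

lemma (in Metric_space) star_in_thickening:
  assumes nc: "total_nerve_cover X f I U r" and res: "resolution I U d < ennreal \<epsilon>" and "0 < \<epsilon>"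
    and U: "\<And>i. i \<in> I \<Longrightarrow> U i \<subseteq> M" and V: "V \<subseteq> M" and "0 \<le> a"
  shows "total_nerve_cover.star_in I U (thickening M d a V) (thickening M d (a + \<epsilon>) V)"
  unfolding total_nerve_cover.star_in_def[OF nc]
proof (intro ballI impI subsetI)
  fix i u assume i: "i \<in> I" and "U i \<inter> thickening M d a V \<noteq> {}" and u: "u \<in> U i"
  then obtain p where p: "p \<in> U i" "p \<in> thickening M d a V" by blast
  have up: "d u p < \<epsilon>"
    by (rule dist_less_of_resolution[OF res i u p(1)])
  have M: "u \<in> M" "p \<in> M"
    using u p U[OF i] by auto
  have "\<exists>v\<in>V. d u v < a + \<epsilon>"
  proof (cases "a = 0")
    case True
    then show ?thesis
      using p up by (auto simp: thickening_def)
  next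
    case False
    then obtain v where v: "v \<in> V" "d p v < a"
      using p(2) \<open>0 \<le> a\<close> by (auto simp: mem_thickening)
    then have "d u v \<le> d u p + d p v"
      using triangle M V by blast
    then show ?thesis
      using v up by force
  qed
  then show "u \<in> thickening M d (a + \<epsilon>) V"
    using M(1) \<open>0 \<le> a\<close> \<open>0 < \<epsilon>\<close> by (simp add: mem_thickening)
qed

text \<open>Every condition is an instance of a statement about stars. Compatibility with
  \<open>a \<le> b\<close> is naturality for the inclusion of one thickening of \<open>V\<close>
  into another, and the round trips use the thickenings by \<open>a\<close>,
  \<open>a + \<epsilon>\<close> and \<open>a + 2 * \<epsilon>\<close>.\<close>

lemma (in Metric_space) interleaving_of_total_nerve_cover:
  fixes X :: "'x topology" and I :: "'i set" and r :: "'i rel"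
  assumes nc: "total_nerve_cover X f I U r" and res: "resolution I U d < ennreal \<epsilon>" and pos: "0 < \<epsilon>"
    and U: "\<And>i. i \<in> I \<Longrightarrow> U i \<subseteq> M"
  defines "L \<equiv> leray TYPE('k::field) X f"
  defines "C \<equiv> continuous_extension r I U (cellular_part U (leray TYPE('k) X f))"
  shows "\<exists>\<phi> \<psi>. interleaving M d \<epsilon> C L \<phi> \<psi>"
proof -
  interpret total_nerve_cover X f I U r by (rule nc)
  let ?t = "thickening M d"
  define \<phi> :: "real \<Rightarrow> 'a set \<Rightarrow> nat \<Rightarrow> ('i set \<Rightarrow> ('x, 'k) kchain set) set \<times> ('i set \<Rightarrow> ('x, 'k) kchain set) set
      \<Rightarrow> ('x, 'k) kchain set"
    where "\<phi> a V n = to_leray n (?t a V) (?t (a + \<epsilon>) V)" for a V n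
  define \<psi> :: "real \<Rightarrow> 'a set \<Rightarrow> nat \<Rightarrow> ('x, 'k) kchain set
      \<Rightarrow> ('i set \<Rightarrow> ('x, 'k) kchain set) set \<times> ('i set \<Rightarrow> ('x, 'k) kchain set) set"
    where "\<psi> a V n = from_leray n (?t a V) (?t (a + \<epsilon>) V)" for a V n
  have sub: "V \<subseteq> M" if "openin mtopology V" for V
    using openin_subset[OF that] by simp
  have star: "star_in (?t a V) (?t (a + \<epsilon>) V)" if "0 \<le> a" "openin mtopology V" for a V
    using star_in_thickening[OF nc res pos U sub] that by blast
  have star2: "star_in (?t (a + \<epsilon>) V) (?t (a + 2 * \<epsilon>) V)" if "0 \<le> a" "openin mtopology V" for a V
    using star[of "a + \<epsilon>" V] that pos by (simp add: add.assoc)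
  have mono: "?t a V \<subseteq> ?t b V" if "openin mtopology V" "0 \<le> a" "a \<le> b" for a b V
    using thickening_increasing[OF sub] that by blast
  have "interleaving M d \<epsilon> C L \<phi> \<psi>"
    unfolding interleaving_def Let_def
  proof (intro conjI allI impI ballI; (elim conjE)?)
    fix a :: real assume a: "0 \<le> a"
    show "precosheaf_hom mtopology (shift M d a C) (shift M d (a + \<epsilon>) L) (\<phi> a)"
      unfolding precosheaf_hom_def
    proof (intro conjI allI impI ballI; (elim conjE)?)
      fix V n assume V: "openin mtopology V"
      show "\<phi> a V n \<in> linear_maps (ob (shift M d a C) V n) (ob (shift M d (a + \<epsilon>) L) V n)"
        using to_leray_linear[OF star[OF a V], of n] by (simp add: shift_def \<phi>_def C_def L_def)
    next
      fix V W n x assume VW: "openin mtopology V" "openin mtopology W" "V \<subseteq> W"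
        and x: "x \<in> carrier (ob (shift M d a C) V n)"
      show "\<phi> a W n (mor (shift M d a C) V W n x) = mor (shift M d (a + \<epsilon>) L) V W n (\<phi> a V n x)"
        using to_leray_natural[OF star[OF a VW(1)] star[OF a VW(2)] thickening_mono[OF VW(3)] thickening_mono[OF VW(3)], of x n] x
        by (simp add: shift_def \<phi>_def C_def L_def)
    qed
    show "precosheaf_hom mtopology (shift M d a L) (shift M d (a + \<epsilon>) C) (\<psi> a)"
      unfolding precosheaf_hom_def
    proof (intro conjI allI impI ballI; (elim conjE)?)
      fix V n assume V: "openin mtopology V"
      show "\<psi> a V n \<in> linear_maps (ob (shift M d a L) V n) (ob (shift M d (a + \<epsilon>) C) V n)"
        using from_leray_linear[OF star[OF a V], of n] by (simp add: shift_def \<psi>_def C_def L_def)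
    next
      fix V W n x assume VW: "openin mtopology V" "openin mtopology W" "V \<subseteq> W"
        and x: "x \<in> carrier (ob (shift M d a L) V n)"
      show "\<psi> a W n (mor (shift M d a L) V W n x) = mor (shift M d (a + \<epsilon>) C) V W n (\<psi> a V n x)"
        using from_leray_natural[OF star[OF a VW(1)] star[OF a VW(2)] thickening_mono[OF VW(3)] thickening_mono[OF VW(3)], of x n] x
        by (simp add: shift_def \<psi>_def C_def L_def)
    qed
  next
    fix a b V n x assume a: "0 \<le> a" "a \<le> b" and V: "openin mtopology V"
      and x: "x \<in> carrier (ob (shift M d a C) V n)"
    have b: "a + \<epsilon> \<le> b + \<epsilon>" "0 \<le> b" "0 \<le> a + \<epsilon>" using a pos by auto
    show "\<phi> b V n (shift_map M d a b C V n x) = shift_map M d (a + \<epsilon>) (b + \<epsilon>) L V n (\<phi> a V n x)"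
      using to_leray_natural[OF star[OF a(1) V] star[OF b(2) V] mono[OF V a] mono[OF V b(3,1)], of x n] x
      by (simp add: shift_def shift_map_def \<phi>_def C_def L_def)
  next
    fix a b V n x assume a: "0 \<le> a" "a \<le> b" and V: "openin mtopology V"
      and x: "x \<in> carrier (ob (shift M d a L) V n)"
    have b: "a + \<epsilon> \<le> b + \<epsilon>" "0 \<le> b" "0 \<le> a + \<epsilon>" using a pos by auto
    show "\<psi> b V n (shift_map M d a b L V n x) = shift_map M d (a + \<epsilon>) (b + \<epsilon>) C V n (\<psi> a V n x)"
      using from_leray_natural[OF star[OF a(1) V] star[OF b(2) V] mono[OF V a] mono[OF V b(3,1)], of x n] x
      by (simp add: shift_def shift_map_def \<psi>_def C_def L_def)
  next
    fix a V n x assume a: "0 \<le> a" and V: "openin mtopology V"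
      and x: "x \<in> carrier (ob (shift M d a C) V n)"
    show "\<psi> (a + \<epsilon>) V n (\<phi> a V n x) = shift_map M d a (a + 2 * \<epsilon>) C V n x"
      using from_leray_to_leray[OF star[OF a V] star2[OF a V], of x n] x
      by (simp add: shift_def shift_map_def \<phi>_def \<psi>_def C_def add.assoc)
  next
    fix a V n x assume a: "0 \<le> a" and V: "openin mtopology V"
      and x: "x \<in> carrier (ob (shift M d a L) V n)"
    show "\<phi> (a + \<epsilon>) V n (\<psi> a V n x) = shift_map M d a (a + 2 * \<epsilon>) L V n x"
      using to_leray_from_leray[OF star[OF a V] star2[OF a V], of x n] x
      by (simp add: shift_def shift_map_def \<phi>_def \<psi>_def L_def add.assoc)
  qed
  then show ?thesis by blast
qed

theorem theorem5:
  fixes X :: "'x topology" and f :: "'x \<Rightarrow> 'y"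
    and Y :: "'y set" and d :: "'y \<Rightarrow> 'y \<Rightarrow> real"
    and I :: "'i set" and U :: "'i \<Rightarrow> 'y set" and r :: "'i rel"
  defines "T \<equiv> Metric_space.mtopology Y d"
    and "L \<equiv> leray TYPE('k::field) X f"
    and "C \<equiv> continuous_extension r I U (cellular_part U (leray TYPE('k) X f))"
  assumes "compact_space X" and "Metric_space Y d" and "continuous_map X T f"
    and "\<And>V. openin T V \<Longrightarrow> fin_dim (graded_total (ob L V))"
    and "finite I" and "\<And>i. i \<in> I \<Longrightarrow> openin T (U i)"
    and "f ` topspace X \<subseteq> (\<Union>i\<in>I. U i)"
    and "one_dimensional (nerve I U)"
    and "linear_order_on I r"
    and "constructible T L" and "constructible T C"
  shows "interleaving_distance Y d C L \<le> resolution I U d"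
proof (rule dense_ge)
  \<comment> \<open>It suffices to bound the distance by every \<open>x\<close> above the
    resolution. At the resolution itself two points of one \<open>U i\<close> may be exactly that
    far apart, and the strict inequality of the thickening could fail.\<close>
  fix x assume x: "resolution I U d < x"
  interpret Metric_space Y d by fact
  have nc: "total_nerve_cover X f I U r"
  proof
    show "finite I" "linear_order_on I r" by fact+
    show "openin X {x \<in> topspace X. f x \<in> U i}" if "i \<in> I" for i
      using assms that by (intro openin_continuous_map_preimage) auto
    show "U i \<inter> U j \<inter> U k = {}" if "i \<in> I" "j \<in> I" "k \<in> I" "i \<noteq> j" "j \<noteq> k" "i \<noteq> k" for i j k
    proof (rule ccontr)
      assume "U i \<inter> U j \<inter> U k \<noteq> {}"
      then have "{i, j, k} \<in> simplices_of_dim (nerve I U) 2"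
        using that by (auto simp: simplices_of_dim_def nerve_def)
      then show False
        using \<open>one_dimensional (nerve I U)\<close> by (auto simp: one_dimensional_def)
    qed
    show "\<exists>i\<in>I. f x \<in> U i" if "x \<in> topspace X" for x
      using \<open>f ` topspace X \<subseteq> (\<Union>i\<in>I. U i)\<close> that by auto
  qed
  have U: "U i \<subseteq> Y" if "i \<in> I" for i
    using openin_subset[of T "U i"] assms that by (simp add: T_def)
  show "interleaving_distance Y d C L \<le> x"
  proof (cases x)
    case (real \<epsilon>)
    \<comment> \<open>The resolution is nonnegative, so a value above it is positive and its
      thickening is the metric one rather than the exceptional case of radius 0.\<close>
    have "0 < ennreal \<epsilon>"
      using x real by (metis zero_le le_less_trans)
    then have "0 < \<epsilon>" by simp
    then have "\<exists>\<phi> \<psi>. interleaving Y d \<epsilon> C L \<phi> \<psi>"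
      unfolding C_def L_def using x real by (intro interleaving_of_total_nerve_cover[OF nc _ _ U]) auto
    then show ?thesis
      unfolding interleaving_distance_def using real by (intro Inf_lower) auto
  qed simp
qed

end
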